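(* Let $d\geq 3$ be a fixed integer. If $d$ is odd, then $\alpha_d(N) < N^{\frac{1}{2} + \frac{1}{2d} + o(1)}$. If $d$ is even, then $\alpha_d(N) < N^{\frac{1}{2} + \frac{1}{d-1} + o(1)}$. Here $o(1)$ denotes a quantity tending to $0$ as $N\to\infty$ with $d$ fixed.
   Context: A finite point set in $\mathbb{R}^d$ is in general position if no $d+1$ of its members lie on a common hyperplane. $\alpha_d(N)$ denotes the largest integer such that any set of $N$ points in $\mathbb{R}^d$, with no $d+2$ members on a common hyperplane, contains a subset of $\alpha_d(N)$ points in general position. *)

theory Defs
  imports "HOL-Analysis.Analysis" "HOL-Computational_Algebra.Polynomial"
begin

definition is_hyperplane :: "(real ^ 'n) set \<Rightarrow> bool" where
  "is_hyperplane H \<longleftrightarrow> (\<exists>a b. a \<noteq> 0 \<and> H = {x. a \<bullet> x = b})"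

definition no_members_on_hyperplane :: "nat \<Rightarrow> (real ^ 'n) set \<Rightarrow> bool" where
  "no_members_on_hyperplane k S \<longleftrightarrow>
     \<not> (\<exists>T\<subseteq>S. card T = k \<and> (\<exists>H. is_hyperplane H \<and> T \<subseteq> H))"

definition in_general_position :: "(real ^ 'n) set \<Rightarrow> bool" where
  "in_general_position S \<longleftrightarrow> finite S \<and> no_members_on_hyperplane (CARD('n) + 1) S"

definition guaranteed_size :: "'n::finite itself \<Rightarrow> nat \<Rightarrow> nat \<Rightarrow> bool" where
  "guaranteed_size d N m \<longleftrightarrow>
     (\<forall>S :: (real ^ 'n) set. finite S \<and> card S = N \<and> no_members_on_hyperplane (CARD('n) + 2) S
        \<longrightarrow> (\<exists>T\<subseteq>S. card T = m \<and> in_general_position T))"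

text \<open>The dimension \<open>d\<close> is \<open>CARD('n)\<close>, so \<open>\<alpha>\<^sub>d(N)\<close> is written \<open>alpha TYPE('n) N\<close>.\<close>

definition alpha :: "'n::finite itself \<Rightarrow> nat \<Rightarrow> nat" where
  "alpha d N = (GREATEST m. guaranteed_size d N m)"

text \<open>The operator \<open>GREATEST\<close> only means something here because the admissible \<open>m\<close> are bounded.
  They are: points on the moment curve give, for every \<open>N\<close>, a set satisfying the hypothesis,
  so no \<open>m > N\<close> is guaranteed.\<close>

lemma moment_curve_set:
  "\<exists>S :: (real ^ 'n) set. finite S \<and> card S = N \<and> no_members_on_hyperplane (CARD('n) + 2) S"
proof -
  obtain f :: "'n \<Rightarrow> nat" where f: "bij_betw f UNIV {0..<CARD('n)}"
    using ex_bij_betw_finite_nat[of "UNIV :: 'n set"] by auto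
  have inj_f: "inj f" and f_less: "f i < CARD('n)" for i
    using f by (auto simp: bij_betw_def)
  define c :: "nat \<Rightarrow> real ^ 'n" where "c k = (\<chi> i. real k ^ Suc (f i))" for k
  obtain i0 where i0: "f i0 = 0"
    using f zero_less_card_finite[where 'a='n] unfolding bij_betw_def
    by (metis atLeastLessThan_iff imageE le0)
  have inj_c: "inj c"
  proof (rule injI)
    fix x y assume "c x = c y"
    then have "c x $ i0 = c y $ i0" by simp
    then show "x = y" by (simp add: c_def i0)
  qed
  have few: "finite K \<and> card K \<le> CARD('n)"
    if K: "c ` K \<subseteq> {x. a \<bullet> x = b}" and a: "a \<noteq> 0" for K a b
  proof -
    define p where "p = (\<Sum>i\<in>UNIV. monom (a $ i) (Suc (f i))) - [:b:]"
    have coeff_p: "coeff p (Suc (f j)) = a $ j" for j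
    proof -
      have "coeff p (Suc (f j)) = (\<Sum>i\<in>UNIV. if i = j then a $ i else 0)"
        using inj_f by (auto simp: p_def coeff_sum inj_eq intro!: sum.cong)
      then show ?thesis by simp
    qed
    have "p \<noteq> 0"
      using a coeff_p by (metis coeff_0 vec_eq_iff zero_index)
    have deg: "degree p \<le> CARD('n)"
      unfolding p_def using f_less
      by (intro degree_diff_le degree_sum_le)
        (auto intro: order.trans[OF degree_monom_le] simp: Suc_le_eq)
    have roots: "real ` K \<subseteq> {x. poly p x = 0}"
      using K by (auto simp: p_def poly_sum poly_monom c_def inner_vec_def)
    have fin: "finite (real ` K)"
      using roots poly_roots_finite[OF \<open>p \<noteq> 0\<close>] finite_subset by blast
    have "card (real ` K) \<le> degree p"
      using card_mono[OF poly_roots_finite[OF \<open>p \<noteq> 0\<close>] roots] card_poly_roots_bound[OF \<open>p \<noteq> 0\<close>]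
      by simp
    then show ?thesis
      using fin deg by (simp add: card_image finite_image_iff)
  qed
  have "no_members_on_hyperplane (CARD('n) + 2) (c ` {..<N})"
    unfolding no_members_on_hyperplane_def is_hyperplane_def
  proof clarify
    fix T a b assume T: "T \<subseteq> c ` {..<N}" "card T = CARD('n) + 2" "T \<subseteq> {x. a \<bullet> x = b}"
      and a: "a \<noteq> (0 :: real ^ 'n)"
    obtain K where K: "K \<subseteq> {..<N}" "T = c ` K"
      using T(1) by (meson subset_imageE)
    have "card T = card K"
      using inj_c K(2) by (simp add: card_image inj_on_subset)
    then show False using few[of K a b] a T K by simp
  qed
  then show ?thesis
    using inj_c by (intro exI[of _ "c ` {..<N}"]) (simp add: card_image inj_on_subset)
qed

lemma guaranteed_size_le:
  assumes "guaranteed_size (d :: 'n::finite itself) N m"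
  shows "m \<le> N"
proof -
  obtain S :: "(real ^ 'n) set" where
    S: "finite S" "card S = N" "no_members_on_hyperplane (CARD('n) + 2) S"
    using moment_curve_set by blast
  then obtain T where "T \<subseteq> S" "card T = m"
    using assms unfolding guaranteed_size_def by blast
  then show ?thesis
    using card_mono[OF S(1)] S(2) by blast
qed

lemma guaranteed_size_0: "guaranteed_size d N 0"
  unfolding guaranteed_size_def in_general_position_def no_members_on_hyperplane_def
  by (intro allI impI exI[of _ "{}"]) auto

lemma guaranteed_size_alpha: "guaranteed_size d N (alpha d N)"
  unfolding alpha_def
  by (rule GreatestI_nat[where P = "guaranteed_size d N", OF guaranteed_size_0 guaranteed_size_le])

lemma le_alpha: "guaranteed_size d N m \<Longrightarrow> m \<le> alpha d N"
  unfolding alpha_def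
  by (rule Greatest_le_nat[where P = "guaranteed_size d N", OF _ guaranteed_size_le])

end

theory Submission
  imports Defs "HOL-Real_Asymp.Real_Asymp"
begin

text \<open>
  Let \<open>d\<close> be the dimension, let \<open>q = 2 r\<close> be the even one of the numbers \<open>d\<close> and \<open>d + 1\<close>, and let
  \<open>\<theta> = (d + 1) / (2 (q - 1))\<close>. Both exponents of the theorem are equal to \<open>\<theta>\<close>.

  A set of at least \<open>d + 1\<close> points in general position contains no two disjoint \<open>r\<close>-sets of equal
  sum, because such a pair is an affine dependence among \<open>q \<le> d + 1\<close> points
  (\<open>general_position_imp_sum_free\<close>). Hence it is enough to find \<open>N\<close> points with no \<open>d + 2\<close> on a
  hyperplane such that any \<open>N ^ (\<theta> + o(1))\<close> of them contain two disjoint \<open>r\<close>-sets of equal sum.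
  These points are a random sample of the image of a grid \<open>{0, \<dots>, k - 1} ^ D\<close> under a generic linear
  map into the \<open>d\<close>-dimensional space. The number \<open>k\<close> is a large constant and \<open>D\<close> tends to infinity.
  Write \<open>M = k ^ D\<close>.

  Few sets of \<open>d + 2\<close> grid points are mapped into a hyperplane. By genericity such points lie on a
  flat of dimension \<open>d - 1\<close> before the projection. Arrange their coordinates in a matrix with \<open>d + 2\<close>
  columns; then all its \<open>D\<close> rows lie in a subspace of dimension at most \<open>d\<close>, which contains at most
  \<open>k ^ d\<close> vectors with entries in \<open>{0, \<dots>, k - 1}\<close>. Since \<open>k\<close> is fixed, there are only
  boundedly many possibilities for these vectors, and so \<open>O(M ^ d)\<close> such sets
  (\<open>card_low_rank_le\<close>). A random sample of \<open>2 N\<close> grid points, where \<open>N\<close> is a small multiple of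
  \<open>M ^ (2 / (d + 1))\<close>, contains at most \<open>N\<close> of them after a suitable choice, and deleting one
  point from each leaves \<open>N\<close> points (\<open>sparse_sample\<close>).

  Sums of \<open>r\<close> grid points take at most \<open>(r k) ^ D\<close> values, which is \<open>M ^ (1 + o(1))\<close> as \<open>k\<close>
  grows. By the Cauchy--Schwarz inequality every large subset \<open>U\<close> of the grid therefore contains at
  least \<open>|U| ^ q / M ^ (1 + o(1))\<close> unions of two disjoint \<open>r\<close>-sets of equal sum
  (\<open>card_sum_edges_ge\<close>). These unions form a \<open>q\<close>-uniform hypergraph with small codegrees, because
  \<open>q - 1\<close> elements of an edge determine the last one up to finitely many choices. The method of
  hypergraph containers (\<open>weighted_containers\<close>, applied repeatedly in \<open>sum_free_containers\<close>) yields
  \<open>exp (M ^ (1 / (q - 1) + o(1)))\<close> subsets of the grid, each of size at most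
  \<open>M ^ (1 + 1 / (q - 1) + o(1)) / N\<close>, that cover all sets without two disjoint \<open>r\<close>-sets of equal
  sum. A random sample of \<open>2 N\<close> points meets such a container in at most
  \<open>M ^ (1 / (q - 1) + o(1))\<close> points on average, and \<open>M ^ (1 / (q - 1))\<close> is \<open>N ^ \<theta>\<close> up to a constant
  factor. A union bound over the containers shows that with probability more than \<open>1 / 2\<close> no
  container contains \<open>N ^ (\<theta> + o(1))\<close> points of the sample.
\<close>

section \<open>Containers for weighted hypergraphs\<close>

text \<open>
  The argument \<open>\<mu>\<close> is a weighted hypergraph on the vertex set \<open>V\<close>. For a singleton \<open>T\<close> this is
  the degree of a vertex, for larger \<open>T\<close> a codegree, and for \<open>T = {}\<close> the total weight.
\<close>

definition wdeg :: "'a set \<Rightarrow> ('a set \<Rightarrow> real) \<Rightarrow> 'a set \<Rightarrow> real" where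
  "wdeg V \<mu> T = (\<Sum>E | E \<subseteq> V \<and> T \<subseteq> E. \<mu> E)"

text \<open>
  What remains of \<open>\<mu>\<close> after the vertices \<open>vs\<close> have been picked and the link \<open>\<nu>\<close> has been built
  from them: an edge is discarded once it meets a picked vertex or contains a set whose degree in
  \<open>\<nu>\<close> has reached the cap \<open>\<theta>\<close>. Discarding the second kind keeps all codegrees of \<open>\<nu>\<close> bounded.
\<close>

definition residual ::
  "(nat \<Rightarrow> real) \<Rightarrow> 'a set \<Rightarrow> ('a set \<Rightarrow> real) \<Rightarrow> 'a list \<Rightarrow> ('a set \<Rightarrow> real) \<Rightarrow> 'a set \<Rightarrow> real" where
  "residual \<theta> V \<mu> vs \<nu> E =
     (if E \<inter> set vs = {} \<and> (\<forall>T\<subseteq>E. T \<noteq> {} \<longrightarrow> wdeg V \<nu> T < \<theta> (card T)) then \<mu> E else 0)"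

text \<open>
  The weighted hypergraph, of uniformity one less, that collects the links of the picked vertices
  in what remained of \<open>\<mu>\<close> at the time of each pick. The last pick is the head of the list.
\<close>

primrec link ::
  "(nat \<Rightarrow> real) \<Rightarrow> 'a set \<Rightarrow> ('a set \<Rightarrow> real) \<Rightarrow> 'a list \<Rightarrow> 'a set \<Rightarrow> real" where
  "link \<theta> V \<mu> [] = (\<lambda>F. 0)"
| "link \<theta> V \<mu> (v # vs) =
     (\<lambda>F. link \<theta> V \<mu> vs F +
       (if v \<in> F then 0 else residual \<theta> V \<mu> vs (link \<theta> V \<mu> vs) (insert v F)))"

abbreviation rest ::
  "(nat \<Rightarrow> real) \<Rightarrow> 'a set \<Rightarrow> ('a set \<Rightarrow> real) \<Rightarrow> 'a list \<Rightarrow> 'a set \<Rightarrow> real" where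
  "rest \<theta> V \<mu> vs \<equiv> residual \<theta> V \<mu> vs (link \<theta> V \<mu> vs)"

definition uniform_weight :: "nat \<Rightarrow> 'a set \<Rightarrow> ('a set \<Rightarrow> real) \<Rightarrow> bool" where
  "uniform_weight l V \<mu> \<longleftrightarrow> (\<forall>E. \<mu> E \<ge> 0) \<and> (\<forall>E. \<mu> E \<noteq> 0 \<longrightarrow> E \<subseteq> V \<and> card E = l)"

text \<open>
  When \<open>w\<close> is the total weight, the condition says that, up to the factor \<open>K\<close>, a random edge is
  no more likely to contain a given \<open>T\<close> than if, with \<open>p = L / |V|\<close>, the first vertex of \<open>T\<close> cost
  a factor \<open>1 / |V|\<close> and each further one a factor \<open>p\<close>.
\<close>

definition spread :: "real \<Rightarrow> nat \<Rightarrow> 'a set \<Rightarrow> real \<Rightarrow> ('a set \<Rightarrow> real) \<Rightarrow> bool" where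
  "spread K L V w \<mu> \<longleftrightarrow> w \<le> wdeg V \<mu> {} \<and>
     (\<forall>T\<subseteq>V. T \<noteq> {} \<longrightarrow>
       wdeg V \<mu> T \<le> K * w * (real L / real (card V)) ^ (card T - 1) / real (card V))"

definition weight_independent :: "('a set \<Rightarrow> real) \<Rightarrow> 'a set \<Rightarrow> bool" where
  "weight_independent \<mu> I \<longleftrightarrow> (\<forall>E\<subseteq>I. \<mu> E = 0)"

lemma finite_supersets: "finite V \<Longrightarrow> finite {E. E \<subseteq> V \<and> P E}"
  by (rule finite_subset[of _ "Pow V"]) auto

lemma wdeg_eq_sum_Pow:
  assumes "finite V"
  shows "wdeg V \<mu> T = (\<Sum>E\<in>Pow V. if T \<subseteq> E then \<mu> E else 0)"
  unfolding wdeg_def using assms by (intro sum.mono_neutral_cong_left) auto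

lemma wdeg_mono:
  assumes "\<And>E. \<mu> E \<le> \<mu>' E"
  shows "wdeg V \<mu> T \<le> wdeg V \<mu>' T"
  unfolding wdeg_def by (rule sum_mono) (rule assms)

lemma wdeg_nonneg:
  assumes "\<And>E. \<mu> E \<ge> 0"
  shows "wdeg V \<mu> T \<ge> 0"
  unfolding wdeg_def by (rule sum_nonneg) (rule assms)

lemma residual_nonneg: "(\<And>E. \<mu> E \<ge> 0) \<Longrightarrow> residual \<theta> V \<mu> vs \<nu> E \<ge> 0"
  by (simp add: residual_def)

lemma residual_le: "(\<And>E. \<mu> E \<ge> 0) \<Longrightarrow> residual \<theta> V \<mu> vs \<nu> E \<le> \<mu> E"
  by (simp add: residual_def)

lemma link_nonneg: "(\<And>E. \<mu> E \<ge> 0) \<Longrightarrow> link \<theta> V \<mu> vs F \<ge> 0"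
  by (induction vs arbitrary: F) (auto simp: residual_nonneg)

lemma link_support:
  assumes "link \<theta> V \<mu> vs F \<noteq> 0"
  shows "\<exists>v\<in>set vs. v \<notin> F \<and> \<mu> (insert v F) \<noteq> 0"
  using assms
proof (induction vs)
  case (Cons v vs)
  show ?case
  proof (cases "link \<theta> V \<mu> vs F = 0")
    case True
    then have "v \<notin> F" "rest \<theta> V \<mu> vs (insert v F) \<noteq> 0"
      using Cons.prems by (auto split: if_splits)
    then show ?thesis by (auto simp: residual_def split: if_splits)
  next
    case False
    then show ?thesis using Cons.IH by auto
  qed
qed simp

lemma uniform_weight_link:
  assumes "uniform_weight (Suc l) V \<mu>" "finite V"
  shows "uniform_weight l V (link \<theta> V \<mu> vs)"
  unfolding uniform_weight_def
proof (intro conjI allI impI)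
  fix E show "link \<theta> V \<mu> vs E \<ge> 0"
    using assms by (intro link_nonneg) (auto simp: uniform_weight_def)
next
  fix F assume "link \<theta> V \<mu> vs F \<noteq> 0"
  from link_support[OF this] obtain v where v: "v \<notin> F" "\<mu> (insert v F) \<noteq> 0"
    by blast
  then have *: "insert v F \<subseteq> V" "card (insert v F) = Suc l"
    using assms by (auto simp: uniform_weight_def)
  have "finite (insert v F)" using *(1) assms(2) by (rule finite_subset)
  then show "F \<subseteq> V" "card F = l" using * v(1) by auto
qed

lemma weight_independent_link:
  assumes "weight_independent \<mu> I" "set vs \<subseteq> I"
  shows "weight_independent (link \<theta> V \<mu> vs) I"
  unfolding weight_independent_def
proof (intro allI impI, rule ccontr)
  fix F assume "F \<subseteq> I" "link \<theta> V \<mu> vs F \<noteq> 0"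
  from link_support[OF this(2)] obtain v where v: "v \<in> set vs" "\<mu> (insert v F) \<noteq> 0"
    by blast
  have "insert v F \<subseteq> I" using v(1) \<open>F \<subseteq> I\<close> assms(2) by blast
  then show False using v(2) assms(1) by (simp add: weight_independent_def)
qed

lemma link_contribution:
  assumes "finite V" "v \<in> V" "v \<notin> T"
  shows "(\<Sum>F | F \<subseteq> V \<and> T \<subseteq> F. if v \<in> F then 0 else \<rho> (insert v F)) = wdeg V \<rho> (insert v T)"
proof -
  have "(\<Sum>F | F \<subseteq> V \<and> T \<subseteq> F. if v \<in> F then 0 else \<rho> (insert v F))
      = (\<Sum>F | F \<subseteq> V \<and> T \<subseteq> F \<and> v \<notin> F. \<rho> (insert v F))"
    using finite_supersets[OF assms(1)]
    by (intro sum.mono_neutral_cong_right) auto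
  also have "\<dots> = wdeg V \<rho> (insert v T)"
    unfolding wdeg_def using assms
    by (intro sum.reindex_bij_witness[where i = "\<lambda>E. E - {v}" and j = "insert v"]) auto
  finally show ?thesis .
qed

lemma wdeg_link_Cons:
  assumes "finite V" "v \<in> V" "v \<notin> T"
  shows "wdeg V (link \<theta> V \<mu> (v # vs)) T
    = wdeg V (link \<theta> V \<mu> vs) T + wdeg V (rest \<theta> V \<mu> vs) (insert v T)"
  using link_contribution[OF assms, of "rest \<theta> V \<mu> vs"]
  by (simp add: wdeg_def sum.distrib)

lemma wdeg_link_Cons_mem:
  assumes "v \<in> T"
  shows "wdeg V (link \<theta> V \<mu> (v # vs)) T = wdeg V (link \<theta> V \<mu> vs) T"
  using assms unfolding wdeg_def by (intro sum.cong) auto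

lemma rest_Cons_le:
  assumes "\<And>E. \<mu> E \<ge> 0"
  shows "rest \<theta> V \<mu> (v # vs) E \<le> rest \<theta> V \<mu> vs E"
proof -
  have "wdeg V (link \<theta> V \<mu> vs) T \<le> wdeg V (link \<theta> V \<mu> (v # vs)) T" for T
    by (rule wdeg_mono) (use assms in \<open>auto simp: residual_nonneg\<close>)
  then have "wdeg V (link \<theta> V \<mu> vs) T < \<theta> (card T)"
    if "wdeg V (link \<theta> V \<mu> (v # vs)) T < \<theta> (card T)" for T
    using that order.strict_trans1 by blast
  then have "E \<inter> set vs = {} \<and> (\<forall>T\<subseteq>E. T \<noteq> {} \<longrightarrow> wdeg V (link \<theta> V \<mu> vs) T < \<theta> (card T))"
    if "E \<inter> set (v # vs) = {} \<and>
      (\<forall>T\<subseteq>E. T \<noteq> {} \<longrightarrow> wdeg V (link \<theta> V \<mu> (v # vs)) T < \<theta> (card T))"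
    using that by (metis Int_insert_right insert_not_empty list.simps(15))
  moreover have ite: "(if P then x else 0) \<le> (if Q then x else 0)" if "P \<Longrightarrow> Q" "0 \<le> x"
    for P Q and x :: real
    using that by simp
  ultimately show ?thesis
    unfolding residual_def[of _ _ _ "v # vs"] residual_def[of _ _ _ vs]
    by (intro ite assms)
qed

text \<open>
  One pick raises the degree of \<open>T\<close> in the link by at most the cap, and nothing is added after the
  cap has been reached, so the degree can overshoot the cap only once.
\<close>

lemma wdeg_link_le:
  assumes "finite V" "set vs \<subseteq> V" "T \<subseteq> V" "T \<noteq> {}" "\<And>E. \<mu> E \<ge> 0" "\<theta> (card T) \<ge> 0"
    and deg: "\<And>v. v \<in> V \<Longrightarrow> v \<notin> T \<Longrightarrow> wdeg V \<mu> (insert v T) \<le> \<theta> (card T)"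
  shows "wdeg V (link \<theta> V \<mu> vs) T \<le> 2 * \<theta> (card T)"
  using assms(2)
proof (induction vs)
  case Nil
  then show ?case using assms(6) by (simp add: wdeg_def)
next
  case (Cons v vs)
  show ?case
  proof (cases "v \<in> T")
    case True
    then show ?thesis using Cons by (simp add: wdeg_link_Cons_mem del: link.simps)
  next
    case False
    have v: "v \<in> V" using Cons.prems by simp
    show ?thesis
    proof (cases "wdeg V (link \<theta> V \<mu> vs) T < \<theta> (card T)")
      case True
      have "wdeg V (rest \<theta> V \<mu> vs) (insert v T) \<le> wdeg V \<mu> (insert v T)"
        by (intro wdeg_mono residual_le assms(5))
      then show ?thesis
        using deg[OF v False] True wdeg_link_Cons[OF assms(1) v False, of \<theta> \<mu> vs]
        by linarith
    next
      case sat: False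
      have "rest \<theta> V \<mu> vs E = 0" if "T \<subseteq> E" for E
        using that sat assms(4) unfolding residual_def by auto
      then have "wdeg V (rest \<theta> V \<mu> vs) (insert v T) = 0"
        unfolding wdeg_def by (intro sum.neutral) auto
      then show ?thesis
        using Cons.IH Cons.prems wdeg_link_Cons[OF assms(1) v False, of \<theta> \<mu> vs] by simp
    qed
  qed
qed

text \<open>
  Every edge of an \<open>l\<close>-uniform hypergraph is counted once for each of its \<open>2 ^ l\<close> subsets.
\<close>

lemma sum_wdeg:
  assumes "finite V" "uniform_weight l V \<nu>"
  shows "(\<Sum>T\<in>Pow V. wdeg V \<nu> T) = 2 ^ l * wdeg V \<nu> {}"
proof -
  have "(\<Sum>T\<in>Pow V. wdeg V \<nu> T) = (\<Sum>T\<in>Pow V. \<Sum>E\<in>Pow V. if T \<subseteq> E then \<nu> E else 0)"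
    by (simp add: wdeg_eq_sum_Pow[OF assms(1)])
  also have "\<dots> = (\<Sum>E\<in>Pow V. \<Sum>T\<in>Pow V. if T \<subseteq> E then \<nu> E else 0)"
    by (rule sum.swap)
  also have "\<dots> = (\<Sum>E\<in>Pow V. 2 ^ l * \<nu> E)"
  proof (intro sum.cong refl)
    fix E assume E: "E \<in> Pow V"
    then have fin: "finite E" using assms(1) finite_subset by blast
    have "(\<Sum>T\<in>Pow V. if T \<subseteq> E then \<nu> E else 0) = (\<Sum>T\<in>Pow E. \<nu> E)"
      using E assms(1) by (intro sum.mono_neutral_cong_right) auto
    also have "\<dots> = 2 ^ card E * \<nu> E" using fin by (simp add: card_Pow)
    also have "\<dots> = 2 ^ l * \<nu> E"
      using assms(2) unfolding uniform_weight_def by (cases "\<nu> E = 0") auto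
    finally show "(\<Sum>T\<in>Pow V. if T \<subseteq> E then \<nu> E else 0) = 2 ^ l * \<nu> E" .
  qed
  also have "\<dots> = 2 ^ l * wdeg V \<nu> {}"
    by (simp add: wdeg_def sum_distrib_left Pow_def)
  finally show ?thesis .
qed

lemma sum_wdeg_singleton:
  assumes "finite V" "\<And>E. \<mu> E \<noteq> 0 \<Longrightarrow> E \<subseteq> V \<and> card E = l"
  shows "(\<Sum>v\<in>V. wdeg V \<mu> {v}) = real l * wdeg V \<mu> {}"
proof -
  have "(\<Sum>v\<in>V. wdeg V \<mu> {v}) = (\<Sum>v\<in>V. \<Sum>E\<in>Pow V. if v \<in> E then \<mu> E else 0)"
    by (simp add: wdeg_eq_sum_Pow[OF assms(1)])
  also have "\<dots> = (\<Sum>E\<in>Pow V. \<Sum>v\<in>V. if v \<in> E then \<mu> E else 0)"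
    by (rule sum.swap)
  also have "\<dots> = (\<Sum>E\<in>Pow V. real l * \<mu> E)"
  proof (intro sum.cong refl)
    fix E assume E: "E \<in> Pow V"
    then have "(\<Sum>v\<in>V. if v \<in> E then \<mu> E else 0) = (\<Sum>v\<in>E. \<mu> E)"
      using assms(1) by (intro sum.mono_neutral_cong_right) auto
    also have "\<dots> = real l * \<mu> E"
      using assms(2)[of E] by (cases "\<mu> E = 0") auto
    finally show "(\<Sum>v\<in>V. if v \<in> E then \<mu> E else 0) = real l * \<mu> E" .
  qed
  also have "\<dots> = real l * wdeg V \<mu> {}"
    by (simp add: wdeg_def sum_distrib_left Pow_def)
  finally show ?thesis .
qed

text \<open>
  Always pick the vertex of \<open>I\<close> of largest remaining degree. Remaining degrees only decrease, so
  after \<open>i\<close> picks no vertex of \<open>I\<close> has a degree larger than any of the \<open>i\<close> contributions that make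
  up the weight of the link.
\<close>

lemma greedy_picks:
  assumes "finite V" "I \<subseteq> V" "I \<noteq> {}" "\<And>E. \<mu> E \<ge> 0"
  shows "\<exists>vs. length vs = i \<and> set vs \<subseteq> I \<and>
    (\<forall>u\<in>I. real i * wdeg V (rest \<theta> V \<mu> vs) {u} \<le> wdeg V (link \<theta> V \<mu> vs) {})"
proof (induction i)
  case 0
  then show ?case by (simp add: wdeg_def)
next
  case (Suc i)
  then obtain vs where vs: "length vs = i" "set vs \<subseteq> I"
    and le: "\<And>u. u \<in> I \<Longrightarrow> real i * wdeg V (rest \<theta> V \<mu> vs) {u} \<le> wdeg V (link \<theta> V \<mu> vs) {}"
    by blast
  have finI: "finite I" using assms finite_subset by blast
  define f where "f u = wdeg V (rest \<theta> V \<mu> vs) {u}" for u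
  have "Max (f ` I) \<in> f ` I" using finI assms(3) by (intro Max_in) auto
  then obtain v where v: "v \<in> I" "f v = Max (f ` I)" by auto
  have fv: "f u \<le> f v" if "u \<in> I" for u
    using v(2) finI that by simp
  have "real (Suc i) * wdeg V (rest \<theta> V \<mu> (v # vs)) {u} \<le> wdeg V (link \<theta> V \<mu> (v # vs)) {}"
    if u: "u \<in> I" for u
  proof -
    have *: "wdeg V (rest \<theta> V \<mu> (v # vs)) {u} \<le> f u"
      unfolding f_def by (intro wdeg_mono rest_Cons_le assms(4))
    have "real (Suc i) * wdeg V (rest \<theta> V \<mu> (v # vs)) {u} \<le> real (Suc i) * f u"
      by (rule mult_left_mono[OF *]) simp
    also have "\<dots> \<le> real i * f u + f v"
      using fv[OF u] by (simp add: algebra_simps)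
    also have "\<dots> \<le> wdeg V (link \<theta> V \<mu> vs) {} + f v"
      using le[OF u] by (simp add: f_def)
    also have "\<dots> = wdeg V (link \<theta> V \<mu> (v # vs)) {}"
      unfolding f_def using v(1) assms(1,2) by (subst wdeg_link_Cons) auto
    finally show ?thesis .
  qed
  then show ?case using vs v(1) by (intro exI[of _ "v # vs"]) auto
qed

text \<open>
  Little is discarded while the link is light. The picked vertices carry little weight because
  degrees are bounded. A saturated set \<open>T\<close> has weight at most \<open>1 / p\<close> times its degree in the link,
  and these degrees sum to at most \<open>2 ^ l\<close> times the weight of the link.
\<close>

lemma rest_total:
  assumes "finite V" "V \<noteq> {}" "uniform_weight (Suc l) V \<mu>" "spread K L V w \<mu>"
    and "K > 0" "w > 0" "L > 0" "set vs \<subseteq> V" "length vs = L"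
    and "p = real L / real (card V)"
    and \<theta>: "\<And>j. \<theta> j = K * w * p ^ j / real (card V)"
  shows "wdeg V (rest \<theta> V \<mu> vs) {} \<ge> w - K * w * p - 2 ^ l * wdeg V (link \<theta> V \<mu> vs) {} / p"
proof -
  let ?n = "real (card V)"
  let ?\<nu> = "link \<theta> V \<mu> vs"
  have n: "?n > 0" using assms(1,2) by (simp add: card_gt_0_iff)
  have p: "p > 0" using n assms by simp
  have nn: "\<mu> E \<ge> 0" for E using assms(3) by (simp add: uniform_weight_def)
  define Sat where "Sat = {T. T \<subseteq> V \<and> T \<noteq> {} \<and> wdeg V ?\<nu> T \<ge> \<theta> (card T)}"
  have finSat: "finite Sat" unfolding Sat_def by (rule finite_supersets[OF assms(1)])
  \<comment> \<open>an edge either remains, or meets a pick, or contains a saturated set\<close>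
  have pt: "\<mu> E \<le> rest \<theta> V \<mu> vs E + (\<Sum>v\<in>set vs. if v \<in> E then \<mu> E else 0)
       + (\<Sum>T\<in>Sat. if T \<subseteq> E then \<mu> E else 0)" if E: "E \<subseteq> V" for E
  proof (cases "E \<inter> set vs = {}")
    case False
    then obtain v where v: "v \<in> set vs" "v \<in> E" by auto
    have "(if v \<in> E then \<mu> E else 0) \<le> (\<Sum>v\<in>set vs. if v \<in> E then \<mu> E else 0)"
      using v nn by (intro member_le_sum) auto
    moreover have "(\<Sum>T\<in>Sat. if T \<subseteq> E then \<mu> E else 0) \<ge> 0" using nn by (intro sum_nonneg) auto
    ultimately show ?thesis using v residual_nonneg[of \<mu> \<theta> V vs ?\<nu> E] nn by auto
  next
    case disj: True
    have s1: "(\<Sum>v\<in>set vs. if v \<in> E then \<mu> E else 0) \<ge> 0" using nn by (intro sum_nonneg) auto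
    have s2: "(\<Sum>T\<in>Sat. if T \<subseteq> E then \<mu> E else 0) \<ge> 0" using nn by (intro sum_nonneg) auto
    show ?thesis
    proof (cases "\<forall>T\<subseteq>E. T \<noteq> {} \<longrightarrow> wdeg V ?\<nu> T < \<theta> (card T)")
      case True
      then have "rest \<theta> V \<mu> vs E = \<mu> E" using disj by (simp add: residual_def)
      then show ?thesis using s1 s2 by linarith
    next
      case False
      then obtain T where T: "T \<subseteq> E" "T \<in> Sat" using E by (auto simp: Sat_def not_less)
      have "(if T \<subseteq> E then \<mu> E else 0) \<le> (\<Sum>T\<in>Sat. if T \<subseteq> E then \<mu> E else 0)"
        using T nn finSat by (intro member_le_sum) auto
      then show ?thesis using T s1 residual_nonneg[of \<mu> \<theta> V vs ?\<nu> E] nn by auto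
    qed
  qed
  have swap: "(\<Sum>E\<in>Pow V. \<Sum>T\<in>X. if f T \<subseteq> E then \<mu> E else 0) = (\<Sum>T\<in>X. wdeg V \<mu> (f T))"
    for X :: "'b set" and f :: "'b \<Rightarrow> 'a set"
    by (subst sum.swap) (simp add: wdeg_eq_sum_Pow[OF assms(1)])
  have "w \<le> (\<Sum>E\<in>Pow V. \<mu> E)"
    using assms(4) by (simp add: spread_def wdeg_def Pow_def)
  also have "\<dots> \<le> (\<Sum>E\<in>Pow V. rest \<theta> V \<mu> vs E + (\<Sum>v\<in>set vs. if {v} \<subseteq> E then \<mu> E else 0)
       + (\<Sum>T\<in>Sat. if T \<subseteq> E then \<mu> E else 0))"
    using pt by (intro sum_mono) auto
  also have "\<dots> = wdeg V (rest \<theta> V \<mu> vs) {} + (\<Sum>v\<in>set vs. wdeg V \<mu> {v}) + (\<Sum>T\<in>Sat. wdeg V \<mu> T)"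
    unfolding sum.distrib swap[of "\<lambda>v. {v}"] swap[of "\<lambda>T. T"] by (simp add: wdeg_def Pow_def)
  finally have main: "w \<le> \<dots>" .
  have deg: "wdeg V \<mu> T \<le> K * w * p ^ (card T - 1) / ?n" if "T \<subseteq> V" "T \<noteq> {}" for T
    using assms(4,10) that by (simp add: spread_def)
  have "(\<Sum>v\<in>set vs. wdeg V \<mu> {v}) \<le> (\<Sum>v\<in>set vs. K * w / ?n)"
    using deg[of "{v}" for v] assms(8) by (intro sum_mono) fastforce
  also have "\<dots> = real (card (set vs)) * (K * w / ?n)" by simp
  also have "\<dots> \<le> real L * (K * w / ?n)"
    using card_length[of vs] assms n by (intro mult_right_mono) auto
  also have "\<dots> = K * w * p" using assms(10) by simp
  finally have A: "(\<Sum>v\<in>set vs. wdeg V \<mu> {v}) \<le> K * w * p" .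
  have "(\<Sum>T\<in>Sat. wdeg V \<mu> T) \<le> (\<Sum>T\<in>Sat. wdeg V ?\<nu> T / p)"
  proof (rule sum_mono)
    fix T assume T: "T \<in> Sat"
    then have T': "T \<subseteq> V" "T \<noteq> {}" "\<theta> (card T) \<le> wdeg V ?\<nu> T" by (auto simp: Sat_def)
    have "card T > 0" using T' assms(1) finite_subset by (auto simp: card_gt_0_iff)
    then have "p ^ (card T - 1) = p ^ card T / p" using p by (cases "card T") auto
    then have "K * w * p ^ (card T - 1) / ?n = \<theta> (card T) / p" by (simp add: \<theta>)
    then show "wdeg V \<mu> T \<le> wdeg V ?\<nu> T / p"
      using deg[OF T'(1,2)] T'(3) p by (smt (verit) divide_right_mono)
  qed
  also have "\<dots> \<le> (\<Sum>T\<in>Pow V. wdeg V ?\<nu> T / p)"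
    using p assms(1) wdeg_nonneg[of ?\<nu> V] link_nonneg[of \<mu>] nn
    by (intro sum_mono2) (auto simp: Sat_def)
  also have "\<dots> = 2 ^ l * wdeg V ?\<nu> {} / p"
    using sum_wdeg[OF assms(1) uniform_weight_link[OF assms(3,1)], of \<theta> vs]
    by (simp flip: sum_divide_distrib)
  finally show ?thesis using main A by linarith
qed

text \<open>
  The container theorem, by induction on the uniformity. Given an independent set \<open>I\<close>, make \<open>L\<close>
  greedy picks in \<open>I\<close>. The link of the picks is again spread, with \<open>K\<close> replaced by \<open>2 K / c\<close>, and
  \<open>I\<close> is independent in it; if the link is heavy, the induction hypothesis applies to it. If the
  link is light, every vertex of \<open>I\<close> has small remaining degree. Since most of the weight remains,
  and no degree exceeds \<open>K w / |V|\<close>, at least \<open>|V| / (4 K)\<close> vertices do not have small remaining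
  degree, and the others form a container. In both cases the containers depend only on the list of
  picks, which bounds their number by the number of such lists.
\<close>

theorem weighted_containers:
  fixes V :: "'a set" and c :: real
  assumes V: "finite V" "V \<noteq> {}" and L: "L > 0" and c: "c > 0" "c \<le> 1 / 4" "2 ^ l * c \<le> 1 / 4"
    and "K > 0" "w > 0" "uniform_weight l V \<mu>" "spread K L V w \<mu>"
    and "4 * (K * (2 / c) ^ l) * real L \<le> real (card V)"
  shows "\<exists>\<C>. finite \<C> \<and> card \<C> \<le> card V ^ (l * L) \<and>
    (\<forall>C\<in>\<C>. C \<subseteq> V \<and> real (card C) \<le> (1 - 1 / (4 * (K * (2 / c) ^ l))) * real (card V)) \<and>
    (\<forall>I\<subseteq>V. I \<noteq> {} \<longrightarrow> weight_independent \<mu> I \<longrightarrow> (\<exists>C\<in>\<C>. I \<subseteq> C))"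
  using c(3) assms(7-)
proof (induction l arbitrary: K w \<mu>)
  case 0
  have "\<mu> {} \<noteq> 0"
  proof
    assume z: "\<mu> {} = 0"
    have "\<mu> E = 0" for E
    proof (rule ccontr)
      assume nz: "\<mu> E \<noteq> 0"
      then have "E \<subseteq> V" "card E = 0" using 0 unfolding uniform_weight_def by auto
      then have "E = {}" using V(1) finite_subset by fastforce
      then show False using nz z by simp
    qed
    then show False using 0 by (simp add: spread_def wdeg_def)
  qed
  then show ?case by (intro exI[of _ "{}"]) (auto simp: weight_independent_def)
next
  case (Suc l)
  let ?n = "real (card V)"
  define p where "p = real L / ?n"
  define \<theta> where "\<theta> j = K * w * p ^ j / ?n" for j
  \<comment> \<open>in the heavy case the codegrees of the link are at most \<open>2 * \<theta>\<close> and its weight is at least \<open>w'\<close>,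
    so the spread constant grows by the factor \<open>2 / c\<close>\<close>
  define K' where "K' = K * (2 / c)"
  define w' where "w' = c * p * w"
  define F where "F = K * (2 / c) ^ Suc l"
  have n: "?n > 0" using V by (simp add: card_gt_0_iff)
  have p: "p > 0" using n L by (simp add: p_def)
  have nn: "\<mu> E \<ge> 0" for E using Suc.prems(4) by (simp add: uniform_weight_def)
  have F': "K' * (2 / c) ^ l = F" by (simp add: K'_def F_def)
  have KF: "K \<le> F"
  proof -
    have "1 \<le> 2 / c" using c by (simp add: field_simps)
    then have "1 \<le> (2 / c) ^ Suc l" by (rule one_le_power)
    then show ?thesis using Suc.prems(2) mult_left_mono[of 1 "(2 / c) ^ Suc l" K] by (simp add: F_def)
  qed
  have Fpos: "F > 0" using KF Suc.prems(2) by linarith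
  have Kp: "K * p \<le> 1 / 4"
  proof -
    have "4 * K * real L \<le> 4 * F * real L" using KF by (simp add: mult_right_mono)
    also have "\<dots> \<le> ?n" using Suc.prems(6) by (simp add: F_def)
    finally show ?thesis using n by (simp add: p_def field_simps)
  qed
  have deg: "wdeg V \<mu> T \<le> K * w * p ^ (card T - 1) / ?n" if "T \<subseteq> V" "T \<noteq> {}" for T
    using Suc.prems(5) that by (simp add: spread_def p_def)
  have \<theta>0: "\<theta> j \<ge> 0" for j using Suc.prems p n by (simp add: \<theta>_def)
  define good where "good \<C> \<nu> \<longleftrightarrow> finite \<C> \<and> card \<C> \<le> card V ^ (l * L) \<and>
    (\<forall>C\<in>\<C>. C \<subseteq> V \<and> real (card C) \<le> (1 - 1 / (4 * F)) * ?n) \<and>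
    (\<forall>I\<subseteq>V. I \<noteq> {} \<longrightarrow> weight_independent \<nu> I \<longrightarrow> (\<exists>C\<in>\<C>. I \<subseteq> C))"
    for \<C> :: "'a set set" and \<nu>
  define low where "low vs = {u \<in> V. wdeg V (rest \<theta> V \<mu> vs) {u} < c * w / ?n}" for vs
  let ?tot = "\<lambda>vs. wdeg V (link \<theta> V \<mu> vs) {}"
  let ?Vs = "{vs. set vs \<subseteq> V \<and> length vs = L}"
  \<comment> \<open>heavy link: the induction hypothesis applies\<close>
  have big: "\<exists>\<C>. good \<C> (link \<theta> V \<mu> vs)" if vs: "vs \<in> ?Vs" and tot: "?tot vs \<ge> w'" for vs
  proof -
    have "spread K' L V w' (link \<theta> V \<mu> vs)"
      unfolding spread_def
    proof (intro conjI allI impI)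
      show "w' \<le> ?tot vs" by (rule tot)
      fix T assume T: "T \<subseteq> V" "T \<noteq> {}"
      have finT: "finite T" using T V finite_subset by blast
      have "wdeg V (link \<theta> V \<mu> vs) T \<le> 2 * \<theta> (card T)"
      proof (rule wdeg_link_le[OF V(1) _ T])
        fix v assume v: "v \<in> V" "v \<notin> T"
        show "wdeg V \<mu> (insert v T) \<le> \<theta> (card T)"
          using deg[of "insert v T"] T v finT by (simp add: \<theta>_def)
      qed (use vs nn \<theta>0 in auto)
      also have "\<dots> = K' * w' * p ^ (card T - 1) / ?n"
      proof -
        have "card T > 0" using T finT by (simp add: card_gt_0_iff)
        then obtain j where "card T = Suc j" using gr0_implies_Suc by blast
        then show ?thesis using c by (simp add: \<theta>_def K'_def w'_def)
      qed
      finally show "wdeg V (link \<theta> V \<mu> vs) T \<le> K' * w' * (real L / ?n) ^ (card T - 1) / ?n"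
        by (simp add: p_def)
    qed
    note spread = this
    have "2 ^ l * c \<le> 1 / 4" using Suc.prems(1) c(1) by simp
    moreover have "K' > 0" "w' > 0" using Suc.prems(2,3) c p by (simp_all add: K'_def w'_def)
    moreover have "4 * (K' * (2 / c) ^ l) * real L \<le> ?n"
      unfolding F' F_def by (rule Suc.prems(6))
    ultimately show ?thesis
      unfolding good_def F'[symmetric]
      by (intro Suc.IH[OF _ _ _ _ spread] uniform_weight_link[OF Suc.prems(4) V(1)])
  qed
  \<comment> \<open>light link: the vertices of small remaining degree form a container\<close>
  have small: "real (card (low vs)) \<le> (1 - 1 / (4 * F)) * ?n" if vs: "vs \<in> ?Vs" and tot: "?tot vs < w'" for vs
  proof -
    let ?\<rho> = "rest \<theta> V \<mu> vs"
    have "?\<rho> E \<noteq> 0 \<longrightarrow> E \<subseteq> V \<and> card E = Suc l" for E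
      using Suc.prems(4) by (auto simp: residual_def uniform_weight_def)
    then have S: "(\<Sum>v\<in>V. wdeg V ?\<rho> {v}) = real (Suc l) * wdeg V ?\<rho> {}"
      using V by (intro sum_wdeg_singleton) blast+
    have "wdeg V ?\<rho> {} \<ge> w - K * w * p - 2 ^ l * ?tot vs / p"
      using vs by (intro rest_total[OF V Suc.prems(4,5,2,3) L _ _ p_def]) (auto simp: \<theta>_def)
    moreover have "K * w * p \<le> w / 4"
      using Kp Suc.prems(3) mult_left_mono[of "K * p" "1/4" w] by (simp add: mult.commute mult.left_commute)
    moreover have "2 ^ l * ?tot vs / p \<le> w / 4"
    proof -
      have "2 ^ l * ?tot vs / p \<le> 2 ^ l * w' / p"
        using tot p by (intro divide_right_mono mult_left_mono) auto
      also have "\<dots> = (2 ^ l * c) * w" using p by (simp add: w'_def)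
      also have "\<dots> \<le> 1 / 4 * w"
        using Suc.prems(1,3) c(1) by (intro mult_right_mono) auto
      finally show ?thesis by simp
    qed
    ultimately have half: "wdeg V ?\<rho> {} \<ge> w / 2" by linarith
    have "w / 2 \<le> real (Suc l) * wdeg V ?\<rho> {}"
    proof -
      have "1 * wdeg V ?\<rho> {} \<le> real (Suc l) * wdeg V ?\<rho> {}"
        using half Suc.prems(3) by (intro mult_right_mono) auto
      then show ?thesis using half by linarith
    qed
    also have "\<dots> = (\<Sum>v\<in>low vs. wdeg V ?\<rho> {v}) + (\<Sum>v\<in>V - low vs. wdeg V ?\<rho> {v})"
      unfolding S[symmetric] using V(1)
      by (subst sum.subset_diff[of "low vs" V]) (auto simp: low_def)
    also have "(\<Sum>v\<in>low vs. wdeg V ?\<rho> {v}) \<le> real (card (low vs)) * (c * w / ?n)"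
      by (rule sum_bounded_above) (auto simp: low_def)
    also have "\<dots> \<le> ?n * (c * w / ?n)"
      using V c Suc.prems(3) by (intro mult_right_mono) (auto simp: low_def intro!: card_mono)
    also have "\<dots> \<le> w / 4" using n c Suc.prems(3) by simp
    also have "(\<Sum>v\<in>V - low vs. wdeg V ?\<rho> {v}) \<le> real (card (V - low vs)) * (K * w / ?n)"
    proof (rule sum_bounded_above)
      fix v assume "v \<in> V - low vs"
      then have "wdeg V \<mu> {v} \<le> K * w / ?n" using deg[of "{v}"] by simp
      moreover have "wdeg V ?\<rho> {v} \<le> wdeg V \<mu> {v}" by (intro wdeg_mono residual_le nn)
      ultimately show "wdeg V ?\<rho> {v} \<le> K * w / ?n" by linarith
    qed
    finally have "w / 2 \<le> w / 4 + real (card (V - low vs)) * (K * w / ?n)" by simp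
    then have "w / 4 \<le> real (card (V - low vs)) * (K * w / ?n)" by linarith
    then have "?n / (4 * K) \<le> real (card (V - low vs))"
      using n Suc.prems(2,3) by (simp add: field_simps)
    moreover have "?n / (4 * F) \<le> ?n / (4 * K)"
      using n KF Suc.prems(2) Fpos by (intro divide_left_mono) auto
    moreover have "card (V - low vs) = card V - card (low vs)" "card (low vs) \<le> card V"
      using V(1) by (auto simp: low_def intro!: card_Diff_subset card_mono)
    ultimately show ?thesis by (simp add: field_simps of_nat_diff)
  qed
  define \<C> where "\<C> vs = (SOME \<C>. good \<C> (link \<theta> V \<mu> vs))" for vs
  have \<C>: "good (\<C> vs) (link \<theta> V \<mu> vs)" if "vs \<in> ?Vs" "?tot vs \<ge> w'" for vs
    unfolding \<C>_def using big[OF that] by (rule someI_ex)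
  define D where "D vs = (if ?tot vs \<ge> w' then \<C> vs else {low vs})" for vs
  have finVs: "finite ?Vs" using finite_lists_length_eq[OF V(1)] .
  have cardV: "card V \<ge> 1" using n by simp
  have D: "finite (D vs) \<and> card (D vs) \<le> card V ^ (l * L) \<and>
    (\<forall>C\<in>D vs. C \<subseteq> V \<and> real (card C) \<le> (1 - 1 / (4 * F)) * ?n)" if "vs \<in> ?Vs" for vs
  proof (cases "?tot vs \<ge> w'")
    case True
    then show ?thesis using \<C>[OF that True] unfolding D_def good_def by presburger
  next
    case False
    then have "D vs = {low vs}" by (simp add: D_def)
    moreover have "low vs \<subseteq> V" by (auto simp: low_def)
    moreover have "1 \<le> card V ^ (l * L)" using cardV by (rule one_le_power)
    ultimately show ?thesis using small[OF that] False by simp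
  qed
  have "card (\<Union>vs\<in>?Vs. D vs) \<le> (\<Sum>vs\<in>?Vs. card (D vs))" by (rule card_UN_le[OF finVs])
  also have "\<dots> \<le> (\<Sum>vs\<in>?Vs. card V ^ (l * L))" using D by (intro sum_mono) blast
  also have "\<dots> = card V ^ (Suc l * L)"
    using card_lists_length_eq[OF V(1), of L] by (simp add: power_add)
  finally have cardD: "card (\<Union>vs\<in>?Vs. D vs) \<le> card V ^ (Suc l * L)" .
  have "\<exists>C\<in>(\<Union>vs\<in>?Vs. D vs). I \<subseteq> C"
    if I: "I \<subseteq> V" "I \<noteq> {}" "weight_independent \<mu> I" for I
  proof -
    obtain vs where vs: "length vs = L" "set vs \<subseteq> I"
      and le: "\<And>u. u \<in> I \<Longrightarrow> real L * wdeg V (rest \<theta> V \<mu> vs) {u} \<le> ?tot vs"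
      using greedy_picks[of V I \<mu> L \<theta>] V(1) I(1,2) nn by blast
    have vsV: "vs \<in> ?Vs" using vs I by auto
    have "\<exists>C\<in>D vs. I \<subseteq> C"
    proof (cases "?tot vs \<ge> w'")
      case True
      then show ?thesis
        using \<C>[OF vsV True] weight_independent_link[OF I(3) vs(2)] I
        unfolding good_def D_def by auto
    next
      case False
      have "wdeg V (rest \<theta> V \<mu> vs) {u} < c * w / ?n" if "u \<in> I" for u
      proof -
        have "real L * wdeg V (rest \<theta> V \<mu> vs) {u} < real L * (c * w / ?n)"
          using le[OF that] False by (simp add: w'_def p_def mult_ac)
        then show ?thesis using L by (simp only: mult_less_cancel_left_pos of_nat_0_less_iff)
      qed
      then show ?thesis using I(1) False by (auto simp: D_def low_def)
    qed
    then show ?thesis using vsV by blast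
  qed
  moreover have "finite (\<Union>vs\<in>?Vs. D vs)" using finVs D by (intro finite_UN_I) blast+
  moreover have "\<forall>C\<in>(\<Union>vs\<in>?Vs. D vs). C \<subseteq> V \<and> real (card C) \<le> (1 - 1 / (4 * F)) * ?n"
    using D by blast
  ultimately show ?case
    unfolding F_def[symmetric]
    using cardD by (intro exI[of _ "\<Union>vs\<in>?Vs. D vs"]) blast
qed

section \<open>Supersaturation for subsets of equal sum\<close>

text \<open>
  The hypergraph on \<open>U\<close> whose edges are the unions of two disjoint \<open>r\<close>-sets of equal sum.
\<close>

definition sum_edges :: "nat \<Rightarrow> 'a::ab_group_add set \<Rightarrow> 'a set set" where
  "sum_edges r U = {E. E \<subseteq> U \<and> card E = 2 * r \<and> (\<exists>A\<subseteq>E. card A = r \<and> \<Sum>A = \<Sum>(E - A))}"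

lemma binomial_le_power: "n choose k \<le> n ^ k"
  by (cases "k \<le> n") (simp_all add: binomial_le_pow binomial_eq_0)

text \<open>
  A set with prescribed sum is determined by all of its elements but one.
\<close>

lemma card_fixed_sum_le:
  fixes U :: "'a::ab_group_add set"
  assumes "finite U" "s > 0"
  shows "card {B. B \<subseteq> U \<and> card B = s \<and> \<Sum>B = \<sigma>} \<le> card U ^ (s - 1)"
proof -
  define b where "b B = (SOME b. b \<in> B)" for B :: "'a set"
  let ?X = "{B. B \<subseteq> U \<and> card B = s \<and> \<Sum>B = \<sigma>}"
  have b: "b B \<in> B" "finite B" if "B \<in> ?X" for B
  proof -
    have "card B > 0" using that assms by simp
    then show "finite B" "b B \<in> B"
      unfolding b_def by (auto simp: card_gt_0_iff some_in_eq)
  qed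
  have split: "b B = \<sigma> - \<Sum>(B - {b B})" if "B \<in> ?X" for B
    using sum.remove[OF b(2,1)[OF that], of "\<lambda>x. x"] that by (simp add: eq_diff_eq)
  have "inj_on (\<lambda>B. B - {b B}) ?X"
  proof (rule inj_onI)
    fix B C assume B: "B \<in> ?X" and C: "C \<in> ?X" and eq: "B - {b B} = C - {b C}"
    then have "b B = b C" using split[OF B] split[OF C] by simp
    then show "B = C" using eq b(1)[OF B] b(1)[OF C] by (metis insert_Diff)
  qed
  moreover have "(\<lambda>B. B - {b B}) ` ?X \<subseteq> {C. C \<subseteq> U \<and> card C = s - 1}"
  proof (rule image_subsetI)
    fix B assume B: "B \<in> ?X"
    show "B - {b B} \<in> {C. C \<subseteq> U \<and> card C = s - 1}" using B b[OF B] by auto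
  qed
  ultimately have "card ?X \<le> card {C. C \<subseteq> U \<and> card C = s - 1}"
    by (rule card_inj_on_le) (rule finite_supersets[OF assms(1)])
  also have "\<dots> = card U choose (s - 1)" by (rule n_subsets[OF assms(1)])
  also have "\<dots> \<le> card U ^ (s - 1)" by (rule binomial_le_power)
  finally show ?thesis .
qed

definition equal_sum_pairs :: "nat \<Rightarrow> 'a::ab_group_add set \<Rightarrow> ('a set \<times> 'a set) set" where
  "equal_sum_pairs s U =
     (SIGMA A:{A. A \<subseteq> U \<and> card A = s}. {B. B \<subseteq> U \<and> card B = s \<and> \<Sum>B = \<Sum>A})"

lemma finite_equal_sum_pairs: "finite U \<Longrightarrow> finite (equal_sum_pairs s U)"
  unfolding equal_sum_pairs_def by (intro finite_SigmaI finite_supersets)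

lemma card_equal_sum_pairs_le:
  assumes "finite U" "s > 0"
  shows "card (equal_sum_pairs s U) \<le> card U ^ (2 * s - 1)"
proof -
  have "card (equal_sum_pairs s U)
      = (\<Sum>A | A \<subseteq> U \<and> card A = s. card {B. B \<subseteq> U \<and> card B = s \<and> \<Sum>B = \<Sum>A})"
    unfolding equal_sum_pairs_def using assms(1)
    by (intro card_SigmaI finite_supersets ballI) auto
  also have "\<dots> \<le> (\<Sum>A | A \<subseteq> U \<and> card A = s. card U ^ (s - 1))"
    by (intro sum_mono card_fixed_sum_le assms)
  also have "\<dots> = (card U choose s) * card U ^ (s - 1)"
    using n_subsets[OF assms(1)] by simp
  also have "\<dots> \<le> card U ^ s * card U ^ (s - 1)"
    by (intro mult_right_mono binomial_le_power) simp
  also have "\<dots> = card U ^ (2 * s - 1)"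
    using assms(2) by (simp flip: power_add) (simp add: mult_2)
  finally show ?thesis .
qed

text \<open>
  The Cauchy--Schwarz inequality for the numbers of \<open>r\<close>-subsets with a given sum.
\<close>

lemma equal_sum_pairs_lower_bound:
  assumes "finite U" "finite Y" "\<And>A. A \<subseteq> U \<Longrightarrow> card A = r \<Longrightarrow> \<Sum>A \<in> Y"
  shows "(card U choose r)\<^sup>2 \<le> card Y * card (equal_sum_pairs r U)"
proof -
  let ?S = "{A. A \<subseteq> U \<and> card A = r}"
  define f where "f y = card {A. A \<subseteq> U \<and> card A = r \<and> \<Sum>A = y}" for y
  have fin: "finite ?S" by (rule finite_supersets[OF assms(1)])
  have grp: "(\<Sum>y\<in>Y. \<Sum>A | A \<in> ?S \<and> \<Sum>A = y. h A) = sum h ?S" for h :: "'a set \<Rightarrow> nat"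
    using assms(2,3) by (intro sum.group fin) auto
  have "card U choose r = card ?S" by (rule n_subsets[OF assms(1), symmetric])
  also have "\<dots> = (\<Sum>y\<in>Y. f y)" using grp[of "\<lambda>_. 1"] by (simp add: f_def conj_assoc)
  finally have 1: "card U choose r = (\<Sum>y\<in>Y. f y)" .
  have "card (equal_sum_pairs r U) = (\<Sum>A\<in>?S. f (\<Sum>A))"
    unfolding equal_sum_pairs_def f_def using assms(1)
    by (intro card_SigmaI finite_supersets ballI) auto
  also have "\<dots> = (\<Sum>y\<in>Y. (f y)\<^sup>2)"
    unfolding grp[symmetric] by (intro sum.cong refl) (auto simp: f_def power2_eq_square conj_assoc)
  finally have 2: "card (equal_sum_pairs r U) = (\<Sum>y\<in>Y. (f y)\<^sup>2)" .
  have "(\<Sum>y\<in>Y. real (f y))\<^sup>2 \<le> real (card Y) * (\<Sum>y\<in>Y. (real (f y))\<^sup>2)"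
    by (subst mult.commute) (rule sum_squared_le_sum_of_squares)
  then have "real ((\<Sum>y\<in>Y. f y)\<^sup>2) \<le> real (card Y * (\<Sum>y\<in>Y. (f y)\<^sup>2))" by simp
  then show ?thesis unfolding 1 2 by (simp only: of_nat_le_iff)
qed

text \<open>
  Removing a common element from both sets leaves a pair of \<open>(r - 1)\<close>-sets of equal sum, of which
  there are few.
\<close>

lemma equal_sum_pairs_meeting_le:
  assumes "finite U" "r \<ge> 2"
  shows "card {(A, B) \<in> equal_sum_pairs r U. A \<inter> B \<noteq> {}} \<le> card U ^ (2 * r - 2)"
proof -
  let ?X = "{(A, B) \<in> equal_sum_pairs r U. A \<inter> B \<noteq> {}}"
  define c where "c A B = (SOME c. c \<in> A \<inter> B)" for A B :: "'a set"
  define g where "g = (\<lambda>(A, B). (c A B, A - {c A B}, B - {c A B}))"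
  have c: "c A B \<in> A \<inter> B" if "(A, B) \<in> ?X" for A B
    using that unfolding c_def by (intro someI_ex[of "\<lambda>c. c \<in> A \<inter> B"]) auto
  have inj: "inj_on g ?X"
  proof (rule inj_onI)
    fix x y assume x: "x \<in> ?X" and y: "y \<in> ?X" and eq: "g x = g y"
    obtain A B A' B' where xy: "x = (A, B)" "y = (A', B')" by fastforce
    have *: "c A B \<in> A \<inter> B" "c A' B' \<in> A' \<inter> B'"
      by (rule c, use x xy in simp) (rule c, use y xy in simp)
    have "c A B = c A' B'" "A - {c A B} = A' - {c A' B'}" "B - {c A B} = B' - {c A' B'}"
      using eq by (auto simp only: g_def prod.case prod.inject xy)
    then show "x = y" using * xy by (metis IntD1 IntD2 insert_Diff)
  qed
  have sub: "g ` ?X \<subseteq> U \<times> equal_sum_pairs (r - 1) U"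
  proof (rule image_subsetI)
    fix x assume "x \<in> ?X"
    then obtain A B where x: "x = (A, B)"
      and X: "(A, B) \<in> equal_sum_pairs r U" "A \<inter> B \<noteq> {}"
      by auto
    then have cc: "c A B \<in> A \<inter> B" by (intro c) simp
    have AB: "A \<subseteq> U" "B \<subseteq> U" "card A = r" "card B = r" "\<Sum>B = \<Sum>A"
      using X by (auto simp: equal_sum_pairs_def)
    have fin: "finite A" "finite B" using AB assms(1) finite_subset by auto
    have "\<Sum>A = c A B + \<Sum>(A - {c A B})" "\<Sum>B = c A B + \<Sum>(B - {c A B})"
      using fin cc sum.remove[of A "c A B" "\<lambda>x. x"] sum.remove[of B "c A B" "\<lambda>x. x"] by auto
    then have "\<Sum>(B - {c A B}) = \<Sum>(A - {c A B})" using AB(5) by simp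
    then show "g x \<in> U \<times> equal_sum_pairs (r - 1) U"
      using AB cc fin by (auto simp: x g_def equal_sum_pairs_def)
  qed
  have "card ?X \<le> card (U \<times> equal_sum_pairs (r - 1) U)"
    using assms(1) by (intro card_inj_on_le[OF inj sub] finite_cartesian_product finite_equal_sum_pairs)
  also have "\<dots> \<le> card U * card U ^ (2 * (r - 1) - 1)"
    using assms card_equal_sum_pairs_le[of U "r - 1"] by (simp add: card_cartesian_product)
  also have "\<dots> = card U ^ (2 * r - 2)"
  proof -
    have "2 * r - 2 = Suc (2 * (r - 1) - 1)" using assms(2) by simp
    then show ?thesis by (simp only: power_Suc)
  qed
  finally show ?thesis .
qed

lemma finite_sum_edges: "finite U \<Longrightarrow> finite (sum_edges r U)"
  unfolding sum_edges_def by (rule finite_supersets)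

lemma card_sum_edges_count:
  assumes "finite U" "finite Y" "\<And>A. A \<subseteq> U \<Longrightarrow> card A = r \<Longrightarrow> \<Sum>A \<in> Y" "r \<ge> 2"
  shows "(card U choose r)\<^sup>2 \<le> card Y * (4 ^ r * card (sum_edges r U) + card U ^ (2 * r - 2))"
proof -
  let ?P = "equal_sum_pairs r U"
  let ?X = "{(A, B) \<in> ?P. A \<inter> B \<noteq> {}}"
  let ?D = "{(A, B) \<in> ?P. A \<inter> B = {}}"
  have finP: "finite ?P" by (rule finite_equal_sum_pairs[OF assms(1)])
  have "inj_on (\<lambda>(A, B). (A \<union> B, A)) ?D" by (auto intro!: inj_onI)
  moreover have "(\<lambda>(A, B). (A \<union> B, A)) ` ?D \<subseteq> (SIGMA E:sum_edges r U. Pow E)"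
  proof (rule image_subsetI)
    fix x assume "x \<in> ?D"
    then obtain A B where x: "x = (A, B)" and P: "(A, B) \<in> ?P" and disj: "A \<inter> B = {}"
      by auto
    have AB: "A \<subseteq> U" "B \<subseteq> U" "card A = r" "card B = r" "\<Sum>B = \<Sum>A"
      using P by (auto simp: equal_sum_pairs_def)
    have fin: "finite A" "finite B" using AB assms(1) finite_subset by auto
    have "A \<union> B - A = B" using disj by auto
    then have "A \<union> B \<in> sum_edges r U"
      using AB disj fin by (auto simp: sum_edges_def card_Un_disjoint intro!: exI[of _ A])
    then show "(case x of (A, B) \<Rightarrow> (A \<union> B, A)) \<in> (SIGMA E:sum_edges r U. Pow E)"
      using x by auto
  qed
  moreover have finS: "finite (SIGMA E:sum_edges r U. Pow E)"
    using assms(1) finite_sum_edges[OF assms(1)] finite_subset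
    by (intro finite_SigmaI) (auto simp: sum_edges_def)
  ultimately have "card ?D \<le> card (SIGMA E:sum_edges r U. Pow E)"
    by (rule card_inj_on_le)
  also have "\<dots> = (\<Sum>E\<in>sum_edges r U. card (Pow E))"
    using assms(1) finite_sum_edges[OF assms(1)] finite_subset
    by (intro card_SigmaI) (auto simp: sum_edges_def)
  also have "\<dots> = (\<Sum>E\<in>sum_edges r U. 4 ^ r)"
  proof (intro sum.cong refl)
    fix E assume "E \<in> sum_edges r U"
    then have "E \<subseteq> U" "card E = 2 * r" by (auto simp: sum_edges_def)
    moreover from this have "finite E" using assms(1) by (simp add: finite_subset)
    ultimately show "card (Pow E) = 4 ^ r" by (simp add: card_Pow power_mult)
  qed
  finally have D: "card ?D \<le> 4 ^ r * card (sum_edges r U)" by (simp add: mult.commute)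
  have "card ?P = card (?D \<union> ?X)" by (rule arg_cong[where f = card]) auto
  also have "\<dots> \<le> card ?D + card ?X" by (rule card_Un_le)
  also have "\<dots> \<le> 4 ^ r * card (sum_edges r U) + card U ^ (2 * r - 2)"
    using D equal_sum_pairs_meeting_le[OF assms(1,4)] by linarith
  finally show ?thesis
    using equal_sum_pairs_lower_bound[OF assms(1-3)] by (meson le_trans mult_le_mono2)
qed

text \<open>
  Supersaturation. Pairs of \<open>r\<close>-sets of equal sum that are not disjoint number at most
  \<open>|U| ^ (2 r - 2)\<close>, which is at most half of the Cauchy--Schwarz bound as soon as \<open>|U|\<^sup>2\<close>
  exceeds a constant times the number \<open>|Y|\<close> of possible sums.
\<close>

lemma card_sum_edges_ge:
  assumes "finite U" "finite Y" "\<And>A. A \<subseteq> U \<Longrightarrow> card A = r \<Longrightarrow> \<Sum>A \<in> Y" "r \<ge> 2"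
    and "card Y > 0" "2 * (2 * real r) ^ (2 * r) * real (card Y) \<le> (real (card U))\<^sup>2"
  shows "real (card U) ^ (2 * r) / (2 * (2 * real r) ^ (2 * r) * real (card Y))
    \<le> real (card (sum_edges r U))"
proof -
  let ?u = "real (card U)" and ?Q = "real (card Y)" and ?e = "real (card (sum_edges r U))"
  define R where "R = real r ^ (2 * r)"
  have R: "R \<ge> 1" using assms(4) by (simp add: R_def)
  \<comment> \<open>the factor \<open>4 ^ r\<close> is the number of subsets of an edge, which bounds the number of pairs
    with a given union\<close>
  have four: "(2 * real r) ^ (2 * r) = 4 ^ r * R"
    by (simp add: R_def power_mult_distrib power_mult)
  have Q: "?Q \<ge> 1" using assms(5) by simp
  have "real r ^ 2 \<le> real r ^ (2 * r)" using assms(4) by (intro power_increasing) auto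
  also have "\<dots> \<le> 2 * (2 * real r) ^ (2 * r) * 1"
  proof -
    have "1 * R \<le> (2 * 4 ^ r) * R"
    proof (rule mult_right_mono)
      show "1 \<le> 2 * (4 :: real) ^ r" using one_le_power[of "4 :: real" r] by linarith
    qed (use R in simp)
    then show ?thesis unfolding four by (simp add: R_def)
  qed
  also have "\<dots> \<le> 2 * (2 * real r) ^ (2 * r) * ?Q" using Q by (intro mult_left_mono) auto
  also have "\<dots> \<le> ?u\<^sup>2" by (rule assms(6))
  finally have ru: "r \<le> card U" by (simp add: power2_le_iff_abs_le)
  have "(?u / real r) ^ r \<le> real (card U choose r)"
    using binomial_ge_n_over_k_pow_k[OF ru, where 'a = real] by simp
  then have "((?u / real r) ^ r)\<^sup>2 \<le> (real (card U choose r))\<^sup>2"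
    by (intro power_mono) auto
  also have "((?u / real r) ^ r)\<^sup>2 = ?u ^ (2 * r) / R"
    by (simp add: R_def power_divide mult.commute flip: power_mult)
  also have "(real (card U choose r))\<^sup>2 \<le> ?Q * (4 ^ r * ?e + ?u ^ (2 * r - 2))"
  proof -
    have "real ((card U choose r)\<^sup>2)
        \<le> real (card Y * (4 ^ r * card (sum_edges r U) + card U ^ (2 * r - 2)))"
      using card_sum_edges_count[OF assms(1-4)] by (simp only: of_nat_le_iff)
    then show ?thesis by (simp only: of_nat_power of_nat_mult of_nat_add of_nat_numeral)
  qed
  finally have main: "?u ^ (2 * r) / R \<le> ?Q * 4 ^ r * ?e + ?Q * ?u ^ (2 * r - 2)"
    by (simp add: algebra_simps)
  have "1 * (2 * R * ?Q) \<le> 4 ^ r * (2 * R * ?Q)"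
    using R Q by (intro mult_right_mono one_le_power) auto
  then have "2 * R * ?Q \<le> 2 * (2 * real r) ^ (2 * r) * ?Q" unfolding four by (simp add: mult_ac)
  also have "\<dots> \<le> ?u\<^sup>2" by (rule assms(6))
  finally have "?Q \<le> ?u\<^sup>2 / (2 * R)" using R by (simp add: field_simps)
  then have "?Q * ?u ^ (2 * r - 2) \<le> ?u\<^sup>2 / (2 * R) * ?u ^ (2 * r - 2)"
    by (rule mult_right_mono) simp
  also have "\<dots> = ?u ^ (2 * r) / (2 * R)"
  proof -
    have "2 * r = 2 + (2 * r - 2)" using assms(4) by simp
    then have "?u ^ (2 * r) = ?u\<^sup>2 * ?u ^ (2 * r - 2)" by (metis power_add)
    then show ?thesis by simp
  qed
  finally have "?u ^ (2 * r) / (2 * R) \<le> ?Q * 4 ^ r * ?e"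
    using main R by (simp add: field_simps)
  then show ?thesis unfolding four using R Q by (simp add: field_simps)
qed

text \<open>
  An edge containing \<open>T\<close> is determined by \<open>T\<close>, by all but one of its other vertices, and by how
  the known vertices are distributed over the two sides: the last vertex then balances the sums.
\<close>

lemma sum_edges_degree_le:
  fixes U :: "'a::ab_group_add set"
  assumes "finite U" "T \<subseteq> U" "card T < 2 * r"
  shows "card {E \<in> sum_edges r U. T \<subseteq> E} \<le> 2 ^ (2 * r) * card U ^ (2 * r - 1 - card T)"
proof -
  define s where "s = 2 * r - 1 - card T"
  let ?\<F> = "{F. F \<subseteq> U \<and> card F = s}"
  define g where "g = (\<lambda>(F, P). insert (\<Sum>P - \<Sum>((F \<union> T) - P)) (F \<union> T))"
  have finT: "finite T" using assms finite_subset by auto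
  have cover: "{E \<in> sum_edges r U. T \<subseteq> E} \<subseteq> g ` (SIGMA F:?\<F>. Pow (F \<union> T))"
  proof clarify
    fix E assume E: "E \<in> sum_edges r U" and TE: "T \<subseteq> E"
    then have EU: "E \<subseteq> U" and cE: "card E = 2 * r" by (auto simp: sum_edges_def)
    have finE: "finite E" using EU assms(1) finite_subset by auto
    have "E - T \<noteq> {}" using cE assms(3) TE by auto
    then obtain e where e: "e \<in> E" "e \<notin> T" by blast
    obtain A where A: "A \<subseteq> E" "\<Sum>A = \<Sum>(E - A)" using E by (auto simp: sum_edges_def)
    \<comment> \<open>let \<open>P\<close> be the side that does not contain the missing vertex \<open>e\<close>\<close>
    obtain P where P: "P \<subseteq> E" "\<Sum>P = \<Sum>(E - P)" "e \<notin> P"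
    proof (cases "e \<in> A")
      case True
      have "E - (E - A) = A" using A(1) by auto
      then show ?thesis using that[of "E - A"] A True by auto
    next
      case False
      then show ?thesis using that[of A] A by auto
    qed
    define F where "F = E - T - {e}"
    have FT: "F \<union> T = E - {e}" using e TE by (auto simp: F_def)
    have "E - P - {e} = (F \<union> T) - P" using FT by auto
    then have "\<Sum>(E - P) = e + \<Sum>((F \<union> T) - P)"
      using sum.remove[of "E - P" e "\<lambda>x. x"] finE e P(3) by simp
    then have "e = \<Sum>P - \<Sum>((F \<union> T) - P)" using P(2) by simp
    then have "E = g (F, P)" using FT e by (auto simp: g_def)
    moreover have "F \<in> ?\<F>"
      using EU finE finT e TE cE by (auto simp: F_def s_def card_Diff_subset)
    moreover have "P \<subseteq> F \<union> T" using P FT by auto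
    ultimately show "E \<in> g ` (SIGMA F:?\<F>. Pow (F \<union> T))" by blast
  qed
  have fin\<F>: "finite ?\<F>" by (rule finite_supersets[OF assms(1)])
  have finFT: "finite (F \<union> T)" if "F \<in> ?\<F>" for F
    using that finT assms(1) finite_subset by auto
  have "card {E \<in> sum_edges r U. T \<subseteq> E} \<le> card (SIGMA F:?\<F>. Pow (F \<union> T))"
    using fin\<F> finFT by (intro surj_card_le[OF _ cover] finite_SigmaI) auto
  also have "\<dots> = (\<Sum>F\<in>?\<F>. card (Pow (F \<union> T)))"
    using fin\<F> finFT by (intro card_SigmaI) auto
  also have "\<dots> \<le> (\<Sum>F\<in>?\<F>. 2 ^ (2 * r))"
  proof (rule sum_mono)
    fix F assume F: "F \<in> ?\<F>"
    have "card (F \<union> T) \<le> 2 * r"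
      using card_Un_le[of F T] F assms(3) by (simp add: s_def)
    then show "card (Pow (F \<union> T)) \<le> 2 ^ (2 * r)"
      using finFT[OF F] by (simp add: card_Pow del: finite_Un)
  qed
  also have "\<dots> = 2 ^ (2 * r) * (card U choose s)"
    using n_subsets[OF assms(1)] by simp
  also have "\<dots> \<le> 2 ^ (2 * r) * card U ^ s"
    by (intro mult_left_mono binomial_le_power) simp
  finally show ?thesis by (simp add: s_def)
qed

lemma sum_card_incident:
  assumes "finite U" "finite \<E>" "\<And>E. E \<in> \<E> \<Longrightarrow> E \<subseteq> U \<and> card E = q"
  shows "(\<Sum>v\<in>U. card {E \<in> \<E>. v \<in> E}) = q * card \<E>"
proof -
  have "(\<Sum>v\<in>U. card {E \<in> \<E>. v \<in> E}) = (\<Sum>v\<in>U. \<Sum>E\<in>\<E>. if v \<in> E then 1 else 0)"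
    using assms(2) by (simp flip: sum.inter_filter)
  also have "\<dots> = (\<Sum>E\<in>\<E>. \<Sum>v\<in>U. if v \<in> E then 1 else 0)" by (rule sum.swap)
  also have "\<dots> = (\<Sum>E\<in>\<E>. q)"
  proof (intro sum.cong refl)
    fix E assume "E \<in> \<E>"
    then have "{v \<in> U. v \<in> E} = E" "card E = q" using assms(3) by blast+
    then show "(\<Sum>v\<in>U. if v \<in> E then 1 else 0) = q"
      using assms(1) by (simp flip: sum.inter_filter)
  qed
  finally show ?thesis by (simp add: mult.commute)
qed

text \<open>
  Supersaturation gives many edges but no control of the vertex degrees. Take a largest subfamily
  that respects the degree bound. If it had fewer than \<open>e\<close> edges, at most half of the vertices
  would have reached the bound, and among the edges that avoid these vertices there would be
  one that could still be added.
\<close>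

lemma bounded_degree_subfamily:
  fixes e :: real
  assumes "e > 0" "finite U" "U \<noteq> {}" "finite \<H>" "\<And>E. E \<in> \<H> \<Longrightarrow> E \<subseteq> U \<and> card E = q" "q > 0"
    and many: "\<And>X. X \<subseteq> U \<Longrightarrow> 2 * card X \<le> card U \<Longrightarrow> e \<le> real (card {E \<in> \<H>. E \<inter> X = {}})"
  shows "\<exists>\<E>\<subseteq>\<H>. e \<le> real (card \<E>) \<and>
    (\<forall>v\<in>U. real (card {E \<in> \<E>. v \<in> E}) < 2 * real q * e / real (card U) + 1)"
proof -
  \<comment> \<open>chosen so that, by double counting, fewer than \<open>e\<close> edges can saturate at most half of \<open>U\<close>\<close>
  define \<Delta> where "\<Delta> = 2 * real q * e / real (card U)"
  have u: "real (card U) > 0" using assms(2,3) by (simp add: card_gt_0_iff)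
  have \<Delta>: "\<Delta> > 0" using assms(1,6) u by (simp add: \<Delta>_def)
  define ok where "ok \<E> \<longleftrightarrow> \<E> \<subseteq> \<H> \<and> (\<forall>v\<in>U. real (card {E \<in> \<E>. v \<in> E}) < \<Delta> + 1)" for \<E>
  define S where "S = {\<E>. ok \<E>}"
  have "S \<subseteq> Pow \<H>" by (auto simp: S_def ok_def)
  then have finS: "finite S" using assms(4) by (simp add: finite_subset)
  have "{} \<in> S" using \<Delta> by (simp add: S_def ok_def)
  then have "Max (card ` S) \<in> card ` S" using finS by (intro Max_in) auto
  then obtain \<E> where "\<E> \<in> S" and maxS: "card \<E> = Max (card ` S)" by force
  then have \<E>: "ok \<E>" by (simp add: S_def)
  have max: "card \<E>' \<le> card \<E>" if "ok \<E>'" for \<E>'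
    unfolding maxS using finS that by (intro Max_ge) (auto simp: S_def)
  have fin\<E>: "finite \<E>" using \<E> assms(4) finite_subset by (auto simp: ok_def)
  have "e \<le> real (card \<E>)"
  proof (rule ccontr)
    assume small: "\<not> e \<le> real (card \<E>)"
    define X where "X = {v \<in> U. real (card {E \<in> \<E>. v \<in> E}) \<ge> \<Delta>}"
    have "real (card X) * \<Delta> \<le> (\<Sum>v\<in>X. real (card {E \<in> \<E>. v \<in> E}))"
      by (rule sum_bounded_below) (simp add: X_def)
    also have "\<dots> \<le> (\<Sum>v\<in>U. real (card {E \<in> \<E>. v \<in> E}))"
      using assms(2) by (intro sum_mono2) (auto simp: X_def)
    also have "\<dots> = real (q * card \<E>)"
    proof -
      have "(\<Sum>v\<in>U. card {E \<in> \<E>. v \<in> E}) = q * card \<E>"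
      proof (rule sum_card_incident[OF assms(2) fin\<E>])
        fix E assume "E \<in> \<E>"
        then have "E \<in> \<H>" using \<E> by (auto simp only: ok_def)
        then show "E \<subseteq> U \<and> card E = q" by (rule assms(5))
      qed
      then show ?thesis by (simp flip: of_nat_sum)
    qed
    also have "\<dots> \<le> real q * e" using small by (simp add: mult_left_mono)
    also have "\<dots> = \<Delta> * (real (card U) / 2)" using u by (simp add: \<Delta>_def)
    finally have "real (card X) \<le> real (card U) / 2" using \<Delta> by (simp add: mult.commute)
    then have "e \<le> real (card {E \<in> \<H>. E \<inter> X = {}})"
      by (intro many) (auto simp: X_def)
    then have "card \<E> < card {E \<in> \<H>. E \<inter> X = {}}" using small by linarith
    then have "\<not> {E \<in> \<H>. E \<inter> X = {}} \<subseteq> \<E>"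
      using card_mono[OF fin\<E>] by (meson not_le)
    then obtain E where E: "E \<in> \<H>" "E \<inter> X = {}" "E \<notin> \<E>" by blast
    have "ok (insert E \<E>)"
      unfolding ok_def
    proof (intro conjI ballI)
      show "insert E \<E> \<subseteq> \<H>" using \<E> E by (simp add: ok_def)
      fix v assume v: "v \<in> U"
      show "real (card {E' \<in> insert E \<E>. v \<in> E'}) < \<Delta> + 1"
      proof (cases "v \<in> E")
        case True
        then have "v \<notin> X" using E by auto
        then have "real (card {E' \<in> \<E>. v \<in> E'}) < \<Delta>" using v by (simp add: X_def)
        moreover have "{E' \<in> insert E \<E>. v \<in> E'} = insert E {E' \<in> \<E>. v \<in> E'}"
          using True by auto
        ultimately show ?thesis using E(3) fin\<E> by simp
      next
        case False
        then have "{E' \<in> insert E \<E>. v \<in> E'} = {E' \<in> \<E>. v \<in> E'}" by auto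
        then show ?thesis using \<E> v by (simp add: ok_def)
      qed
    qed
    then have "card (insert E \<E>) \<le> card \<E>" by (rule max)
    then show False using E(3) fin\<E> by simp
  qed
  then show ?thesis using \<E> by (auto simp: ok_def \<Delta>_def)
qed

section \<open>Containers for sets without disjoint subsets of equal sum\<close>

text \<open>
  The value of \<open>K * (2 / c) ^ (2 * r)\<close> from the container theorem at \<open>K = 8 * r\<close> and
  \<open>c = 1 / 2 ^ (2 * r + 2)\<close>.
\<close>

definition container_const :: "nat \<Rightarrow> real" where
  "container_const r = 8 * real r * (2 * 2 ^ (2 * r + 2)) ^ (2 * r)"

text \<open>
  Every half of a large set \<open>U\<close> contains at least \<open>|U| ^ (2 * r) / (edge_const r * |Y|)\<close> edges, where \<open>Y\<close>
  is the set of sums: the constant of the supersaturation bound, times \<open>2 ^ (2 * r)\<close> for passing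
  to half of \<open>U\<close>.
\<close>

definition edge_const :: "nat \<Rightarrow> real" where
  "edge_const r = 2 ^ (2 * r) * (2 * (2 * real r) ^ (2 * r))"

lemma container_const_ge_1:
  assumes "r \<ge> 2"
  shows "container_const r \<ge> 1"
proof -
  have "1 \<le> 2 * (2 :: real) ^ (2 * r + 2)"
    using one_le_power[of "2 :: real" "2 * r + 2"] by linarith
  then have "1 \<le> (2 * (2 :: real) ^ (2 * r + 2)) ^ (2 * r)" by (rule one_le_power)
  moreover have "1 \<le> 8 * real r" using assms by simp
  ultimately have "1 * 1 \<le> 8 * real r * (2 * 2 ^ (2 * r + 2)) ^ (2 * r)"
    by (intro mult_mono) auto
  then show ?thesis by (simp add: container_const_def)
qed

lemma edge_const_ge_1:
  assumes "r \<ge> 2"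
  shows "edge_const r \<ge> 1"
proof -
  have "1 \<le> (2 * real r) ^ (2 * r)" using assms by (intro one_le_power) auto
  then have "1 \<le> 2 * (2 * real r) ^ (2 * r)" by linarith
  moreover have "1 \<le> (2::real) ^ (2 * r)" by (rule one_le_power) simp
  ultimately have "1 * 1 \<le> (2::real) ^ (2 * r) * (2 * (2 * real r) ^ (2 * r))"
    by (intro mult_mono) auto
  then show ?thesis by (simp add: edge_const_def)
qed

definition container_family :: "nat \<Rightarrow> 'a::ab_group_add set \<Rightarrow> nat \<Rightarrow> real \<Rightarrow> 'a set set \<Rightarrow> bool" where
  "container_family r U N s \<C> \<longleftrightarrow> finite \<C> \<and> card \<C> \<le> N \<and>
     (\<forall>C\<in>\<C>. C \<subseteq> U \<and> real (card C) \<le> s) \<and>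
     (\<forall>I\<subseteq>U. I \<noteq> {} \<longrightarrow> sum_edges r I = {} \<longrightarrow> (\<exists>C\<in>\<C>. I \<subseteq> C))"

lemma container_familyD:
  assumes "container_family r U N s \<C>"
  shows "finite \<C>" "card \<C> \<le> N"
    and "\<And>C. C \<in> \<C> \<Longrightarrow> C \<subseteq> U" "\<And>C. C \<in> \<C> \<Longrightarrow> real (card C) \<le> s"
    and "\<And>I. I \<subseteq> U \<Longrightarrow> I \<noteq> {} \<Longrightarrow> sum_edges r I = {} \<Longrightarrow> \<exists>C\<in>\<C>. I \<subseteq> C"
  using assms unfolding container_family_def by simp_all

lemma container_family_mono:
  assumes "container_family r U N s \<C>" "N \<le> N'" "s \<le> s'"
  shows "container_family r U N' s' \<C>"
  unfolding container_family_def
proof (intro conjI ballI allI impI)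
  note D = container_familyD[OF assms(1)]
  show "finite \<C>" by (rule D(1))
  show "card \<C> \<le> N'" using D(2) assms(2) by (rule le_trans)
  show "C \<subseteq> U" if "C \<in> \<C>" for C using D(3)[OF that] .
  show "real (card C) \<le> s'" if "C \<in> \<C>" for C using D(4)[OF that] assms(3) by (rule order_trans)
  show "\<exists>C\<in>\<C>. I \<subseteq> C" if "I \<subseteq> U" "I \<noteq> {}" "sum_edges r I = {}" for I
    using D(5)[OF that] .
qed

text \<open>
  The container theorem is applied to a subfamily of bounded vertex degree. The condition on pairs
  is the strongest of those on codegrees of \<open>2, \<dots>, 2 r - 1\<close> vertices and is implied by
  \<open>uL\<close>; the condition on whole edges amounts to \<open>LQ\<close> and determines how large \<open>L\<close> has to be.
\<close>

lemma sum_free_containers_step: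
  fixes U :: "'a::ab_group_add set"
  assumes U: "finite U" and r: "r \<ge> 2" and L: "L > 0"
    and Y: "finite Y" "card Y > 0" "\<And>A. A \<subseteq> U \<Longrightarrow> card A = r \<Longrightarrow> \<Sum>A \<in> Y"
    and uQ: "4 * edge_const r * real (card Y) \<le> (real (card U))\<^sup>2"
    and uL: "2 ^ (2 * r) * edge_const r * real (card Y) \<le> real (card U) * real L"
    and LQ: "edge_const r * real (card Y) \<le> real L ^ (2 * r - 1)"
    and Lu: "4 * container_const r * real L \<le> real (card U)"
  shows "\<exists>\<C>. container_family r U (card U ^ (2 * r * L))
    ((1 - 1 / (4 * container_const r)) * real (card U)) \<C>"
proof -
  let ?u = "real (card U)" and ?Q = "real (card Y)"
  define b where "b = edge_const r"
  define K where "K = 8 * real r"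
  define c :: real where "c = 1 / 2 ^ (2 * r + 2)"
  define e where "e = ?u ^ (2 * r) / (b * ?Q)"
  have K: "K \<ge> 1" using r by (simp add: K_def)
  have b: "b \<ge> 1" unfolding b_def by (rule edge_const_ge_1[OF r])
  have Q: "?Q \<ge> 1" using Y(2) by simp
  have bQ: "b * ?Q \<ge> 1" using mult_mono[OF b Q] b by simp
  have sh: "K * (2 / c) ^ (2 * r) = container_const r" by (simp add: K_def c_def container_const_def)
  have sh1: "container_const r \<ge> 1" by (rule container_const_ge_1[OF r])
  have L1: "real L \<ge> 1" using L by simp
  have Lu': "real L \<le> ?u"
  proof -
    have "1 * real L \<le> 4 * container_const r * real L" using sh1 by (intro mult_right_mono) auto
    then show ?thesis using Lu by simp
  qed
  have u1: "?u \<ge> 1" using Lu' L1 by linarith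
  have Une: "U \<noteq> {}" using u1 by auto
  have e: "e > 0" using u1 bQ unfolding e_def by (intro divide_pos_pos zero_less_power) linarith+
  \<comment> \<open>this makes the degree bound at least \<open>1\<close>, so that the additive \<open>1\<close> in it is harmless\<close>
  have eu: "?u \<le> e"
  proof -
    have "b * ?Q \<le> ?u ^ (2 * r - 1)"
      using LQ power_mono[OF Lu', of "2 * r - 1"] by (simp add: b_def)
    then have "?u * (b * ?Q) \<le> ?u * ?u ^ (2 * r - 1)" using u1 by (intro mult_left_mono) auto
    also have "\<dots> = ?u ^ (2 * r)" using r by (simp flip: power_Suc)
    finally show ?thesis using bQ by (simp add: e_def pos_le_divide_eq)
  qed
  have many: "e \<le> real (card {E \<in> sum_edges r U. E \<inter> X = {}})" if X: "X \<subseteq> U" "2 * card X \<le> card U" for X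
  proof -
    let ?a = "2 * (2 * real r) ^ (2 * r)"
    let ?W = "U - X"
    have finX: "finite X" using X(1) U finite_subset by blast
    have "card ?W = card U - card X" by (rule card_Diff_subset[OF finX X(1)])
    then have W: "?u / 2 \<le> real (card ?W)" using X(2) by simp
    have a: "?a > 0" using r by simp
    have "?a * ?Q \<le> edge_const r * ?Q"
    proof (rule mult_right_mono)
      have "1 * ?a \<le> 2 ^ (2 * r) * ?a" using a by (intro mult_right_mono one_le_power) auto
      then show "?a \<le> edge_const r" by (simp add: edge_const_def)
    qed simp
    also have "\<dots> \<le> (?u / 2)\<^sup>2" using uQ by (simp add: power_divide)
    also have "\<dots> \<le> (real (card ?W))\<^sup>2" using W by (intro power_mono) auto
    finally have "real (card ?W) ^ (2 * r) / (?a * ?Q) \<le> real (card (sum_edges r ?W))"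
      using U Y r by (intro card_sum_edges_ge) auto
    moreover have "(?u / 2) ^ (2 * r) / (?a * ?Q) \<le> real (card ?W) ^ (2 * r) / (?a * ?Q)"
      using W a Q by (intro divide_right_mono power_mono) auto
    moreover have "(?u / 2) ^ (2 * r) / (?a * ?Q) = e"
      by (simp add: e_def b_def edge_const_def power_divide)
    moreover have "sum_edges r ?W = {E \<in> sum_edges r U. E \<inter> X = {}}"
      by (auto simp: sum_edges_def)
    ultimately show ?thesis by simp
  qed
  have edge: "E \<subseteq> U \<and> card E = 2 * r" if "E \<in> sum_edges r U" for E
    using that by (simp add: sum_edges_def)
  have "\<exists>\<E>\<subseteq>sum_edges r U. e \<le> real (card \<E>) \<and>
    (\<forall>v\<in>U. real (card {E \<in> \<E>. v \<in> E}) < 2 * real (2 * r) * e / ?u + 1)"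
    by (rule bounded_degree_subfamily[OF e U Une finite_sum_edges[OF U] edge _ many])
      (use r in auto)
  then obtain \<E> where \<E>: "\<E> \<subseteq> sum_edges r U" "e \<le> real (card \<E>)"
    and deg1: "\<And>v. v \<in> U \<Longrightarrow> real (card {E \<in> \<E>. v \<in> E}) < 2 * real (2 * r) * e / ?u + 1"
    by blast
  have fin\<E>: "finite \<E>" using \<E>(1) finite_sum_edges[OF U] by (rule finite_subset)
  define \<mu> where "\<mu> E = (if E \<in> \<E> then 1 else 0 :: real)" for E
  have wdeg: "wdeg U \<mu> T = real (card {E \<in> \<E>. T \<subseteq> E})" for T
  proof -
    have "wdeg U \<mu> T = (\<Sum>E\<in>{E \<in> \<E>. T \<subseteq> E}. 1)"
      unfolding wdeg_def using finite_supersets[OF U] \<E>(1)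
      by (intro sum.mono_neutral_cong_right) (auto simp: \<mu>_def sum_edges_def)
    then show ?thesis by simp
  qed
  have "\<exists>\<C>. finite \<C> \<and> card \<C> \<le> card U ^ (2 * r * L) \<and>
    (\<forall>C\<in>\<C>. C \<subseteq> U \<and> real (card C) \<le> (1 - 1 / (4 * (K * (2 / c) ^ (2 * r)))) * ?u) \<and>
    (\<forall>I\<subseteq>U. I \<noteq> {} \<longrightarrow> weight_independent \<mu> I \<longrightarrow> (\<exists>C\<in>\<C>. I \<subseteq> C))"
  proof (rule weighted_containers[OF U Une L _ _ _ _ e])
    show "c > 0" by (simp add: c_def)
    show "c \<le> 1 / 4" by (simp add: c_def field_simps)
    show "2 ^ (2 * r) * c \<le> 1 / 4" by (simp add: c_def)
    show "K > 0" using K by linarith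
    show "uniform_weight (2 * r) U \<mu>"
      using \<E>(1) by (auto simp: uniform_weight_def \<mu>_def sum_edges_def split: if_splits)
    show "4 * (K * (2 / c) ^ (2 * r)) * real L \<le> ?u" using Lu by (simp only: sh)
    show "spread K L U e \<mu>"
      unfolding spread_def
    proof (intro conjI allI impI)
      show "e \<le> wdeg U \<mu> {}" using \<E>(2) by (simp add: wdeg)
      fix T assume T: "T \<subseteq> U" "T \<noteq> {}"
      have finT: "finite T" using T(1) U by (rule finite_subset)
      have cT: "card T \<ge> 1" using T finT by (simp add: Suc_le_eq card_gt_0_iff)
      let ?R = "K * e * (real L / ?u) ^ (card T - 1) / ?u"
      have R0: "?R \<ge> 0" using K e L1 u1 by (intro divide_nonneg_nonneg mult_nonneg_nonneg) auto
      consider "card T = 1" | "2 \<le> card T" "card T < 2 * r" | "card T = 2 * r" | "card T > 2 * r"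
        using cT by linarith
      then show "wdeg U \<mu> T \<le> ?R"
      proof cases
        case 1
        then obtain v where v: "T = {v}" by (rule card_1_singletonE)
        have "real (card {E \<in> \<E>. v \<in> E}) < 2 * real (2 * r) * e / ?u + 1"
          using deg1 T v by simp
        also have "1 \<le> 2 * real (2 * r) * e / ?u"
        proof -
          have "1 * ?u \<le> (2 * real (2 * r)) * e" using eu r e by (intro mult_mono) auto
          then show ?thesis using u1 by (simp add: pos_le_divide_eq)
        qed
        finally show ?thesis using v by (simp add: wdeg K_def field_simps)
      next
        case 2
        have "wdeg U \<mu> T \<le> real (card {E \<in> sum_edges r U. T \<subseteq> E})"
          unfolding wdeg of_nat_le_iff using \<E>(1) finite_sum_edges[OF U] by (intro card_mono) auto
        also have "\<dots> \<le> real (2 ^ (2 * r) * card U ^ (2 * r - 1 - card T))"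
          unfolding of_nat_le_iff using sum_edges_degree_le[OF U T(1) 2(2)] .
        also have "\<dots> = 2 ^ (2 * r) * ?u ^ (2 * r - 1 - card T)" by simp
        also have "\<dots> \<le> (?u * real L / (b * ?Q)) * ?u ^ (2 * r - 1 - card T)"
          using uL bQ u1 by (intro mult_right_mono) (auto simp: b_def pos_le_divide_eq mult_ac)
        also have "\<dots> \<le> (K * ?u * real L ^ (card T - 1) / (b * ?Q)) * ?u ^ (2 * r - 1 - card T)"
        proof (intro mult_right_mono divide_right_mono)
          have "real L ^ 1 \<le> real L ^ (card T - 1)" using L1 2 by (intro power_increasing) auto
          then have "1 * ?u * real L \<le> K * ?u * real L ^ (card T - 1)"
            using K u1 by (intro mult_mono) auto
          then show "?u * real L \<le> K * ?u * real L ^ (card T - 1)" by simp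
        qed (use bQ u1 in auto)
        also have "\<dots> = ?R"
        proof -
          have "2 * r = (2 * r - 1 - card T) + 1 + (card T - 1) + 1" using 2 by simp
          then have "?u ^ (2 * r) = ?u ^ (2 * r - 1 - card T) * ?u * ?u ^ (card T - 1) * ?u"
            by (metis power_add power_one_right)
          then show ?thesis using u1 by (simp add: e_def power_divide)
        qed
        finally show ?thesis .
      next
        case 3
        have "{E \<in> \<E>. T \<subseteq> E} \<subseteq> {T}"
        proof
          fix E assume E: "E \<in> {E \<in> \<E>. T \<subseteq> E}"
          then have "E \<subseteq> U" "card E = card T" using \<E>(1) edge 3 by auto
          then have "T = E" using E U by (intro card_subset_eq) (auto intro: finite_subset)
          then show "E \<in> {T}" by simp
        qed
        then have "card {E \<in> \<E>. T \<subseteq> E} \<le> card {T}" by (intro card_mono) auto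
        then have "wdeg U \<mu> T \<le> 1" by (simp add: wdeg)
        also have "1 \<le> K * (real L ^ (2 * r - 1) / (b * ?Q))"
        proof -
          have "1 * 1 \<le> K * (real L ^ (2 * r - 1) / (b * ?Q))"
            using K LQ bQ by (intro mult_mono) (auto simp: b_def pos_le_divide_eq)
          then show ?thesis by simp
        qed
        also have "\<dots> = ?R"
        proof -
          have "?u ^ (2 * r) = ?u * ?u ^ (2 * r - 1)" using r by (simp flip: power_Suc)
          then show ?thesis using u1 3 by (simp add: e_def power_divide)
        qed
        finally show ?thesis .
      next
        case 4
        have none: "{E \<in> \<E>. T \<subseteq> E} = {}"
        proof (rule ccontr)
          assume "{E \<in> \<E>. T \<subseteq> E} \<noteq> {}"
          then obtain E where "E \<in> \<E>" "T \<subseteq> E" by blast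
          then have "E \<subseteq> U" "card E = 2 * r" using \<E>(1) edge by auto
          moreover have "card T \<le> card E"
            using \<open>T \<subseteq> E\<close> \<open>E \<subseteq> U\<close> U by (metis card_mono finite_subset)
          ultimately show False using 4 by simp
        qed
        show ?thesis using R0 by (simp add: wdeg none)
      qed
    qed
  qed
  then obtain \<C> where \<C>: "finite \<C>" "card \<C> \<le> card U ^ (2 * r * L)"
    "\<forall>C\<in>\<C>. C \<subseteq> U \<and> real (card C) \<le> (1 - 1 / (4 * container_const r)) * ?u"
    "\<And>I. I \<subseteq> U \<Longrightarrow> I \<noteq> {} \<Longrightarrow> weight_independent \<mu> I \<Longrightarrow> \<exists>C\<in>\<C>. I \<subseteq> C"
    unfolding sh by blast
  have "\<exists>C\<in>\<C>. I \<subseteq> C" if I: "I \<subseteq> U" "I \<noteq> {}" "sum_edges r I = {}" for I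
  proof (rule \<C>(4)[OF I(1,2)])
    show "weight_independent \<mu> I"
      unfolding weight_independent_def
    proof (intro allI impI)
      fix E assume E: "E \<subseteq> I"
      have "E \<notin> \<E>"
      proof
        assume "E \<in> \<E>"
        then have "E \<in> sum_edges r I" using \<E>(1) E by (auto simp: sum_edges_def)
        then show False using I(3) by simp
      qed
      then show "\<mu> E = 0" by (simp add: \<mu>_def)
    qed
  qed
  then show ?thesis unfolding container_family_def using \<C>(1-3) by blast
qed

text \<open>
  Containers that are still larger than \<open>m\<close> are replaced by containers for their own subsets; each
  of the \<open>R\<close> rounds shrinks them by the same factor.
\<close>

theorem sum_free_containers:
  fixes G :: "'a::ab_group_add set"
  assumes G: "finite G" and r: "r \<ge> 2" and L: "L > 0"
    and Y: "finite Y" "card Y > 0" "\<And>A. A \<subseteq> G \<Longrightarrow> card A = r \<Longrightarrow> \<Sum>A \<in> Y"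
    and mQ: "4 * edge_const r * real (card Y) \<le> m\<^sup>2"
    and mL: "2 ^ (2 * r) * edge_const r * real (card Y) \<le> m * real L"
    and LQ: "edge_const r * real (card Y) \<le> real L ^ (2 * r - 1)"
    and Lm: "4 * container_const r * real L \<le> m"
    and m: "m > 0"
  shows "\<exists>\<C>. container_family r G (card G ^ (2 * r * L * R))
    (max m ((1 - 1 / (4 * container_const r)) ^ R * real (card G))) \<C>"
proof (cases "G = {}")
  case True
  then have "container_family r G (card G ^ (2 * r * L * R))
    (max m ((1 - 1 / (4 * container_const r)) ^ R * real (card G))) {}"
    unfolding container_family_def by simp
  then show ?thesis by (rule exI)
next
  case False
  then have G1: "card G \<ge> 1" using G by (simp add: Suc_le_eq card_gt_0_iff)
  let ?\<delta> = "1 - 1 / (4 * container_const r)"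
  have \<delta>: "?\<delta> \<ge> 0" using container_const_ge_1[OF r] by (simp add: field_simps)
  show ?thesis
  proof (induction R)
    case 0
    have "container_family r G (card G ^ (2 * r * L * 0)) (max m (?\<delta> ^ 0 * real (card G))) {G}"
      unfolding container_family_def by simp
    then show ?case by (rule exI)
  next
    case (Suc R)
    then obtain \<C> where
      F: "container_family r G (card G ^ (2 * r * L * R)) (max m (?\<delta> ^ R * real (card G))) \<C>"
      by (rule exE)
    note \<C> = container_familyD(1,2)[OF F] and sub = container_familyD(3)[OF F]
      and size = container_familyD(4)[OF F] and cover = container_familyD(5)[OF F]
    let ?s = "max m (?\<delta> ^ Suc R * real (card G))"
    have ex: "\<exists>\<D>. container_family r C (card G ^ (2 * r * L)) ?s \<D>" if C: "C \<in> \<C>" for C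
    proof (cases "real (card C) \<le> m")
      case True
      have "1 \<le> card G ^ (2 * r * L)" using G1 by (rule one_le_power)
      then have "container_family r C (card G ^ (2 * r * L)) ?s {C}"
        unfolding container_family_def using True by simp
      then show ?thesis by (rule exI)
    next
      case big: False
      then have mC: "m \<le> real (card C)" by simp
      have finC: "finite C" using sub[OF C] G by (rule finite_subset)
      have "\<exists>\<D>. container_family r C (card C ^ (2 * r * L)) (?\<delta> * real (card C)) \<D>"
      proof (rule sum_free_containers_step[OF finC r L Y(1,2)])
        show "\<Sum>A \<in> Y" if "A \<subseteq> C" "card A = r" for A
          using that(1) sub[OF C] by (intro Y(3) that(2)) (rule subset_trans)
        show "4 * edge_const r * real (card Y) \<le> (real (card C))\<^sup>2"
          using mQ power_mono[OF mC, of 2] m by linarith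
        show "2 ^ (2 * r) * edge_const r * real (card Y) \<le> real (card C) * real L"
          using mL mult_right_mono[OF mC, of "real L"] by linarith
        show "edge_const r * real (card Y) \<le> real L ^ (2 * r - 1)" by (rule LQ)
        show "4 * container_const r * real L \<le> real (card C)" using Lm mC by linarith
      qed
      then obtain \<D> where \<D>: "container_family r C (card C ^ (2 * r * L)) (?\<delta> * real (card C)) \<D>"
        by (rule exE)
      have *: "card C ^ (2 * r * L) \<le> card G ^ (2 * r * L)"
        using sub[OF C] G by (intro power_mono card_mono) auto
      have "real (card C) \<le> ?\<delta> ^ R * real (card G)" using size[OF C] big by linarith
      then have "?\<delta> * real (card C) \<le> ?\<delta> * (?\<delta> ^ R * real (card G))"
        using \<delta> by (rule mult_left_mono)
      then have **: "?\<delta> * real (card C) \<le> ?s" by (simp only: power_Suc mult.assoc max.coboundedI2)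
      have "container_family r C (card G ^ (2 * r * L)) ?s \<D>"
        by (rule container_family_mono[OF \<D> * **])
      then show ?thesis by (rule exI)
    qed
    define \<D> where "\<D> C = (SOME \<D>. container_family r C (card G ^ (2 * r * L)) ?s \<D>)" for C :: "'a set"
    have \<D>: "container_family r C (card G ^ (2 * r * L)) ?s (\<D> C)" if "C \<in> \<C>" for C
      unfolding \<D>_def using ex[OF that] by (rule someI_ex)
    have "card (\<Union>C\<in>\<C>. \<D> C) \<le> (\<Sum>C\<in>\<C>. card (\<D> C))" by (rule card_UN_le[OF \<C>(1)])
    also have "\<dots> \<le> (\<Sum>C\<in>\<C>. card G ^ (2 * r * L))"
    proof (rule sum_mono)
      fix C assume "C \<in> \<C>"
      then show "card (\<D> C) \<le> card G ^ (2 * r * L)"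
        by (rule container_familyD(2)[OF \<D>])
    qed
    also have "\<dots> = card \<C> * card G ^ (2 * r * L)" by simp
    also have "\<dots> \<le> card G ^ (2 * r * L * R) * card G ^ (2 * r * L)"
      by (rule mult_right_mono[OF \<C>(2)]) simp
    also have "\<dots> = card G ^ (2 * r * L * Suc R)" by (simp flip: power_add add: algebra_simps)
    finally have 1: "card (\<Union>C\<in>\<C>. \<D> C) \<le> card G ^ (2 * r * L * Suc R)" .
    have 2: "finite (\<Union>C\<in>\<C>. \<D> C)"
    proof (rule finite_UN_I[OF \<C>(1)])
      fix C assume "C \<in> \<C>"
      then show "finite (\<D> C)" by (rule container_familyD(1)[OF \<D>])
    qed
    have 3: "\<forall>D\<in>(\<Union>C\<in>\<C>. \<D> C). D \<subseteq> G \<and> real (card D) \<le> ?s"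
    proof
      fix D assume "D \<in> (\<Union>C\<in>\<C>. \<D> C)"
      then obtain C where C: "C \<in> \<C>" "D \<in> \<D> C" by blast
      have "D \<subseteq> G"
        using container_familyD(3)[OF \<D>[OF C(1)] C(2)] sub[OF C(1)] by (rule subset_trans)
      then show "D \<subseteq> G \<and> real (card D) \<le> ?s"
        using container_familyD(4)[OF \<D>[OF C(1)] C(2)] by (rule conjI)
    qed
    have 4: "\<forall>I\<subseteq>G. I \<noteq> {} \<longrightarrow> sum_edges r I = {} \<longrightarrow> (\<exists>D\<in>(\<Union>C\<in>\<C>. \<D> C). I \<subseteq> D)"
    proof (intro allI impI)
      fix I assume I: "I \<subseteq> G" "I \<noteq> {}" "sum_edges r I = {}"
      obtain C where C: "C \<in> \<C>" "I \<subseteq> C" using cover[OF I] by (rule bexE)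
      then have "\<exists>D\<in>\<D> C. I \<subseteq> D"
        by (intro container_familyD(5)[OF \<D>[OF C(1)]] I(2,3))
      then show "\<exists>D\<in>(\<Union>C\<in>\<C>. \<D> C). I \<subseteq> D" using C(1) by blast
    qed
    have "container_family r G (card G ^ (2 * r * L * Suc R)) ?s (\<Union>C\<in>\<C>. \<D> C)"
      unfolding container_family_def using 1 2 3 4 by (intro conjI)
    then show ?case by (rule exI)
  qed
qed

section \<open>Sparse random samples\<close>

lemma binomial_diff_le:
  assumes "j \<le> n" "n \<le> M" "M > 0"
  shows "real ((M - j) choose (n - j)) \<le> (real n / real M) ^ j * real (M choose n)"
  using assms(1)
proof (induction j)
  case (Suc j)
  define a where "a = n - Suc j"
  define b where "b = M - Suc j"
  have ab: "n - j = Suc a" "M - j = Suc b" using Suc.prems assms by (auto simp: a_def b_def)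
  have "Suc a * (Suc b choose Suc a) = Suc b * (b choose a)"
    using binomial_absorption[of a "Suc b"] by (simp del: binomial_Suc_Suc mult_Suc)
  then have eq: "real (Suc b) * real (b choose a) = real (Suc a) * real (Suc b choose Suc a)"
    by (metis of_nat_mult)
  have "real (Suc a) * real M \<le> real n * real (Suc b)"
  proof -
    have "real j * real n \<le> real j * real M" using assms by (intro mult_left_mono) auto
    moreover have R: "real (Suc a) = real n - real j" "real (Suc b) = real M - real j"
      using ab Suc.prems assms by (simp_all flip: of_nat_diff)
    ultimately show ?thesis unfolding R by (simp add: algebra_simps)
  qed
  then have frac: "real (Suc a) / real (Suc b) \<le> real n / real M"
    using assms(3) by (simp add: divide_simps mult.commute)
  have "real (b choose a) = real (Suc a) / real (Suc b) * real (Suc b choose Suc a)"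
    using eq by (simp add: field_simps)
  also have "\<dots> \<le> (real n / real M) * ((real n / real M) ^ j * real (M choose n))"
    using Suc ab by (intro mult_mono frac) auto
  finally show ?case by (simp add: a_def b_def)
qed simp

text \<open>
  The probability that a random \<open>n\<close>-subset of \<open>G\<close> contains a fixed \<open>j\<close>-set is at most
  \<open>(n / |G|) ^ j\<close>.
\<close>

lemma card_subsets_containing_le:
  assumes "finite G" "T \<subseteq> G" "card T = j" "n \<le> card G" "G \<noteq> {}"
  shows "real (card {S. S \<subseteq> G \<and> card S = n \<and> T \<subseteq> S})
    \<le> (real n / real (card G)) ^ j * real (card G choose n)"
proof (cases "j \<le> n")
  case False
  have "{S. S \<subseteq> G \<and> card S = n \<and> T \<subseteq> S} = {}"
  proof (rule ccontr)
    assume "{S. S \<subseteq> G \<and> card S = n \<and> T \<subseteq> S} \<noteq> {}"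
    then obtain S where S: "S \<subseteq> G" "card S = n" "T \<subseteq> S" by blast
    have "finite S" using S(1) assms(1) by (rule finite_subset)
    then have "card T \<le> card S" using S(3) by (rule card_mono)
    then show False using False S assms(3) by simp
  qed
  then have z: "card {S. S \<subseteq> G \<and> card S = n \<and> T \<subseteq> S} = 0" by (simp only: card.empty)
  show ?thesis unfolding z by simp
next
  case True
  have finT: "finite T" using assms(2,1) by (rule finite_subset)
  have "inj_on (\<lambda>S. S - T) {S. S \<subseteq> G \<and> card S = n \<and> T \<subseteq> S}"
    by (rule inj_onI) blast
  moreover have "(\<lambda>S. S - T) ` {S. S \<subseteq> G \<and> card S = n \<and> T \<subseteq> S}
      \<subseteq> {R. R \<subseteq> G - T \<and> card R = n - j}"
    using finT assms(3) by (auto simp: card_Diff_subset)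
  ultimately have "card {S. S \<subseteq> G \<and> card S = n \<and> T \<subseteq> S}
      \<le> card {R. R \<subseteq> G - T \<and> card R = n - j}"
    by (rule card_inj_on_le) (rule finite_supersets, use assms(1) in simp)
  also have "\<dots> = (card G - j) choose (n - j)"
    using n_subsets[of "G - T" "n - j"] assms(1-3) finT by (simp add: card_Diff_subset)
  finally have "real (card {S. S \<subseteq> G \<and> card S = n \<and> T \<subseteq> S})
      \<le> real ((card G - j) choose (n - j))" by simp
  also have "\<dots> \<le> (real n / real (card G)) ^ j * real (card G choose n)"
    using True assms by (intro binomial_diff_le) (auto simp: card_gt_0_iff)
  finally show ?thesis .
qed

lemma binomial_le_power_over_fact: "real (n choose t) \<le> real n ^ t / fact t"
proof -
  have "real ((n choose t) * fact t) \<le> real (n ^ t)"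
    using binomial_fact_pow by (simp only: of_nat_le_iff)
  then show ?thesis by (simp add: pos_le_divide_eq)
qed

text \<open>
  First moment and deletion. In a uniformly random \<open>n\<close>-subset of \<open>G\<close> the expected number of
  members of \<open>\<B>\<close> is at most \<open>n / 4\<close>, and with probability more than \<open>1 / 2\<close> no member of \<open>\<C>\<close> is hit
  in \<open>t\<close> points. So some \<open>n\<close>-subset has the second property and contains at most \<open>n / 2\<close> members
  of \<open>\<B>\<close>; deleting one point from each of them leaves at least \<open>n / 2\<close> points.
\<close>

lemma sparse_sample:
  fixes G :: "'a set"
  assumes G: "finite G" and n: "n \<le> card G" "n > 0"
    and \<B>: "finite \<B>" "\<And>B. B \<in> \<B> \<Longrightarrow> B \<subseteq> G" "\<And>B. B \<in> \<B> \<Longrightarrow> card B = k" "k > 0"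
    and few: "4 * real (card \<B>) * (real n / real (card G)) ^ k \<le> real n"
    and \<C>: "finite \<C>" "\<And>C. C \<in> \<C> \<Longrightarrow> C \<subseteq> G" "\<And>C. C \<in> \<C> \<Longrightarrow> real (card C) \<le> s"
    and rare: "2 * real (card \<C>) * (s ^ t / fact t) * (real n / real (card G)) ^ t < 1"
  shows "\<exists>S\<subseteq>G. n \<le> 2 * card S \<and> (\<forall>B\<in>\<B>. \<not> B \<subseteq> S) \<and> (\<forall>C\<in>\<C>. card (S \<inter> C) < t)"
proof -
  let ?\<Omega> = "{S. S \<subseteq> G \<and> card S = n}"
  define p where "p = real n / real (card G)"
  define N where "N = real (card G choose n)"
  have p0: "p \<ge> 0" by (simp add: p_def)
  have Gne: "G \<noteq> {}" using n by auto
  have N: "N > 0" using n by (simp add: N_def)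
  have card\<Omega>: "real (card ?\<Omega>) = N" using n_subsets[OF G] by (simp add: N_def)
  have fin\<Omega>: "finite ?\<Omega>" by (rule finite_supersets[OF G])
  have hit: "real (card {S \<in> ?\<Omega>. T \<subseteq> S}) \<le> p ^ j * N" if "T \<subseteq> G" "card T = j" for T j
    using card_subsets_containing_le[OF G that n(1) Gne]
    by (simp add: p_def N_def conj_assoc)
  define bad where "bad S = {B \<in> \<B>. B \<subseteq> S}" for S
  have "(\<Sum>S\<in>?\<Omega>. real (card (bad S))) = (\<Sum>S\<in>?\<Omega>. \<Sum>B\<in>\<B>. if B \<subseteq> S then 1 else 0)"
    using \<B>(1) by (simp add: bad_def flip: sum.inter_filter)
  also have "\<dots> = (\<Sum>B\<in>\<B>. \<Sum>S\<in>?\<Omega>. if B \<subseteq> S then 1 else 0)" by (rule sum.swap)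
  also have "\<dots> = (\<Sum>B\<in>\<B>. real (card {S \<in> ?\<Omega>. B \<subseteq> S}))"
    using fin\<Omega> by (simp flip: sum.inter_filter)
  also have "\<dots> \<le> (\<Sum>B\<in>\<B>. p ^ k * N)"
    by (intro sum_mono hit \<B>)
  also have "\<dots> = real (card \<B>) * p ^ k * N" by simp
  also have "\<dots> \<le> real n / 4 * N"
    using few N by (intro mult_right_mono) (auto simp: p_def)
  finally have total: "(\<Sum>S\<in>?\<Omega>. real (card (bad S))) \<le> real n / 4 * N" .
  define \<Omega>2 where "\<Omega>2 = {S \<in> ?\<Omega>. \<exists>C\<in>\<C>. t \<le> card (S \<inter> C)}"
  have "\<Omega>2 \<subseteq> (\<Union>C\<in>\<C>. \<Union>T\<in>{T. T \<subseteq> C \<and> card T = t}. {S \<in> ?\<Omega>. T \<subseteq> S})"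
  proof
    fix S assume "S \<in> \<Omega>2"
    then obtain C where S: "S \<in> ?\<Omega>" and C: "C \<in> \<C>" "t \<le> card (S \<inter> C)"
      unfolding \<Omega>2_def by blast
    obtain T where T: "T \<subseteq> S \<inter> C" "card T = t"
      using obtain_subset_with_card_n[OF C(2)] by metis
    then show "S \<in> (\<Union>C\<in>\<C>. \<Union>T\<in>{T. T \<subseteq> C \<and> card T = t}. {S \<in> ?\<Omega>. T \<subseteq> S})"
      using S C(1) by blast
  qed
  then have "card \<Omega>2 \<le> card (\<Union>C\<in>\<C>. \<Union>T\<in>{T. T \<subseteq> C \<and> card T = t}. {S \<in> ?\<Omega>. T \<subseteq> S})"
    by (rule card_mono[rotated]) (rule finite_subset[OF _ fin\<Omega>], blast)
  also have "\<dots> \<le> (\<Sum>C\<in>\<C>. card (\<Union>T\<in>{T. T \<subseteq> C \<and> card T = t}. {S \<in> ?\<Omega>. T \<subseteq> S}))"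
    by (rule card_UN_le[OF \<C>(1)])
  also have "\<dots> \<le> (\<Sum>C\<in>\<C>. \<Sum>T | T \<subseteq> C \<and> card T = t. card {S \<in> ?\<Omega>. T \<subseteq> S})"
  proof (intro sum_mono card_UN_le finite_supersets)
    fix C assume "C \<in> \<C>"
    then show "finite C" using \<C>(2) G by (metis finite_subset)
  qed
  finally have "real (card \<Omega>2) \<le> real (\<Sum>C\<in>\<C>. \<Sum>T | T \<subseteq> C \<and> card T = t. card {S \<in> ?\<Omega>. T \<subseteq> S})"
    by (simp only: of_nat_le_iff)
  also have "\<dots> = (\<Sum>C\<in>\<C>. \<Sum>T | T \<subseteq> C \<and> card T = t. real (card {S \<in> ?\<Omega>. T \<subseteq> S}))"
    by (simp only: of_nat_sum)
  also have "\<dots> \<le> (\<Sum>C\<in>\<C>. (s ^ t / fact t) * (p ^ t * N))"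
  proof (rule sum_mono)
    fix C assume C: "C \<in> \<C>"
    have finC: "finite C" using \<C>(2)[OF C] G by (rule finite_subset)
    have "(\<Sum>T | T \<subseteq> C \<and> card T = t. real (card {S \<in> ?\<Omega>. T \<subseteq> S}))
        \<le> (\<Sum>T | T \<subseteq> C \<and> card T = t. p ^ t * N)"
    proof (rule sum_mono)
      fix T assume "T \<in> {T. T \<subseteq> C \<and> card T = t}"
      then have "T \<subseteq> G" "card T = t" using \<C>(2)[OF C] by auto
      then show "real (card {S \<in> ?\<Omega>. T \<subseteq> S}) \<le> p ^ t * N" by (rule hit)
    qed
    also have "\<dots> = real (card C choose t) * (p ^ t * N)"
      using n_subsets[OF finC] by simp
    also have "\<dots> \<le> (real (card C) ^ t / fact t) * (p ^ t * N)"
      using p0 N by (intro mult_right_mono binomial_le_power_over_fact) auto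
    also have "\<dots> \<le> (s ^ t / fact t) * (p ^ t * N)"
      using p0 N \<C>(3)[OF C] by (intro mult_right_mono divide_right_mono power_mono) auto
    finally show "(\<Sum>T | T \<subseteq> C \<and> card T = t. real (card {S \<in> ?\<Omega>. T \<subseteq> S}))
        \<le> (s ^ t / fact t) * (p ^ t * N)" .
  qed
  also have "\<dots> = (real (card \<C>) * (s ^ t / fact t) * p ^ t) * N" by simp
  also have "\<dots> < 1 / 2 * N"
    using rare N by (intro mult_strict_right_mono) (auto simp: p_def)
  finally have \<Omega>2: "real (card \<Omega>2) < N / 2" by simp
  have sub2: "\<Omega>2 \<subseteq> ?\<Omega>" by (auto simp: \<Omega>2_def)
  have "\<exists>S\<in>?\<Omega> - \<Omega>2. real (card (bad S)) \<le> real n / 2"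
  proof (rule ccontr)
    assume "\<not> ?thesis"
    then have "\<not> real (card (bad S)) \<le> real n / 2" if "S \<in> ?\<Omega> - \<Omega>2" for S
      using that by blast
    then have big: "real n / 2 \<le> real (card (bad S))" if "S \<in> ?\<Omega> - \<Omega>2" for S
      using that by (meson not_le order_less_imp_le)
    have fin2: "finite \<Omega>2" using sub2 fin\<Omega> by (rule finite_subset)
    have "card (?\<Omega> - \<Omega>2) = card ?\<Omega> - card \<Omega>2" by (rule card_Diff_subset[OF fin2 sub2])
    then have "real (card (?\<Omega> - \<Omega>2)) = N - real (card \<Omega>2)"
      using card_mono[OF fin\<Omega> sub2] card\<Omega> by simp
    then have "N / 2 < real (card (?\<Omega> - \<Omega>2))" using \<Omega>2 by simp
    then have "N / 2 * (real n / 2) < real (card (?\<Omega> - \<Omega>2)) * (real n / 2)"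
      using n(2) by (intro mult_strict_right_mono) auto
    also have "\<dots> \<le> (\<Sum>S\<in>?\<Omega> - \<Omega>2. real (card (bad S)))"
      by (rule sum_bounded_below) (rule big)
    also have "\<dots> \<le> (\<Sum>S\<in>?\<Omega>. real (card (bad S)))"
      by (rule sum_mono2[OF fin\<Omega>]) auto
    finally show False using total by (simp add: field_simps)
  qed
  then obtain S where S: "S \<in> ?\<Omega>" "S \<notin> \<Omega>2" and badS: "real (card (bad S)) \<le> real n / 2" by blast
  define pick where "pick B = (SOME b. b \<in> B)" for B :: "'a set"
  have pick: "pick B \<in> B" if "B \<in> \<B>" for B
  proof -
    have "B \<noteq> {}" using \<B>(3)[OF that] \<B>(4) by auto
    then show ?thesis unfolding pick_def by (simp add: some_in_eq)
  qed
  define S' where "S' = S - pick ` bad S"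
  have finbad: "finite (bad S)" using \<B>(1) by (simp add: bad_def)
  have finS: "finite S" using S(1) G by (auto intro: finite_subset)
  have "card (pick ` bad S) \<le> card (bad S)" by (rule card_image_le[OF finbad])
  moreover have "card S - card (pick ` bad S) \<le> card S'"
    unfolding S'_def by (rule diff_card_le_card_Diff) (use finbad in simp)
  moreover have "card S = n" using S(1) by simp
  ultimately have "n \<le> 2 * card S'" using badS by linarith
  moreover have "S' \<subseteq> G" using S(1) by (auto simp: S'_def)
  moreover have "\<not> B \<subseteq> S'" if B: "B \<in> \<B>" for B
  proof
    assume BS: "B \<subseteq> S'"
    then have "B \<in> bad S" using B by (auto simp: bad_def S'_def)
    then have "pick B \<notin> S'" by (simp add: S'_def)
    then show False using pick[OF B] BS by blast
  qed
  moreover have "card (S' \<inter> C) < t" if C: "C \<in> \<C>" for C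
  proof -
    have "card (S' \<inter> C) \<le> card (S \<inter> C)"
      using finS by (intro card_mono) (auto simp: S'_def)
    also have "\<dots> < t" using S C unfolding \<Omega>2_def by (metis (mono_tags, lifting) mem_Collect_eq not_less)
    finally show ?thesis .
  qed
  ultimately show ?thesis by blast
qed

section \<open>Generic evaluation of grid polynomials\<close>

text \<open>
  The grid \<open>{0, \<dots>, k - 1} ^ D\<close>, with polynomials in the role of vectors of length \<open>D\<close>: they form an
  abelian group in which \<open>D\<close> may vary, and evaluation is a family of linear functionals on it.
\<close>

definition grid :: "nat \<Rightarrow> nat \<Rightarrow> real poly set" where
  "grid k D = {p. (\<forall>i<D. coeff p i \<in> real ` {..<k}) \<and> (\<forall>i\<ge>D. coeff p i = 0)}"

lemma coeff_sum_monom: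
  "coeff (\<Sum>i<D. monom (c i) i) j = (if j < D then c j else (0::real))"
  by (simp add: coeff_sum)

lemma bij_betw_grid:
  "bij_betw (\<lambda>f. \<Sum>i<D. monom (real (f i)) i) (PiE {..<D} (\<lambda>_. {..<k})) (grid k D)"
proof (rule bij_betw_imageI)
  let ?g = "\<lambda>f. \<Sum>i<D. monom (real (f i)) i"
  show "inj_on ?g (PiE {..<D} (\<lambda>_. {..<k}))"
  proof (rule inj_onI)
    fix f f' assume f: "f \<in> PiE {..<D} (\<lambda>_. {..<k})" and f': "f' \<in> PiE {..<D} (\<lambda>_. {..<k})"
      and eq: "?g f = ?g f'"
    have "f i = f' i" if "i \<in> {..<D}" for i
      using arg_cong[OF eq, of "\<lambda>p. coeff p i"] that by (simp add: coeff_sum_monom)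
    then show "f = f'" by (rule PiE_ext[OF f f'])
  qed
  show "?g ` PiE {..<D} (\<lambda>_. {..<k}) = grid k D"
  proof (intro subset_antisym subsetI)
    fix p assume "p \<in> ?g ` PiE {..<D} (\<lambda>_. {..<k})"
    then obtain f where "f \<in> PiE {..<D} (\<lambda>_. {..<k})" "p = ?g f" by blast
    then show "p \<in> grid k D" by (auto simp: grid_def coeff_sum_monom PiE_iff)
  next
    fix p assume p: "p \<in> grid k D"
    define f where "f = (\<lambda>i\<in>{..<D}. THE n. n < k \<and> coeff p i = real n)"
    have f: "f i < k \<and> coeff p i = real (f i)" if i: "i < D" for i
    proof -
      have "\<exists>!n. n < k \<and> coeff p i = real n" using p i by (auto simp: grid_def)
      then show ?thesis using i theI'[of "\<lambda>n. n < k \<and> coeff p i = real n"] by (simp add: f_def)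
    qed
    have "p = ?g f"
      using p f by (intro poly_eqI) (auto simp: grid_def coeff_sum_monom)
    moreover have "f \<in> PiE {..<D} (\<lambda>_. {..<k})" using f by (auto simp: f_def PiE_iff)
    ultimately show "p \<in> ?g ` PiE {..<D} (\<lambda>_. {..<k})" by blast
  qed
qed

lemma finite_grid: "finite (grid k D)"
  using bij_betw_finite[OF bij_betw_grid[of D k]] by (simp add: finite_PiE)

lemma card_grid: "card (grid k D) = k ^ D"
  using bij_betw_same_card[OF bij_betw_grid[of D k]] by (simp add: card_PiE)

lemma sum_in_grid:
  assumes "A \<subseteq> grid k D" "card A = r" "r > 0"
  shows "\<Sum>A \<in> grid (r * k) D"
proof -
  have finA: "finite A" using assms by (simp add: card_ge_0_finite)
  have "coeff (\<Sum>A) i \<in> real ` {..<r * k}" if i: "i < D" for i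
  proof -
    have "\<exists>n<k. coeff p i = real n" if "p \<in> A" for p
    proof -
      have "p \<in> grid k D" using assms(1) that by (rule subsetD)
      then show ?thesis using i by (auto simp: grid_def)
    qed
    then obtain c where c: "\<And>p. p \<in> A \<Longrightarrow> c p < k \<and> coeff p i = real (c p)" by metis
    have "coeff (\<Sum>A) i = (\<Sum>p\<in>A. real (c p))"
      unfolding coeff_sum using c by (intro sum.cong) auto
    moreover have "(\<Sum>p\<in>A. c p) < r * k"
      using sum_strict_mono[OF finA, of c "\<lambda>_. k"] c assms by fastforce
    ultimately show ?thesis by (metis imageI lessThan_iff of_nat_sum)
  qed
  moreover have "coeff (\<Sum>A) i = 0" if i: "i \<ge> D" for i
    unfolding coeff_sum
  proof (rule sum.neutral, rule ballI)
    fix p assume "p \<in> A"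
    then have "p \<in> grid k D" using assms(1) by (rule rev_subsetD)
    then show "coeff p i = 0" using i by (simp add: grid_def)
  qed
  ultimately show ?thesis by (simp add: grid_def)
qed

definition cube :: "nat \<Rightarrow> (real ^ 'j) set" where
  "cube k = {v. \<forall>s. v $ s \<in> real ` {..<k}}"

lemma finite_cube: "finite (cube k :: (real ^ 'j) set)"
proof -
  have "(cube k :: (real ^ 'j) set) \<subseteq> vec_lambda ` (PiE UNIV (\<lambda>_. real ` {..<k}))"
  proof
    fix v :: "real ^ 'j" assume "v \<in> cube k"
    then have "vec_nth v \<in> PiE UNIV (\<lambda>_. real ` {..<k})" by (simp add: cube_def PiE_iff)
    then show "v \<in> vec_lambda ` (PiE UNIV (\<lambda>_. real ` {..<k}))" by (metis image_eqI vec_nth_inverse)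
  qed
  moreover have "finite (PiE (UNIV :: 'j set) (\<lambda>_. real ` {..<k}))"
    by (rule finite_PiE) auto
  ultimately show ?thesis using finite_surj by blast
qed

text \<open>
  A minimal set \<open>S\<close> of coordinates that determines the vectors of \<open>W\<close> works: for each \<open>i\<close> in \<open>S\<close>
  minimality provides a vector of \<open>W\<close> that vanishes on \<open>S - {i}\<close> but not at \<open>i\<close>, and these
  vectors are linearly independent.
\<close>

lemma determining_coordinates:
  fixes W :: "(real ^ 'j) set"
  assumes "subspace W"
  shows "\<exists>S. card S \<le> dim W \<and> (\<forall>v\<in>W. (\<forall>i\<in>S. v $ i = 0) \<longrightarrow> v = 0)"
proof -
  define P where "P S \<longleftrightarrow> (\<forall>v\<in>W. (\<forall>i\<in>S. v $ i = 0) \<longrightarrow> v = 0)" for S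
  have "P UNIV" by (simp add: P_def vec_eq_iff)
  then obtain S where S: "P S" and min: "\<And>S'. P S' \<Longrightarrow> card S \<le> card S'"
    using ex_has_least_nat[of P UNIV card] by blast
  have "\<exists>w\<in>W. (\<forall>j\<in>S - {i}. w $ j = 0) \<and> w $ i \<noteq> 0" if i: "i \<in> S" for i
  proof -
    have "card (S - {i}) < card S" using i by (intro psubset_card_mono) auto
    then have "\<not> P (S - {i})" using min by (meson not_le)
    then obtain w where w: "w \<in> W" "\<forall>j\<in>S - {i}. w $ j = 0" "w \<noteq> 0" by (auto simp: P_def)
    have "w $ i \<noteq> 0"
    proof
      assume "w $ i = 0"
      then have "\<forall>j\<in>S. w $ j = 0" using w(2) by blast
      then show False using S w by (auto simp: P_def)
    qed
    then show ?thesis using w by blast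
  qed
  then obtain w where w: "\<And>i. i \<in> S \<Longrightarrow> w i \<in> W" "\<And>i j. i \<in> S \<Longrightarrow> j \<in> S \<Longrightarrow> j \<noteq> i \<Longrightarrow> w i $ j = 0"
    "\<And>i. i \<in> S \<Longrightarrow> w i $ i \<noteq> 0"
    by (metis DiffI singletonD)
  have inj: "inj_on w S"
  proof (rule inj_onI, rule ccontr)
    fix i j assume "i \<in> S" "j \<in> S" "w i = w j" "i \<noteq> j"
    then show False using w(2)[of j i] w(3)[of i] by simp
  qed
  have "independent (w ` S)"
  proof (rule independent_if_scalars_zero)
    show "finite (w ` S)" by simp
    fix f x assume sum: "(\<Sum>x\<in>w ` S. f x *\<^sub>R x) = 0" and "x \<in> w ` S"
    then obtain i where i: "i \<in> S" "x = w i" by blast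
    have "0 = (\<Sum>x\<in>w ` S. f x *\<^sub>R x) $ i" unfolding sum by simp
    also have "\<dots> = (\<Sum>j\<in>S. f (w j) * (w j $ i))"
      by (simp add: sum.reindex[OF inj])
    also have "\<dots> = (\<Sum>j\<in>S. if j = i then f (w i) * (w i $ i) else 0)"
      using w(2) i(1) by (intro sum.cong) auto
    also have "\<dots> = f (w i) * (w i $ i)" using i(1) by simp
    finally show "f x = 0" using w(3)[OF i(1)] i(2) by simp
  qed
  moreover have "w ` S \<subseteq> W" using w(1) by blast
  ultimately have "card (w ` S) \<le> dim W" by (intro independent_card_le_dim)
  then have "card S \<le> dim W" using card_image[OF inj] by simp
  then show ?thesis using S by (auto simp: P_def)
qed

lemma card_subspace_cube_le:
  fixes W :: "(real ^ 'j) set"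
  assumes "subspace W" "dim W \<le> d" "k > 0"
  shows "card (W \<inter> cube k) \<le> k ^ d"
proof -
  obtain S where S: "card S \<le> dim W" "\<And>v. v \<in> W \<Longrightarrow> (\<forall>i\<in>S. v $ i = 0) \<Longrightarrow> v = 0"
    using determining_coordinates[OF assms(1)] by blast
  let ?g = "\<lambda>v :: real ^ 'j. \<lambda>i\<in>S. v $ i"
  have "inj_on ?g (W \<inter> cube k)"
  proof (rule inj_onI)
    fix v w assume v: "v \<in> W \<inter> cube k" and w: "w \<in> W \<inter> cube k" and eq: "?g v = ?g w"
    have "v - w \<in> W" using v w assms(1) by (auto intro: subspace_diff)
    moreover have "\<forall>i\<in>S. (v - w) $ i = 0"
    proof
      fix i assume "i \<in> S"
      then show "(v - w) $ i = 0" using fun_cong[OF eq, of i] by simp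
    qed
    ultimately have "v - w = 0" by (rule S(2))
    then show "v = w" by simp
  qed
  moreover have "?g ` (W \<inter> cube k) \<subseteq> PiE S (\<lambda>_. real ` {..<k})"
    by (auto simp: cube_def)
  ultimately have "card (W \<inter> cube k) \<le> card (PiE S (\<lambda>_. real ` {..<k}))"
    by (rule card_inj_on_le) (simp add: finite_PiE)
  also have "\<dots> = k ^ card S" by (simp add: card_PiE card_image inj_on_def)
  also have "\<dots> \<le> k ^ d" using S(1) assms(2,3) by (intro power_increasing) auto
  finally show ?thesis .
qed

text \<open>
  A tuple \<open>x\<close> of polynomials is a matrix with one column per polynomial; this is the row formed by
  the coefficients of degree \<open>i\<close>.
\<close>

definition coeff_row :: "('j \<Rightarrow> real poly) \<Rightarrow> nat \<Rightarrow> real ^ 'j" where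
  "coeff_row x i = (\<chi> s. coeff (x s) i)"

text \<open>
  The vector \<open>1\<close> is included so that the dimension is one more than the affine dimension of the
  tuple of polynomials.
\<close>

definition row_space :: "nat \<Rightarrow> ('j::finite \<Rightarrow> real poly) \<Rightarrow> (real ^ 'j) set" where
  "row_space D x = span (insert 1 (coeff_row x ` {..<D}))"

definition value_vec :: "('j \<Rightarrow> real poly) \<Rightarrow> real \<Rightarrow> real ^ 'j" where
  "value_vec x \<tau> = (\<chi> s. poly (x s) \<tau>)"

definition tuples :: "nat \<Rightarrow> nat \<Rightarrow> ('j \<Rightarrow> real poly) set" where
  "tuples k D = {x. \<forall>s. x s \<in> grid k D}"

lemma finite_tuples: "finite (tuples k D :: ('j::finite \<Rightarrow> real poly) set)"
proof -
  have "tuples k D = PiE (UNIV :: 'j set) (\<lambda>_. grid k D)" by (auto simp: tuples_def PiE_iff)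
  then show ?thesis by (simp add: finite_PiE finite_grid)
qed

lemma poly_grid_eq:
  assumes "p \<in> grid k D"
  shows "poly p \<tau> = (\<Sum>i<D. coeff p i * \<tau> ^ i)"
proof -
  have "p = (\<Sum>i<D. monom (coeff p i) i)"
    using assms by (intro poly_eqI) (auto simp: coeff_sum_monom grid_def)
  then have "poly p \<tau> = poly (\<Sum>i<D. monom (coeff p i) i) \<tau>" by (rule arg_cong)
  also have "\<dots> = (\<Sum>i<D. coeff p i * \<tau> ^ i)" by (simp add: poly_sum poly_monom)
  finally show ?thesis .
qed

lemma value_vec_in_row_space:
  assumes "x \<in> tuples k D"
  shows "value_vec x \<tau> \<in> row_space D x"
proof -
  have "value_vec x \<tau> = (\<Sum>i<D. \<tau> ^ i *\<^sub>R coeff_row x i)"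
  proof (subst vec_eq_iff, rule allI)
    fix s
    have "x s \<in> grid k D" using assms by (simp add: tuples_def)
    then show "value_vec x \<tau> $ s = (\<Sum>i<D. \<tau> ^ i *\<^sub>R coeff_row x i) $ s"
      by (simp add: value_vec_def coeff_row_def poly_grid_eq mult.commute)
  qed
  also have "\<dots> \<in> row_space D x"
    unfolding row_space_def by (intro span_sum span_scale span_base) auto
  finally show ?thesis .
qed

text \<open>
  Evaluation at the points \<open>t i\<close>, for \<open>i\<close> in \<open>A\<close>, is injective in every coordinate and loses
  no more rank than it must: if the row space has dimension larger than \<open>|A|\<close>, then \<open>1\<close>
  and the vectors of values at these points are linearly independent. The type argument fixes the
  index type of the tuples.
\<close>

definition generic_on ::
  "nat \<Rightarrow> nat \<Rightarrow> 'j::finite itself \<Rightarrow> 'n set \<Rightarrow> ('n \<Rightarrow> real) \<Rightarrow> bool" where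
  "generic_on k D _ A t \<longleftrightarrow>
     (\<forall>i\<in>A. inj_on (\<lambda>p. poly p (t i)) (grid k D)) \<and>
     (\<forall>x\<in>tuples k D :: ('j \<Rightarrow> real poly) set. card A < dim (row_space D x) \<longrightarrow>
       (\<forall>a b. (\<Sum>i\<in>A. a i *\<^sub>R value_vec x (t i)) = b *\<^sub>R 1 \<longrightarrow> (\<forall>i\<in>A. a i = 0)))"

lemma generic_onI:
  fixes j :: "'j::finite itself"
  assumes "\<And>i. i \<in> A \<Longrightarrow> inj_on (\<lambda>p. poly p (t i)) (grid k D)"
    and "\<And>(x :: 'j \<Rightarrow> real poly) a b i. x \<in> tuples k D \<Longrightarrow> card A < dim (row_space D x) \<Longrightarrow>
       (\<Sum>i\<in>A. a i *\<^sub>R value_vec x (t i)) = b *\<^sub>R 1 \<Longrightarrow> i \<in> A \<Longrightarrow> a i = 0"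
  shows "generic_on k D j A t"
  using assms unfolding generic_on_def by blast

lemma generic_onD:
  fixes j :: "'j::finite itself" and x :: "'j \<Rightarrow> real poly"
  assumes "generic_on k D j A t"
  shows "i \<in> A \<Longrightarrow> inj_on (\<lambda>p. poly p (t i)) (grid k D)"
    and "x \<in> tuples k D \<Longrightarrow> card A < dim (row_space D x) \<Longrightarrow>
       (\<Sum>i\<in>A. a i *\<^sub>R value_vec x (t i)) = b *\<^sub>R 1 \<Longrightarrow> i \<in> A \<Longrightarrow> a i = 0"
  using assms unfolding generic_on_def by blast+

text \<open>
  If the rank of \<open>x\<close> is still larger than the number of vectors chosen so far, some \<open>g\<close> in the row
  space is orthogonal to those but not to all rows. Then the combination of the polynomials \<open>x s\<close>
  with coefficients \<open>g $ s\<close> is not zero, and at every \<open>\<tau>\<close> that is not one of its finitely many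
  roots the new vector of values is not orthogonal to \<open>g\<close>. There are finitely many \<open>x\<close>, so
  one \<open>\<tau>\<close> serves all of them.
\<close>

lemma generic_extension:
  fixes j :: "'j::finite itself" and A :: "'n set"
  assumes A: "finite A" "i0 \<notin> A" and gen: "generic_on k D j A t"
  shows "\<exists>\<tau>. generic_on k D j (insert i0 A) (t(i0 := \<tau>))"
proof -
  let ?F = "{x :: 'j \<Rightarrow> real poly. x \<in> tuples k D \<and> Suc (card A) < dim (row_space D x)}"
  let ?S = "\<lambda>x :: 'j \<Rightarrow> real poly. insert 1 ((\<lambda>i. value_vec x (t i)) ` A)"
  have finF: "finite ?F" using finite_tuples by (rule rev_finite_subset) blast
  let ?Q = "\<lambda>x g. (\<Sum>s\<in>UNIV. smult (g $ s) (x s)) \<noteq> 0 \<and> (\<forall>y\<in>?S x. g \<bullet> y = 0)"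
  have ex: "\<exists>g. ?Q x g" if x: "x \<in> ?F" for x
  proof -
    have x1: "x \<in> tuples k D" and x2: "Suc (card A) < dim (row_space D x)" using x by auto
    let ?T = "insert 1 (coeff_row x ` {..<D})"
    have "?S x \<subseteq> row_space D x"
      using value_vec_in_row_space[OF x1] by (auto simp: row_space_def intro: span_base)
    then have sub: "span (?S x) \<subseteq> span ?T"
      unfolding row_space_def by (rule span_minimal) (rule subspace_span)
    have "dim (span (?S x)) \<le> card (?S x)"
      using A(1) by (simp add: dim_le_card' del: dim_insert)
    also have "\<dots> \<le> Suc (card A)"
      using card_insert_le_m1[of "Suc (card A)"] card_image_le[OF A(1)]
      by (metis (no_types, lifting) A(1) card_insert_if finite_imageI le_SucI not_less_eq_eq)
    finally have "dim (span (?S x)) \<noteq> dim (span ?T)" using x2 by (simp add: row_space_def)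
    then have psub: "span (?S x) \<subset> span ?T" using sub by (metis psubsetI)
    obtain g where g: "g \<noteq> 0" "g \<in> span ?T" "\<And>y. y \<in> span (?S x) \<Longrightarrow> orthogonal g y"
      using orthogonal_to_subspace_exists_gen[OF psub] by metis
    have S: "\<forall>y\<in>?S x. g \<bullet> y = 0" using g(3) span_base by (metis orthogonal_def)
    have "\<exists>i<D. g \<bullet> coeff_row x i \<noteq> 0"
    proof (rule ccontr)
      assume no: "\<not> (\<exists>i<D. g \<bullet> coeff_row x i \<noteq> 0)"
      have "orthogonal g g"
      proof (rule orthogonal_to_span[OF g(2)])
        fix y assume "y \<in> ?T"
        then show "orthogonal g y" using no S by (auto simp: orthogonal_def)
      qed
      then show False using g(1) by (simp add: orthogonal_def)
    qed
    then obtain i where i: "g \<bullet> coeff_row x i \<noteq> 0" by blast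
    have "coeff (\<Sum>s\<in>UNIV. smult (g $ s) (x s)) i = g \<bullet> coeff_row x i"
      by (simp add: coeff_sum inner_vec_def coeff_row_def)
    then have "(\<Sum>s\<in>UNIV. smult (g $ s) (x s)) \<noteq> 0" using i by (metis coeff_0)
    then show ?thesis using S by blast
  qed
  define g where "g x = (SOME g. ?Q x g)" for x
  have Q: "?Q x (g x)" if "x \<in> ?F" for x
    unfolding g_def by (rule someI_ex) (rule ex[OF that])
  have g: "(\<Sum>s\<in>UNIV. smult (g x $ s) (x s)) \<noteq> 0" if "x \<in> ?F" for x
    using Q[OF that] by (rule conjunct1)
  have gS: "g x \<bullet> y = 0" if "x \<in> ?F" "y \<in> ?S x" for x y
    using conjunct2[OF Q[OF that(1)]] that(2) by (rule bspec)
  \<comment> \<open>the values of \<open>\<tau>\<close> to avoid: roots of the combinations above, and points where two grid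
    polynomials agree\<close>
  define Z where "Z = (\<Union>x\<in>?F. {\<tau>. poly (\<Sum>s\<in>UNIV. smult (g x $ s) (x s)) \<tau> = 0})
    \<union> (\<Union>(p, q)\<in>{(p, q) \<in> grid k D \<times> grid k D. p \<noteq> q}. {\<tau>. poly (p - q) \<tau> = 0})"
  have "finite Z"
    unfolding Z_def
  proof (intro finite_UnI finite_UN_I finF)
    fix x assume "x \<in> ?F"
    then show "finite {\<tau>. poly (\<Sum>s\<in>UNIV. smult (g x $ s) (x s)) \<tau> = 0}"
      by (intro poly_roots_finite g)
  next
    show "finite {(p, q) \<in> grid k D \<times> grid k D. p \<noteq> q}"
      by (rule finite_subset[of _ "grid k D \<times> grid k D"]) (auto intro: finite_grid)
  next
    fix pq :: "real poly \<times> real poly"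
    assume "pq \<in> {(p, q) \<in> grid k D \<times> grid k D. p \<noteq> q}"
    then have "fst pq - snd pq \<noteq> 0" by auto
    then have "finite {\<tau>. poly (fst pq - snd pq) \<tau> = 0}" by (rule poly_roots_finite)
    then show "finite (case pq of (p, q) \<Rightarrow> {\<tau>. poly (p - q) \<tau> = 0})" by (simp add: case_prod_beta)
  qed
  then obtain \<tau> where \<tau>: "\<tau> \<notin> Z"
    using infinite_UNIV_char_0[where 'a = real] by (metis ex_new_if_finite)
  have "generic_on k D j (insert i0 A) (t(i0 := \<tau>))"
  proof (rule generic_onI)
    fix i assume i: "i \<in> insert i0 A"
    show "inj_on (\<lambda>p. poly p ((t(i0 := \<tau>)) i)) (grid k D)"
    proof (cases "i = i0")
      case True
      show ?thesis
      proof (rule inj_onI, rule ccontr)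
        fix p q assume pq: "p \<in> grid k D" "q \<in> grid k D" "p \<noteq> q"
          and "poly p ((t(i0 := \<tau>)) i) = poly q ((t(i0 := \<tau>)) i)"
        then have "poly (p - q) \<tau> = 0" using True by simp
        then have "\<tau> \<in> Z" using pq unfolding Z_def by blast
        then show False using \<tau> by simp
      qed
    next
      case False
      then show ?thesis using generic_onD(1)[OF gen, of i] i by simp
    qed
  next
    fix x :: "'j \<Rightarrow> real poly" and a b i
    assume x1: "x \<in> tuples k D" and x2: "card (insert i0 A) < dim (row_space D x)"
      and sum: "(\<Sum>i\<in>insert i0 A. a i *\<^sub>R value_vec x ((t(i0 := \<tau>)) i)) = b *\<^sub>R 1"
      and i: "i \<in> insert i0 A"
    have cA: "Suc (card A) < dim (row_space D x)" using x2 A by simp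
    have xF: "x \<in> ?F" using x1 cA by simp
    have "(\<Sum>i\<in>A. a i *\<^sub>R value_vec x ((t(i0 := \<tau>)) i)) = (\<Sum>i\<in>A. a i *\<^sub>R value_vec x (t i))"
      using A(2) by (intro sum.cong) auto
    then have sum': "a i0 *\<^sub>R value_vec x \<tau> + (\<Sum>i\<in>A. a i *\<^sub>R value_vec x (t i)) = b *\<^sub>R 1"
      using sum A by simp
    have "g x \<bullet> value_vec x \<tau> = poly (\<Sum>s\<in>UNIV. smult (g x $ s) (x s)) \<tau>"
      by (simp add: inner_vec_def value_vec_def poly_sum)
    also have "\<dots> \<noteq> 0" using \<tau> xF by (auto simp: Z_def)
    finally have nz: "g x \<bullet> value_vec x \<tau> \<noteq> 0" .
    have "(\<Sum>i\<in>A. a i * (g x \<bullet> value_vec x (t i))) = 0"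
      using gS[OF xF] by (intro sum.neutral) auto
    then have "g x \<bullet> (a i0 *\<^sub>R value_vec x \<tau> + (\<Sum>i\<in>A. a i *\<^sub>R value_vec x (t i))) = a i0 * (g x \<bullet> value_vec x \<tau>)"
      by (simp add: inner_add_right inner_sum_right)
    moreover have "g x \<bullet> (b *\<^sub>R 1) = 0" using gS[OF xF, of 1] by simp
    ultimately have a0: "a i0 = 0" using nz sum' by simp
    have sumA: "(\<Sum>i\<in>A. a i *\<^sub>R value_vec x (t i)) = b *\<^sub>R 1" using sum' a0 by simp
    show "a i = 0"
    proof (cases "i = i0")
      case False
      then have "i \<in> A" using i by simp
      moreover have "card A < dim (row_space D x)" using cA by simp
      ultimately show ?thesis using generic_onD(2)[OF gen x1 _ sumA] by blast
    qed (use a0 in simp)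
  qed
  then show ?thesis by (rule exI)
qed

lemma ex_generic:
  fixes j :: "'j::finite itself"
  assumes "finite A"
  shows "\<exists>t :: 'n \<Rightarrow> real. generic_on k D j A t"
  using assms
proof (induction A rule: finite_induct)
  case empty
  show ?case by (auto simp: generic_on_def)
next
  case (insert i A)
  then show ?case using generic_extension by metis
qed

text \<open>
  The sets of \<open>d + 2\<close> grid points that lie on a common flat of dimension \<open>d - 1\<close>, where \<open>d\<close> is
  \<open>CARD('n)\<close>. The type \<open>'n option option\<close> has \<open>d + 2\<close> elements and serves as index type.
\<close>

definition low_rank :: "nat \<Rightarrow> nat \<Rightarrow> 'n::finite itself \<Rightarrow> real poly set set" where
  "low_rank k D n = {range x | x :: 'n option option \<Rightarrow> real poly.
     x \<in> tuples k D \<and> inj x \<and> dim (row_space D x) \<le> CARD('n)}"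

lemma card_option2: "CARD('n::finite option option) = CARD('n) + 2"
  by (simp add: card_UNIV_option)

lemma low_rank_subset: "B \<in> low_rank k D n \<Longrightarrow> B \<subseteq> grid k D"
  by (auto simp: low_rank_def tuples_def)

lemma card_low_rank_member:
  "B \<in> low_rank k D (n :: 'n::finite itself) \<Longrightarrow> card B = CARD('n) + 2"
  by (auto simp: low_rank_def card_image card_option2)

text \<open>
  All rows of a tuple of low rank lie in one set \<open>Z\<close>, the intersection of the cube
  \<open>{0, \<dots>, k - 1} ^ (d + 2)\<close> with a subspace of dimension at most \<open>d\<close>. Such a \<open>Z\<close> has at most
  \<open>k ^ d\<close> elements, hence there are at most \<open>(k ^ d) ^ D\<close> tuples for each \<open>Z\<close>. The number of
  possible \<open>Z\<close> is bounded in terms of \<open>k\<close> and \<open>d\<close> alone.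
\<close>

lemma card_low_rank_le:
  fixes n :: "'n::finite itself"
  assumes "k > 0"
  shows "finite (low_rank k D n)"
    and "card (low_rank k D n)
      \<le> 2 ^ card (cube k :: (real ^ 'n option option) set) * (k ^ D) ^ CARD('n)"
proof -
  let ?d = "CARD('n)"
  let ?C = "cube k :: (real ^ 'n option option) set"
  let ?\<Z> = "{Z. Z \<subseteq> ?C \<and> card Z \<le> k ^ ?d}"
  let ?g = "\<lambda>X. range (\<lambda>s :: 'n option option. \<Sum>i<D. monom (X i $ s) i)"
  let ?U = "\<Union>Z\<in>?\<Z>. ?g ` PiE {..<D} (\<lambda>_. Z)"
  have sub: "low_rank k D n \<subseteq> ?U"
  proof
    fix B assume "B \<in> low_rank k D n"
    then obtain x :: "'n option option \<Rightarrow> real poly" where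
      x: "B = range x" "x \<in> tuples k D" "dim (row_space D x) \<le> ?d"
      unfolding low_rank_def by blast
    have xg: "x s \<in> grid k D" for s using x(2) by (simp add: tuples_def)
    define Z where "Z = row_space D x \<inter> ?C"
    have "card Z \<le> k ^ ?d"
      unfolding Z_def using x(3) assms
      by (intro card_subspace_cube_le) (simp_all add: row_space_def)
    then have Z: "Z \<in> ?\<Z>" by (simp add: Z_def)
    define X where "X = restrict (coeff_row x) {..<D}"
    have "coeff_row x i \<in> Z" if "i < D" for i
      using that xg by (auto simp: Z_def row_space_def cube_def coeff_row_def grid_def intro!: span_base)
    then have X: "X \<in> PiE {..<D} (\<lambda>_. Z)" by (simp add: X_def PiE_iff)
    have "x s = (\<Sum>i<D. monom (X i $ s) i)" for s
      using xg[of s] by (intro poly_eqI) (auto simp: coeff_sum_monom grid_def X_def coeff_row_def)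
    then have "B = ?g X" using x(1) by simp
    then show "B \<in> ?U" using X Z by blast
  qed
  have fin\<Z>: "finite ?\<Z>" by (rule finite_supersets[OF finite_cube])
  have finZ: "finite (PiE {..<D} (\<lambda>_. Z))" if "Z \<in> ?\<Z>" for Z
    using that finite_cube by (intro finite_PiE) (auto intro: finite_subset)
  have finU: "finite ?U" using fin\<Z> finZ by (intro finite_UN_I finite_imageI)
  show "finite (low_rank k D n)" using sub finU by (rule finite_subset)
  have "card (low_rank k D n) \<le> card ?U" using finU sub by (rule card_mono)
  also have "\<dots> \<le> (\<Sum>Z\<in>?\<Z>. card (?g ` PiE {..<D} (\<lambda>_. Z)))" by (rule card_UN_le[OF fin\<Z>])
  also have "\<dots> \<le> (\<Sum>Z\<in>?\<Z>. (k ^ D) ^ ?d)"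
  proof (rule sum_mono)
    fix Z assume Z: "Z \<in> ?\<Z>"
    have "card (?g ` PiE {..<D} (\<lambda>_. Z)) \<le> card (PiE {..<D} (\<lambda>_. Z))"
      by (rule card_image_le[OF finZ[OF Z]])
    also have "\<dots> = card Z ^ D" by (simp add: card_PiE)
    also have "\<dots> \<le> (k ^ ?d) ^ D" using Z by (intro power_mono) auto
    also have "\<dots> = (k ^ D) ^ ?d" by (simp flip: power_mult add: mult.commute)
    finally show "card (?g ` PiE {..<D} (\<lambda>_. Z)) \<le> (k ^ D) ^ ?d" .
  qed
  also have "\<dots> = card ?\<Z> * (k ^ D) ^ ?d" by simp
  also have "\<dots> \<le> card (Pow ?C) * (k ^ D) ^ ?d"
    using finite_cube by (intro mult_right_mono card_mono) auto
  also have "\<dots> = 2 ^ card ?C * (k ^ D) ^ ?d" by (simp only: card_Pow[OF finite_cube])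
  finally show "card (low_rank k D n) \<le> 2 ^ card ?C * (k ^ D) ^ ?d" .
qed

definition point_of :: "('n \<Rightarrow> real) \<Rightarrow> real poly \<Rightarrow> real ^ 'n" where
  "point_of t p = (\<chi> i. poly p (t i))"

text \<open>
  A hyperplane through the points is a linear relation between \<open>1\<close> and the vectors of values at
  the points \<open>t i\<close>; genericity excludes it when the rank exceeds \<open>d\<close>.
\<close>

lemma hyperplane_imp_low_rank:
  fixes t :: "'n::finite \<Rightarrow> real"
  assumes gen: "generic_on k D TYPE('n option option) UNIV t"
    and T: "T \<subseteq> grid k D" "card T = CARD('n) + 2"
    and H: "is_hyperplane H" "point_of t ` T \<subseteq> H"
  shows "T \<in> low_rank k D TYPE('n)"
proof -
  have finT: "finite T" using T(1) finite_grid by (rule finite_subset)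
  have "card (UNIV :: 'n option option set) = card T" using T(2) by (simp add: card_option2)
  then obtain x where x: "bij_betw x (UNIV :: 'n option option set) T"
    using finite_same_card_bij[of "UNIV :: 'n option option set" T] finT by auto
  have inj: "inj x" and ran: "range x = T" using x by (auto simp: bij_betw_def)
  have xT: "x s \<in> T" for s using ran by blast
  have tup: "x \<in> tuples k D" using xT T(1) by (auto simp: tuples_def)
  obtain a b where a: "a \<noteq> 0" and Hab: "H = {y. a \<bullet> y = b}" using H(1) by (auto simp: is_hyperplane_def)
  have "dim (row_space D x) \<le> CARD('n)"
  proof (rule ccontr)
    assume "\<not> ?thesis"
    then have big: "card (UNIV :: 'n set) < dim (row_space D x)" by simp
    have "(\<Sum>i\<in>UNIV. (a $ i) *\<^sub>R value_vec x (t i)) = b *\<^sub>R 1"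
    proof (subst vec_eq_iff, rule allI)
      fix s
      have "point_of t (x s) \<in> H" using H(2) xT by blast
      then have "a \<bullet> point_of t (x s) = b" by (simp add: Hab)
      then show "(\<Sum>i\<in>UNIV. (a $ i) *\<^sub>R value_vec x (t i)) $ s = (b *\<^sub>R 1) $ s"
        by (simp add: value_vec_def point_of_def inner_vec_def)
    qed
    then have "a $ i = 0" for i by (rule generic_onD(2)[OF gen tup big]) simp
    then show False using a by (simp add: vec_eq_iff)
  qed
  then show ?thesis using tup inj ran unfolding low_rank_def by blast
qed

lemma inj_on_point_of:
  assumes "generic_on k D j UNIV (t :: 'n::finite \<Rightarrow> real)"
  shows "inj_on (point_of t) (grid k D)"
proof (rule inj_onI)
  fix p q assume pq: "p \<in> grid k D" "q \<in> grid k D" "point_of t p = point_of t q"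
  then have "poly p (t undefined) = poly q (t undefined)" by (simp add: point_of_def vec_eq_iff)
  then show "p = q" using generic_onD(1)[OF assms, of undefined] pq by (auto dest: inj_onD)
qed

section \<open>General position in the projected grid\<close>

lemma sum_point_of: "(\<Sum>p\<in>A. point_of t p) = point_of t (\<Sum>A)"
  by (simp add: vec_eq_iff point_of_def poly_sum)

text \<open>
  Two disjoint \<open>r\<close>-sets of equal sum are an affine dependence among \<open>2 r\<close> points. With further
  points of \<open>I\<close> they make up \<open>d + 1\<close> affinely dependent points, and these lie on a hyperplane.
\<close>

lemma general_position_imp_sum_free:
  fixes t :: "'n::finite \<Rightarrow> real"
  assumes inj: "inj_on (point_of t) I" and I: "finite I" "card I \<ge> CARD('n) + 1"
    and gp: "in_general_position (point_of t ` I)"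
    and r: "r > 0" "2 * r \<le> CARD('n) + 1"
  shows "sum_edges r I = {}"
proof (rule ccontr)
  assume "sum_edges r I \<noteq> {}"
  then obtain E A where E: "E \<subseteq> I" "card E = 2 * r" and A: "A \<subseteq> E" "card A = r" "\<Sum>A = \<Sum>(E - A)"
    unfolding sum_edges_def by blast
  have finE: "finite E" using E(1) I(1) by (rule finite_subset)
  have cIE: "card (I - E) = card I - 2 * r" using E finE by (simp add: card_Diff_subset)
  have "CARD('n) + 1 - 2 * r \<le> card (I - E)" using cIE I(2) by simp
  then obtain F where F: "F \<subseteq> I - E" "card F = CARD('n) + 1 - 2 * r" "finite F"
    by (rule obtain_subset_with_card_n)
  define T where "T = E \<union> F"
  have TI: "T \<subseteq> I" using E F by (auto simp: T_def)
  have finT: "finite T" using finE F(3) by (simp add: T_def)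
  have "card T = card E + card F"
    unfolding T_def using F finE by (intro card_Un_disjoint) auto
  then have cT: "card T = CARD('n) + 1" using E(2) F(2) r(2) by simp
  have injT: "inj_on (point_of t) T" using inj TI by (rule inj_on_subset)
  let ?P = "point_of t ` T"
  have cP: "card ?P = CARD('n) + 1" using card_image[OF injT] cT by simp
  \<comment> \<open>the coefficients of the affine dependence, on polynomials and then on their images\<close>
  define c where "c p = (if p \<in> A then 1 else if p \<in> E then - 1 else 0 :: real)" for p
  define u where "u y = c (the_inv_into T (point_of t) y)" for y
  have u: "u (point_of t p) = c p" if "p \<in> T" for p
    using the_inv_into_f_f[OF injT that] by (simp add: u_def)
  have split: "(\<Sum>p\<in>T. c p *\<^sub>R h p) = (\<Sum>p\<in>A. h p) - (\<Sum>p\<in>E - A. h p)"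
    for h :: "real poly \<Rightarrow> 'v::real_vector"
  proof -
    have "(\<Sum>p\<in>T. c p *\<^sub>R h p) = (\<Sum>p\<in>E. c p *\<^sub>R h p)"
      using finT A(1) by (intro sum.mono_neutral_right) (auto simp: T_def c_def)
    also have "\<dots> = (\<Sum>p\<in>E - A. c p *\<^sub>R h p) + (\<Sum>p\<in>A. c p *\<^sub>R h p)"
      by (rule sum.subset_diff[OF A(1) finE])
    also have "(\<Sum>p\<in>E - A. c p *\<^sub>R h p) = (\<Sum>p\<in>E - A. - h p)"
      by (intro sum.cong) (auto simp: c_def)
    also have "(\<Sum>p\<in>A. c p *\<^sub>R h p) = (\<Sum>p\<in>A. h p)"
      by (intro sum.cong) (auto simp: c_def)
    finally show ?thesis by (simp add: sum_negf)
  qed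
  have finA: "finite A" using A(1) finE by (rule finite_subset)
  have cEA: "card (E - A) = r" using A E(2) finA by (simp add: card_Diff_subset)
  have "sum u ?P = (\<Sum>p\<in>T. c p)"
    using u by (simp add: sum.reindex[OF injT])
  also have "\<dots> = 0" using split[of "\<lambda>_. 1 :: real"] A(2) cEA by simp
  finally have u0: "sum u ?P = 0" .
  have "(\<Sum>y\<in>?P. u y *\<^sub>R y) = (\<Sum>p\<in>T. c p *\<^sub>R point_of t p)"
    using u by (simp add: sum.reindex[OF injT])
  also have "\<dots> = 0" unfolding split sum_point_of A(3) by simp
  finally have uy: "(\<Sum>y\<in>?P. u y *\<^sub>R y) = 0" .
  have "A \<noteq> {}" using A(2) r(1) by auto
  then obtain p where p: "p \<in> A" by blast
  then have pT: "p \<in> T" using A(1) by (auto simp: T_def)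
  have "u (point_of t p) \<noteq> 0" using u[OF pT] p by (simp add: c_def)
  then have "affine_dependent ?P"
    using u0 uy pT finT by (subst affine_dependent_explicit_finite) auto
  then have "aff_dim ?P \<noteq> int (card ?P) - 1"
    using finT affine_independent_iff_card[of ?P] by auto
  moreover have "aff_dim ?P \<le> int (card ?P) - 1" using finT by (intro aff_dim_le_card) simp
  ultimately have "aff_dim ?P < DIM(real ^ 'n)" using cP by simp
  then obtain a b where ab: "a \<noteq> 0" "?P \<subseteq> {x. a \<bullet> x = b}" by (rule aff_lowdim_subset_hyperplane)
  then have "is_hyperplane {x. a \<bullet> x = b}" by (auto simp: is_hyperplane_def)
  moreover have "?P \<subseteq> point_of t ` I" using TI by (rule image_mono)
  ultimately show False
    using gp cP ab(2) unfolding in_general_position_def no_members_on_hyperplane_def by blast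
qed

lemma in_general_position_subset:
  "in_general_position T \<Longrightarrow> T' \<subseteq> T \<Longrightarrow> in_general_position T'"
  unfolding in_general_position_def no_members_on_hyperplane_def
  by (meson finite_subset order_trans)

text \<open>
  The construction for given parameters. The sample avoids all sets of low rank, so its image has
  at most \<open>d + 1\<close> points on any hyperplane. A subset of \<open>t\<close> points in general position would have no
  two disjoint \<open>r\<close>-sets of equal sum, hence would lie in a container, but no container contains
  \<open>t\<close> points of the sample.
\<close>

lemma alpha_less:
  fixes k D r N t L R :: nat and m :: real
  defines "M \<equiv> real k ^ D" and "Q \<equiv> (real r * real k) ^ D"
  assumes k: "k > 0" and r: "r \<ge> 2" "2 * r \<le> CARD('n::finite) + 1" and N: "N > 0" "2 * real N \<le> M"
    and few: "4 * (2 ^ card (cube k :: (real ^ 'n option option) set) * M ^ CARD('n))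
      * (2 * real N / M) ^ (CARD('n) + 2) \<le> 2 * real N"
    and L: "L > 0" and m: "m > 0"
    and mQ: "4 * edge_const r * Q \<le> m\<^sup>2"
    and mL: "2 ^ (2 * r) * edge_const r * Q \<le> m * real L"
    and LQ: "edge_const r * Q \<le> real L ^ (2 * r - 1)"
    and Lm: "4 * container_const r * real L \<le> m"
    and R: "(1 - 1 / (4 * container_const r)) ^ R * M \<le> m"
    and t: "t \<ge> CARD('n) + 1"
    and rare: "2 * M ^ (2 * r * L * R) * (m ^ t / fact t) * (2 * real N / M) ^ t < 1"
  shows "alpha TYPE('n) N < t"
proof (rule ccontr)
  assume "\<not> alpha TYPE('n) N < t"
  then have big: "t \<le> alpha TYPE('n) N" by simp
  let ?G = "grid k D" and ?\<B> = "low_rank k D TYPE('n)"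
  have M: "real (card ?G) = M" "M > 0" using k by (simp_all add: card_grid M_def)
  have Q: "real (card (grid (r * k) D)) = Q" by (simp add: card_grid Q_def)
  have "\<exists>\<tau> :: 'n \<Rightarrow> real. generic_on k D TYPE('n option option) UNIV \<tau>"
    by (rule ex_generic) simp
  then obtain \<tau> :: "'n \<Rightarrow> real" where gen: "generic_on k D TYPE('n option option) UNIV \<tau>"
    by (rule exE)
  have inj: "inj_on (point_of \<tau>) ?G" by (rule inj_on_point_of[OF gen])
  have "\<exists>\<C>. container_family r ?G (card ?G ^ (2 * r * L * R))
      (max m ((1 - 1 / (4 * container_const r)) ^ R * real (card ?G))) \<C>"
  proof (rule sum_free_containers[OF finite_grid r(1) L finite_grid[of "r * k" D] _ _ _ _ _ Lm m])
    show "card (grid (r * k) D) > 0" using k r by (simp add: card_grid)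
    show "\<Sum>A \<in> grid (r * k) D" if "A \<subseteq> ?G" "card A = r" for A
      using that r by (intro sum_in_grid) auto
  qed (unfold Q, (fact mQ mL LQ)+)
  then obtain \<C> where "container_family r ?G (card ?G ^ (2 * r * L * R))
      (max m ((1 - 1 / (4 * container_const r)) ^ R * real (card ?G))) \<C>" by (rule exE)
  then have F: "container_family r ?G (card ?G ^ (2 * r * L * R)) m \<C>"
    by (rule container_family_mono) (use R M in auto)
  note \<C> = container_familyD[OF F]
  have "\<exists>S\<subseteq>?G. 2 * N \<le> 2 * card S \<and> (\<forall>B\<in>?\<B>. \<not> B \<subseteq> S) \<and> (\<forall>C\<in>\<C>. card (S \<inter> C) < t)"
  proof (rule sparse_sample[OF finite_grid _ _ _ _ _ _ _ \<C>(1,3,4)])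
    show "2 * N \<le> card ?G" using N(2) M(1) by linarith
    show "2 * N > 0" using N(1) by simp
    show "finite ?\<B>" by (rule card_low_rank_le[OF k])
    show "B \<subseteq> ?G" if "B \<in> ?\<B>" for B by (rule low_rank_subset[OF that])
    show "card B = CARD('n) + 2" if "B \<in> ?\<B>" for B by (rule card_low_rank_member[OF that])
    show "CARD('n) + 2 > 0" by simp
    have "real (card ?\<B>) \<le> real (2 ^ card (cube k :: (real ^ 'n option option) set) * (k ^ D) ^ CARD('n))"
      using card_low_rank_le(2)[OF k] by (simp only: of_nat_le_iff)
    also have "\<dots> = 2 ^ card (cube k :: (real ^ 'n option option) set) * M ^ CARD('n)" by (simp add: M_def)
    finally have "4 * real (card ?\<B>) * (2 * real N / M) ^ (CARD('n) + 2)
      \<le> 4 * (2 ^ card (cube k :: (real ^ 'n option option) set) * M ^ CARD('n))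
        * (2 * real N / M) ^ (CARD('n) + 2)"
      using M(2) by (intro mult_right_mono mult_left_mono) auto
    then show "4 * real (card ?\<B>) * (real (2 * N) / real (card ?G)) ^ (CARD('n) + 2) \<le> real (2 * N)"
      using few M(1) by simp
    have "real (card \<C>) \<le> real (card ?G ^ (2 * r * L * R))"
      using \<C>(2) by (simp only: of_nat_le_iff)
    also have "\<dots> = M ^ (2 * r * L * R)" by (simp add: M)
    finally have "2 * real (card \<C>) * (m ^ t / fact t) * (2 * real N / M) ^ t
      \<le> 2 * M ^ (2 * r * L * R) * (m ^ t / fact t) * (2 * real N / M) ^ t"
      using M(2) m by (intro mult_right_mono mult_left_mono) auto
    also note rare
    finally show "2 * real (card \<C>) * (m ^ t / fact t) * (real (2 * N) / real (card ?G)) ^ t < 1"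
      unfolding M(1) by simp
  qed
  then obtain S where S: "S \<subseteq> ?G" "N \<le> card S" and noB: "\<And>B. B \<in> ?\<B> \<Longrightarrow> \<not> B \<subseteq> S"
    and fewC: "\<And>C. C \<in> \<C> \<Longrightarrow> card (S \<inter> C) < t" by auto
  obtain S0 where S0: "S0 \<subseteq> S" "card S0 = N" "finite S0"
    using obtain_subset_with_card_n[OF S(2)] by metis
  have S0G: "S0 \<subseteq> ?G" using S0(1) S(1) by (rule subset_trans)
  have inj0: "inj_on (point_of \<tau>) S0" using inj S0G by (rule inj_on_subset)
  let ?P = "point_of \<tau> ` S0"
  have "no_members_on_hyperplane (CARD('n) + 2) ?P"
    unfolding no_members_on_hyperplane_def
  proof
    assume "\<exists>T\<subseteq>?P. card T = CARD('n) + 2 \<and> (\<exists>H. is_hyperplane H \<and> T \<subseteq> H)"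
    then obtain T H where T: "T \<subseteq> ?P" "card T = CARD('n) + 2" and H: "is_hyperplane H" "T \<subseteq> H" by blast
    obtain B where B: "B \<subseteq> S0" "T = point_of \<tau> ` B" using T(1) by (rule subset_imageE)
    have "card B = CARD('n) + 2"
      using T(2) B card_image[OF inj_on_subset[OF inj0 B(1)]] by simp
    then have "B \<in> ?\<B>"
      using B S0G H by (intro hyperplane_imp_low_rank[OF gen _ _ H(1)]) auto
    then show False using noB B(1) S0(1) by blast
  qed
  moreover have "finite ?P" "card ?P = N" using S0 card_image[OF inj0] by auto
  ultimately obtain T where T: "T \<subseteq> ?P" "card T = alpha TYPE('n) N" "in_general_position T"
    using guaranteed_size_alpha[of "TYPE('n)" N] unfolding guaranteed_size_def by blast
  have "t \<le> card T" using big T(2) by simp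
  then obtain T' where T': "T' \<subseteq> T" "card T' = t" by (metis obtain_subset_with_card_n)
  have "T' \<subseteq> ?P" using T'(1) T(1) by (rule subset_trans)
  then obtain I where I: "I \<subseteq> S0" "T' = point_of \<tau> ` I" by (rule subset_imageE)
  have injI: "inj_on (point_of \<tau>) I" using inj0 I(1) by (rule inj_on_subset)
  have cI: "card I = t" using T'(2) I(2) card_image[OF injI] by simp
  have finI: "finite I" using I(1) S0(3) by (rule finite_subset)
  have "sum_edges r I = {}"
    using general_position_imp_sum_free[OF injI finI] cI t r
      in_general_position_subset[OF T(3) T'(1)] I(2) by simp
  moreover have "I \<noteq> {}" using cI t by auto
  moreover have IG: "I \<subseteq> ?G" using I(1) S0G by (rule subset_trans)
  ultimately obtain C where C: "C \<in> \<C>" "I \<subseteq> C" using \<C>(5)[of I] by blast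
  have "card I \<le> card (S \<inter> C)"
  proof (rule card_mono)
    show "finite (S \<inter> C)" using S(1) finite_grid[of k D] by (auto intro: finite_subset)
    show "I \<subseteq> S \<inter> C" using C(2) I(1) S0(1) by blast
  qed
  then show False using fewC[OF C(1)] cI by simp
qed

section \<open>Choice of the parameters\<close>

lemma power_le_fact_exp: "real t ^ t \<le> fact t * exp (real t)"
proof -
  have "(\<Sum>n\<in>{t}. inverse (fact n) * real t ^ n) \<le> (\<Sum>n. inverse (fact n) * real t ^ n)"
    by (rule sum_le_suminf[OF summable_exp]) auto
  also have "\<dots> = exp (real t)" by (simp add: exp_def)
  finally show ?thesis by (simp add: field_simps)
qed

text \<open>
  With \<open>x = N\<close> and \<open>M = k ^ D\<close>, the bound on the sets of low rank allows \<open>M\<close> to be of order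
  \<open>x ^ s\<close>, and \<open>dn * (r * k) ^ D \<le> L ^ (2 * r - 1)\<close> forces \<open>L\<close> to be at least about
  \<open>M ^ (1 / (2 * r - 1))\<close>, which is of order \<open>x ^ \<theta>\<close>. The choice is \<open>L = x ^ (\<theta> + \<eta> / 2)\<close>, so
  there are at most \<open>exp (x ^ (\<theta> + \<eta> / 2 + o(1)))\<close> containers. With
  \<open>m = x ^ (\<theta> + \<eta> / 2) * M / x\<close>, a sample of \<open>2 x\<close> points meets a container in at most
  \<open>2 x ^ (\<theta> + \<eta> / 2)\<close> points on average, and \<open>t = x ^ (\<theta> + \<eta>)\<close> points are so unlikely that
  a union bound over the containers succeeds. The loss \<open>r ^ D\<close> in the number of sums is at most
  \<open>M powr \<epsilon>\<close>, which the margin \<open>\<eta>\<close> absorbs.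
\<close>

lemma eventually_parameters:
  fixes d r k :: nat and dn sh C0 \<eta> \<epsilon> s \<theta> :: real
  defines "s \<equiv> (real d + 1) / 2" and "\<theta> \<equiv> s / (2 * real r - 1)"
  assumes d: "d \<ge> 3" and r: "r \<ge> 2" "2 * r \<le> d + 1" and k: "k \<ge> 2"
    and c: "dn \<ge> 1" "sh \<ge> 1" "C0 \<ge> 1" and \<eta>: "\<eta> > 0"
    and \<epsilon>: "\<epsilon> > 0" "s * \<epsilon> \<le> \<eta> / 4" "real r \<le> real k powr \<epsilon>"
  shows "\<forall>\<^sub>F N in sequentially. \<exists>D L R t m. N > 0 \<and> 2 * real N \<le> real k ^ D \<and>
    4 * (C0 * (real k ^ D) ^ d) * (2 * real N / real k ^ D) ^ (d + 2) \<le> 2 * real N \<and>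
    L > 0 \<and> m > 0 \<and>
    4 * dn * (real r * real k) ^ D \<le> m\<^sup>2 \<and>
    2 ^ (2 * r) * dn * (real r * real k) ^ D \<le> m * real L \<and>
    dn * (real r * real k) ^ D \<le> real L ^ (2 * r - 1) \<and>
    4 * sh * real L \<le> m \<and>
    (1 - 1 / (4 * sh)) ^ R * real k ^ D \<le> m \<and>
    t \<ge> d + 1 \<and>
    2 * (real k ^ D) ^ (2 * r * L * R) * (m ^ t / fact t) * (2 * real N / real k ^ D) ^ t < 1 \<and>
    real t < real N powr (\<theta> + \<eta>) + 1"
proof -
  define C1 where "C1 = 4 * C0 * 2 ^ (d + 1)"
  define b where "b = real k * sqrt C1"
  define e where "e = \<theta> + \<eta> / 2"
  have C1: "C1 \<ge> 1"
  proof -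
    have "1 * 1 \<le> (4 * C0) * 2 ^ (d + 1)" using c by (intro mult_mono one_le_power) auto
    then show ?thesis by (simp add: C1_def)
  qed
  have b: "b > 0" using k C1 by (simp add: b_def)
  have s: "s \<ge> 2" using d by (simp add: s_def)
  have q: "2 * real r - 1 > 0" using r by simp
  have \<theta>: "\<theta> > 0" using s q by (simp add: \<theta>_def)
  have \<theta>2: "2 * \<theta> > 1"
  proof -
    have "2 * real r - 1 < 2 * s" using r(2) by (simp add: s_def)
    then show ?thesis using q by (simp add: \<theta>_def pos_less_divide_eq)
  qed
  have e0: "e > 0" using \<theta> \<eta> by (simp add: e_def)
  have "\<forall>\<^sub>F x :: real in at_top. x \<ge> 1 \<and> 2 * x \<le> x powr s \<and>
    dn * (b * x powr s) powr (1 + \<epsilon>) \<le> x powr (s + (2 * real r - 1) * (\<eta> / 2)) \<and>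
    2 ^ (2 * r) * dn * (b * x powr s) powr \<epsilon> \<le> x powr (2 * e - 1) \<and>
    4 * dn * (b * x powr s) powr \<epsilon> \<le> x powr (2 * e - 2 + s) \<and>
    4 * sh * (x powr e + 1) \<le> x powr (e - 1 + s) \<and>
    real (d + 1) \<le> x powr (\<theta> + \<eta>) \<and>
    (ln 2 + 1) - (\<eta> / 2) * ln x \<le> - 1 \<and>
    real (2 * r) * (x powr e + 1) * ((4 * sh * ln (b * x powr s) + 1) * ln (b * x powr s)) + ln 2
      < x powr (\<theta> + \<eta>)"
  proof (intro eventually_conj)
    show "\<forall>\<^sub>F x :: real in at_top. x \<ge> 1" by (rule eventually_ge_at_top)
    show "\<forall>\<^sub>F x :: real in at_top. 2 * x \<le> x powr s"
      using s by real_asymp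
    have pw: "\<forall>\<^sub>F x :: real in at_top. C * x powr \<alpha> \<le> x powr \<beta>" if "\<alpha> < \<beta>" for C \<alpha> \<beta> :: real
      using that by real_asymp
    have split: "(b * x powr s) powr a = b powr a * x powr (s * a)" for x a
      using b by (simp add: powr_mult powr_powr)
    have "s * \<epsilon> < \<eta> / 2" using \<epsilon> \<eta> by linarith
    also have "\<eta> / 2 \<le> (2 * real r - 1) * (\<eta> / 2)" using r \<eta> by simp
    finally have "s * (1 + \<epsilon>) < s + (2 * real r - 1) * (\<eta> / 2)" by (simp add: distrib_left)
    from pw[OF this, of "dn * b powr (1 + \<epsilon>)"]
    show "\<forall>\<^sub>F x in at_top.
        dn * (b * x powr s) powr (1 + \<epsilon>) \<le> x powr (s + (2 * real r - 1) * (\<eta> / 2))"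
      unfolding split by (simp only: mult.assoc)
    have "s * \<epsilon> < 2 * e - 1" using \<epsilon> \<eta> \<theta>2 by (simp add: e_def)
    from pw[OF this, of "2 ^ (2 * r) * dn * b powr \<epsilon>"]
    show "\<forall>\<^sub>F x in at_top. 2 ^ (2 * r) * dn * (b * x powr s) powr \<epsilon> \<le> x powr (2 * e - 1)"
      unfolding split by (simp only: mult.assoc)
    have "s * \<epsilon> < 2 * e - 2 + s" using \<epsilon> \<eta> \<theta>2 s by (simp add: e_def)
    from pw[OF this, of "4 * dn * b powr \<epsilon>"]
    show "\<forall>\<^sub>F x in at_top. 4 * dn * (b * x powr s) powr \<epsilon> \<le> x powr (2 * e - 2 + s)"
      unfolding split by (simp only: mult.assoc)
    have "e < e - 1 + s" "0 < e - 1 + s" using s e0 by auto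
    then show "\<forall>\<^sub>F x in at_top. 4 * sh * (x powr e + 1) \<le> x powr (e - 1 + s)"
      using e0 by real_asymp
    have "0 < \<theta> + \<eta>" using \<theta> \<eta> by simp
    then show "\<forall>\<^sub>F x in at_top. real (d + 1) \<le> x powr (\<theta> + \<eta>)" by real_asymp
    show "\<forall>\<^sub>F x in at_top. (ln 2 + 1) - (\<eta> / 2) * ln x \<le> - 1" using \<eta> by real_asymp
    have pl: "\<forall>\<^sub>F x in at_top. A * (x powr \<alpha> + 1) * ((\<kappa> * ln (b * x powr s) + 1) * ln (b * x powr s)) + B
        < x powr \<beta>"
      if "0 < \<alpha>" "\<alpha> < \<beta>" "0 < s" "0 < b" "A > 0" "\<kappa> > 0" for A B \<kappa> \<alpha> \<beta> s b :: real
      using that by real_asymp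
    show "\<forall>\<^sub>F x in at_top. real (2 * r) * (x powr e + 1)
        * ((4 * sh * ln (b * x powr s) + 1) * ln (b * x powr s)) + ln 2 < x powr (\<theta> + \<eta>)"
      using e0 \<eta> s b c r by (intro pl) (simp_all add: e_def)
  qed
  then have "\<forall>\<^sub>F N in sequentially. real N \<ge> 1 \<and> 2 * real N \<le> real N powr s \<and>
    dn * (b * real N powr s) powr (1 + \<epsilon>) \<le> real N powr (s + (2 * real r - 1) * (\<eta> / 2)) \<and>
    2 ^ (2 * r) * dn * (b * real N powr s) powr \<epsilon> \<le> real N powr (2 * e - 1) \<and>
    4 * dn * (b * real N powr s) powr \<epsilon> \<le> real N powr (2 * e - 2 + s) \<and>
    4 * sh * (real N powr e + 1) \<le> real N powr (e - 1 + s) \<and>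
    real (d + 1) \<le> real N powr (\<theta> + \<eta>) \<and>
    (ln 2 + 1) - (\<eta> / 2) * ln (real N) \<le> - 1 \<and>
    real (2 * r) * (real N powr e + 1)
      * ((4 * sh * ln (b * real N powr s) + 1) * ln (b * real N powr s)) + ln 2
      < real N powr (\<theta> + \<eta>)"
    by (rule eventually_compose_filterlim[OF _ filterlim_real_sequentially])
  then show ?thesis
  proof (rule eventually_mono, elim conjE)
    fix N :: nat
    let ?x = "real N"
    assume x1: "?x \<ge> 1" and E1: "2 * ?x \<le> ?x powr s"
      and E2: "dn * (b * ?x powr s) powr (1 + \<epsilon>) \<le> ?x powr (s + (2 * real r - 1) * (\<eta> / 2))"
      and E3: "2 ^ (2 * r) * dn * (b * ?x powr s) powr \<epsilon> \<le> ?x powr (2 * e - 1)"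
      and E4: "4 * dn * (b * ?x powr s) powr \<epsilon> \<le> ?x powr (2 * e - 2 + s)"
      and E5: "4 * sh * (?x powr e + 1) \<le> ?x powr (e - 1 + s)"
      and E6: "real (d + 1) \<le> ?x powr (\<theta> + \<eta>)"
      and E7: "(ln 2 + 1) - (\<eta> / 2) * ln ?x \<le> - 1"
      and E8: "real (2 * r) * (?x powr e + 1)
        * ((4 * sh * ln (b * ?x powr s) + 1) * ln (b * ?x powr s)) + ln 2 < ?x powr (\<theta> + \<eta>)"
    have x0: "?x > 0" using x1 by linarith
    define P where "P D \<longleftrightarrow> C1 * ?x ^ (d + 1) \<le> (real k ^ D)\<^sup>2" for D
    obtain n where "C1 * ?x ^ (d + 1) < real k ^ n"
      using real_arch_pow[of "real k" "C1 * ?x ^ (d + 1)"] k by auto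
    moreover have "real k ^ n \<le> (real k ^ n)\<^sup>2" using k by (simp add: power2_eq_square)
    ultimately have "P n" by (simp add: P_def)
    \<comment> \<open>minimality of \<open>D\<close> keeps \<open>M\<close> within a factor \<open>b\<close> of \<open>x ^ s\<close>\<close>
    define D where "D = (LEAST D. P D)"
    have PD: "P D" unfolding D_def by (rule LeastI) fact
    have xs: "(?x powr s)\<^sup>2 = ?x ^ (d + 1)"
    proof -
      have "(?x powr s)\<^sup>2 = ?x powr (s + s)" by (simp only: power2_eq_square powr_add)
      also have "s + s = real (d + 1)" by (simp add: s_def)
      also have "?x powr real (d + 1) = ?x ^ (d + 1)" using x0 by (rule powr_realpow)
      finally show ?thesis .
    qed
    define M where "M = real k ^ D"
    have M0: "M > 0" using k by (simp add: M_def)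
    have Mlow: "?x powr s \<le> M"
    proof -
      have "1 * ?x ^ (d + 1) \<le> C1 * ?x ^ (d + 1)" using C1 by (intro mult_right_mono) auto
      also have "\<dots> \<le> M\<^sup>2" using PD by (simp only: P_def M_def)
      finally have "(?x powr s)\<^sup>2 \<le> M\<^sup>2" by (simp only: xs mult_1)
      then show ?thesis using M0 by (rule power2_le_imp_le[OF _ less_imp_le])
    qed
    have "D > 0"
    proof (rule ccontr)
      assume "\<not> D > 0"
      then have "M = 1" by (simp add: M_def)
      then show False using Mlow E1 x1 by simp
    qed
    then have "\<not> P (D - 1)" unfolding D_def by (intro not_less_Least) simp
    then have "(real k ^ (D - 1))\<^sup>2 \<le> C1 * ?x ^ (d + 1)" by (simp add: P_def)
    then have "(real k)\<^sup>2 * (real k ^ (D - 1))\<^sup>2 \<le> (real k)\<^sup>2 * (C1 * ?x ^ (d + 1))"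
      by (rule mult_left_mono) simp
    also have "(real k)\<^sup>2 * (real k ^ (D - 1))\<^sup>2 = M\<^sup>2"
      using \<open>D > 0\<close> unfolding M_def power_mult_distrib[symmetric] by (simp flip: power_Suc)
    also have "(real k)\<^sup>2 * (C1 * ?x ^ (d + 1)) = (b * ?x powr s)\<^sup>2"
      using C1 by (simp add: b_def power_mult_distrib xs)
    finally have Mup: "M \<le> b * ?x powr s"
      by (rule power2_le_imp_le) (use b in simp)
    have M1: "M \<ge> 1" using k by (simp add: M_def)
    define Q where "Q = (real r * real k) ^ D"
    have Qle: "Q \<le> M * M powr \<epsilon>"
    proof -
      have "Q \<le> (real k powr \<epsilon> * real k) ^ D"
        unfolding Q_def using \<epsilon> by (intro power_mono mult_right_mono) auto
      also have "\<dots> = (real k powr \<epsilon>) ^ D * M" by (simp add: power_mult_distrib M_def)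
      also have "(real k powr \<epsilon>) ^ D = M powr \<epsilon>"
        using k by (simp add: M_def powr_powr powr_power mult.commute flip: powr_realpow)
      finally show ?thesis by (simp add: mult.commute)
    qed
    have Meps: "M powr \<epsilon> \<le> (b * ?x powr s) powr \<epsilon>"
      using Mup M0 \<epsilon> by (intro powr_mono2) auto
    have QB: "Q \<le> M * (b * ?x powr s) powr \<epsilon>"
      using Qle mult_left_mono[OF Meps, of M] M0 by linarith
    define L where "L = nat \<lceil>?x powr e\<rceil>"
    define t where "t = nat \<lceil>?x powr (\<theta> + \<eta>)\<rceil>"
    \<comment> \<open>so that \<open>R\<close> rounds of shrinking bring \<open>M\<close> down to at most \<open>1\<close>\<close>
    define R where "R = nat \<lceil>4 * sh * ln M\<rceil>"
    define m where "m = ?x powr e * (M / ?x)"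
    have xe1: "?x powr e \<ge> 1" using x1 e0 by (simp add: ge_one_powr_ge_zero)
    have L: "?x powr e \<le> real L" "real L \<le> ?x powr e + 1"
      unfolding L_def using xe1 by linarith+
    have t: "?x powr (\<theta> + \<eta>) \<le> real t" "real t < ?x powr (\<theta> + \<eta>) + 1"
      unfolding t_def using E6 by linarith+
    have lnM: "0 \<le> ln M" "ln M \<le> ln (b * ?x powr s)" using M1 Mup M0 by simp_all
    have "0 \<le> 4 * sh * ln M" using lnM(1) c by simp
    then have R: "4 * sh * ln M \<le> real R" "real R \<le> 4 * sh * ln M + 1"
      unfolding R_def by linarith+
    have m0: "m > 0" using x0 M0 by (simp add: m_def)
    have c1: "2 * ?x \<le> M" using E1 Mlow by linarith
    have c2: "4 * (C0 * M ^ d) * (2 * ?x / M) ^ (d + 2) \<le> 2 * ?x"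
    proof -
      have "4 * (C0 * M ^ d) * (2 * ?x / M) ^ (d + 2) = (C1 * ?x ^ (d + 1)) * (2 * ?x) / M\<^sup>2"
        using M0 by (simp add: C1_def power_divide power_add power_mult_distrib field_simps power2_eq_square)
      also have "\<dots> \<le> M\<^sup>2 * (2 * ?x) / M\<^sup>2"
        using PD unfolding P_def M_def[symmetric]
        by (intro divide_right_mono mult_right_mono) auto
      also have "\<dots> = 2 * ?x" using M0 by simp
      finally show ?thesis .
    qed
    have c3: "4 * dn * Q \<le> m\<^sup>2"
    proof -
      have "4 * dn * Q \<le> 4 * dn * (M * (b * ?x powr s) powr \<epsilon>)"
        using c by (intro mult_left_mono[OF QB]) auto
      also have "\<dots> = M * (4 * dn * (b * ?x powr s) powr \<epsilon>)" by simp
      also have "\<dots> \<le> M * (?x powr (2 * e - 2 + s))" using E4 M0 by (intro mult_left_mono) auto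
      also have "\<dots> = M * (?x powr (2 * e - 2) * ?x powr s)" by (simp add: powr_add)
      also have "\<dots> \<le> M * (?x powr (2 * e - 2) * M)"
        using Mlow M0 by (intro mult_left_mono) auto
      also have "\<dots> = m\<^sup>2"
      proof -
        have "?x powr (2 * e - 2) = (?x powr e)\<^sup>2 / ?x\<^sup>2"
          using x0 by (simp add: powr_diff power2_eq_square flip: powr_add)
        then show ?thesis by (simp add: m_def power2_eq_square)
      qed
      finally show ?thesis .
    qed
    have c4: "2 ^ (2 * r) * dn * Q \<le> m * real L"
    proof -
      have "2 ^ (2 * r) * dn * Q \<le> 2 ^ (2 * r) * dn * (M * (b * ?x powr s) powr \<epsilon>)"
        using c by (intro mult_left_mono[OF QB]) auto
      also have "\<dots> = M * (2 ^ (2 * r) * dn * (b * ?x powr s) powr \<epsilon>)" by simp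
      also have "\<dots> \<le> M * (?x powr (2 * e - 1))" using E3 M0 by (intro mult_left_mono) auto
      also have "?x powr (2 * e - 1) = ?x powr e * ?x powr e / ?x"
        using x0 by (simp add: powr_diff flip: powr_add)
      also have "M * (?x powr e * ?x powr e / ?x) = m * ?x powr e" by (simp add: m_def)
      also have "\<dots> \<le> m * real L" using L m0 by (intro mult_left_mono) auto
      finally show ?thesis .
    qed
    have c5: "dn * Q \<le> real L ^ (2 * r - 1)"
    proof -
      have "dn * Q \<le> dn * (M * M powr \<epsilon>)" using Qle c by (intro mult_left_mono) auto
      also have "M * M powr \<epsilon> = M powr (1 + \<epsilon>)" using M0 by (simp add: powr_add)
      also have "dn * M powr (1 + \<epsilon>) \<le> dn * (b * ?x powr s) powr (1 + \<epsilon>)"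
        using Mup M0 \<epsilon> c by (intro mult_left_mono powr_mono2) auto
      also have "\<dots> \<le> ?x powr (s + (2 * real r - 1) * (\<eta> / 2))" by (rule E2)
      also have "s + (2 * real r - 1) * (\<eta> / 2) = e * (2 * real r - 1)"
        using q by (simp add: e_def \<theta>_def distrib_right)
      also have "2 * real r - 1 = real (2 * r - 1)" using r by simp
      also have "?x powr (e * real (2 * r - 1)) = (?x powr e) ^ (2 * r - 1)"
        using x0 by (simp flip: powr_powr powr_realpow)
      also have "\<dots> \<le> real L ^ (2 * r - 1)" using L by (intro power_mono) auto
      finally show ?thesis .
    qed
    have c6: "4 * sh * real L \<le> m"
    proof -
      have "4 * sh * real L \<le> 4 * sh * (?x powr e + 1)" using L c by (intro mult_left_mono) auto
      also have "\<dots> \<le> ?x powr (e - 1 + s)" by (rule E5)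
      also have "\<dots> = ?x powr e * (?x powr s / ?x)" using x0 by (simp add: powr_add powr_diff)
      also have "\<dots> \<le> m" unfolding m_def using Mlow x0 by (intro mult_left_mono divide_right_mono) auto
      finally show ?thesis .
    qed
    have L0: "L > 0" using L xe1 by linarith
    have m1: "m \<ge> 1"
    proof -
      have "1 * 1 \<le> (4 * sh) * real L" using c L0 by (intro mult_mono) auto
      then show ?thesis using c6 by linarith
    qed
    have c7: "(1 - 1 / (4 * sh)) ^ R * M \<le> m"
    proof -
      have "1 - 1 / (4 * sh) \<le> exp (- (1 / (4 * sh)))"
        using exp_ge_add_one_self[of "- (1 / (4 * sh))"] by simp
      moreover have "0 \<le> 1 - 1 / (4 * sh)" using c by (simp add: field_simps)
      ultimately have "(1 - 1 / (4 * sh)) ^ R \<le> exp (- (1 / (4 * sh))) ^ R"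
        by (intro power_mono) auto
      also have "\<dots> = exp (- (real R / (4 * sh)))" by (simp flip: exp_of_nat_mult)
      also have "\<dots> \<le> exp (- ln M)" using R c by (simp add: field_simps)
      also have "\<dots> = 1 / M" using M0 by (simp add: exp_minus field_simps)
      finally have "(1 - 1 / (4 * sh)) ^ R * M \<le> 1 / M * M" using M0 by (intro mult_right_mono) auto
      then show ?thesis using M0 m1 by simp
    qed
    have c8: "t \<ge> d + 1" using E6 t(1) by linarith
    have t0: "real t > 0" using c8 by simp
    have c9: "2 * M ^ (2 * r * L * R) * (m ^ t / fact t) * (2 * ?x / M) ^ t < 1"
    proof -
      have mx: "m * (2 * ?x / M) = 2 * ?x powr e" using x0 M0 by (simp add: m_def)
      have "(m ^ t / fact t) * (2 * ?x / M) ^ t = (m * (2 * ?x / M)) ^ t / fact t"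
        by (simp only: power_mult_distrib times_divide_eq_left)
      also have "\<dots> = (2 * ?x powr e) ^ t / fact t" by (simp only: mx)
      also have "\<dots> = (2 * ?x powr e / real t) ^ t * (real t ^ t / fact t)"
        using t0 by (simp add: power_divide)
      also have "\<dots> \<le> (2 * ?x powr e / real t) ^ t * exp (real t)"
        using power_le_fact_exp[of t] t0
        by (intro mult_left_mono) (auto simp: pos_divide_le_eq mult.commute)
      also have "\<dots> \<le> exp (ln 2 - (\<eta> / 2) * ln ?x) ^ t * exp (real t)"
      proof (intro mult_right_mono power_mono)
        have "2 * ?x powr e / real t \<le> 2 * ?x powr e / ?x powr (\<theta> + \<eta>)"
          using t(1) x0 t0 by (intro divide_left_mono mult_pos_pos) auto
        also have "\<dots> = 2 * ?x powr (- (\<eta> / 2))"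
        proof -
          have "?x powr e = ?x powr (\<theta> + \<eta>) * ?x powr (- (\<eta> / 2))"
            by (simp only: e_def flip: powr_add) (simp add: add.commute)
          then show ?thesis using x0 by simp
        qed
        also have "\<dots> = exp (ln 2) * exp (- (\<eta> / 2) * ln ?x)"
          using x0 by (simp add: powr_def)
        also have "\<dots> = exp (ln 2 - (\<eta> / 2) * ln ?x)"
          by (simp only: exp_add[symmetric]) simp
        finally show "2 * ?x powr e / real t \<le> exp (ln 2 - (\<eta> / 2) * ln ?x)" .
      qed (use t0 in auto)
      also have "\<dots> = exp (real t * ((ln 2 + 1) - (\<eta> / 2) * ln ?x))"
        by (simp flip: exp_of_nat_mult exp_add) (simp add: algebra_simps)
      also have "\<dots> \<le> exp (- real t)"
        using mult_left_mono[OF E7, of "real t"] by simp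
      finally have A: "(m ^ t / fact t) * (2 * ?x / M) ^ t \<le> exp (- real t)" .
      have "real (2 * r * L * R) * ln M + ln 2 < real t"
      proof -
        have "real R * ln M \<le> (4 * sh * ln M + 1) * ln M" using R lnM by (intro mult_right_mono) auto
        also have "\<dots> \<le> (4 * sh * ln (b * ?x powr s) + 1) * ln (b * ?x powr s)"
          using lnM c by (intro mult_mono add_mono mult_left_mono) auto
        finally have RM: "real R * ln M
          \<le> (4 * sh * ln (b * ?x powr s) + 1) * ln (b * ?x powr s)" .
        have "real (2 * r) * real L * (real R * ln M)
          \<le> real (2 * r) * (?x powr e + 1) * (real R * ln M)"
          using L lnM by (intro mult_right_mono mult_left_mono mult_nonneg_nonneg) auto
        also have "\<dots> \<le> real (2 * r) * (?x powr e + 1)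
            * ((4 * sh * ln (b * ?x powr s) + 1) * ln (b * ?x powr s))"
          using xe1 by (intro mult_left_mono[OF RM] mult_nonneg_nonneg) auto
        finally have "real (2 * r) * real L * (real R * ln M) \<le> \<dots>" .
        then show ?thesis using E8 t(1) by (simp add: mult.assoc)
      qed
      then have "exp (real (2 * r * L * R) * ln M + ln 2 + - real t) < exp 0"
        unfolding exp_less_cancel_iff by linarith
      then have B: "2 * M ^ (2 * r * L * R) * exp (- real t) < 1"
        using M0 by (simp only: exp_add exp_of_nat_mult exp_ln exp_zero)
      have "2 * M ^ (2 * r * L * R) * ((m ^ t / fact t) * (2 * ?x / M) ^ t)
          \<le> 2 * M ^ (2 * r * L * R) * exp (- real t)"
        using A M0 by (intro mult_left_mono) auto
      then show ?thesis using B by (simp only: mult.assoc)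
    qed
    have "N > 0" using x0 by simp
    then show "\<exists>D L R t m. N > 0 \<and> 2 * real N \<le> real k ^ D \<and>
      4 * (C0 * (real k ^ D) ^ d) * (2 * real N / real k ^ D) ^ (d + 2) \<le> 2 * real N \<and>
      L > 0 \<and> m > 0 \<and>
      4 * dn * (real r * real k) ^ D \<le> m\<^sup>2 \<and>
      2 ^ (2 * r) * dn * (real r * real k) ^ D \<le> m * real L \<and>
      dn * (real r * real k) ^ D \<le> real L ^ (2 * r - 1) \<and>
      4 * sh * real L \<le> m \<and>
      (1 - 1 / (4 * sh)) ^ R * real k ^ D \<le> m \<and>
      t \<ge> d + 1 \<and>
      2 * (real k ^ D) ^ (2 * r * L * R) * (m ^ t / fact t) * (2 * real N / real k ^ D) ^ t < 1 \<and>
      real t < real N powr (\<theta> + \<eta>) + 1"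
      using c1 c2 L0 m0 c3 c4 c5 c6 c7 c8 c9 t(2)
      unfolding M_def Q_def
      by (intro exI[of _ D] exI[of _ L] exI[of _ R] exI[of _ t] exI[of _ m] conjI)
  qed
qed

section \<open>The upper bound\<close>

lemma eventually_alpha_less:
  fixes r :: nat and \<eta> :: real
  defines "\<theta> \<equiv> ((real CARD('n::finite) + 1) / 2) / (2 * real r - 1)"
  assumes d: "CARD('n) \<ge> 3" and r: "r \<ge> 2" "2 * r \<le> CARD('n) + 1" and \<eta>: "\<eta> > 0"
  shows "\<forall>\<^sub>F N in sequentially. real (alpha TYPE('n) N) < real N powr (\<theta> + \<eta>)"
proof -
  define s where "s = (real CARD('n) + 1) / 2"
  define \<epsilon> where "\<epsilon> = \<eta> / (4 * s)"
  have s: "s > 0" by (simp add: s_def)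
  have \<epsilon>: "\<epsilon> > 0" "s * \<epsilon> \<le> \<eta> / 4" using s \<eta> by (simp_all add: \<epsilon>_def)
  \<comment> \<open>large enough for \<open>r \<le> k powr \<epsilon>\<close>\<close>
  define k where "k = nat \<lceil>real r powr (1 / \<epsilon>)\<rceil> + 2"
  have k: "k \<ge> 2" by (simp add: k_def)
  have "real r powr (1 / \<epsilon>) \<le> real k" unfolding k_def by linarith
  then have "(real r powr (1 / \<epsilon>)) powr \<epsilon> \<le> real k powr \<epsilon>" using \<epsilon> by (intro powr_mono2) auto
  then have rk: "real r \<le> real k powr \<epsilon>" using \<epsilon> r by (simp add: powr_powr)
  let ?C0 = "2 ^ card (cube k :: (real ^ 'n option option) set) :: real"
  have C0: "?C0 \<ge> 1" by (rule one_le_power) simp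
  note params = eventually_parameters[OF d r k edge_const_ge_1[OF r(1)] container_const_ge_1[OF r(1)] C0 \<eta>
      \<epsilon>(1) \<epsilon>(2)[unfolded s_def] rk]
  from params show ?thesis
  proof (rule eventually_mono, elim exE conjE)
    fix N D L R t :: nat and m :: real
    assume *: "N > 0" "2 * real N \<le> real k ^ D"
      "4 * (?C0 * (real k ^ D) ^ CARD('n)) * (2 * real N / real k ^ D) ^ (CARD('n) + 2) \<le> 2 * real N"
      "L > 0" "m > 0"
      "4 * edge_const r * (real r * real k) ^ D \<le> m\<^sup>2"
      "2 ^ (2 * r) * edge_const r * (real r * real k) ^ D \<le> m * real L"
      "edge_const r * (real r * real k) ^ D \<le> real L ^ (2 * r - 1)"
      "4 * container_const r * real L \<le> m"
      "(1 - 1 / (4 * container_const r)) ^ R * real k ^ D \<le> m"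
      "t \<ge> CARD('n) + 1"
      "2 * (real k ^ D) ^ (2 * r * L * R) * (m ^ t / fact t) * (2 * real N / real k ^ D) ^ t < 1"
      "real t < real N powr ((real CARD('n) + 1) / 2 / (2 * real r - 1) + \<eta>) + 1"
    have "alpha TYPE('n) N < t"
      by (rule alpha_less[OF _ r *(1-12)]) (use k in simp)
    then have "real (alpha TYPE('n) N) + 1 \<le> real t" by linarith
    then show "real (alpha TYPE('n) N) < real N powr (\<theta> + \<eta>)"
      using *(13) by (simp add: \<theta>_def)
  qed
qed

text \<open>
  The exponent is read off from \<open>f\<close>. The term \<open>1 / N\<close> makes the inequality strict.
\<close>

lemma ex_vanishing_exponent:
  fixes f :: "nat \<Rightarrow> nat" and \<theta> :: real
  assumes "\<theta> \<ge> 0" and less: "\<And>\<eta>. \<eta> > 0 \<Longrightarrow> \<forall>\<^sub>F N in sequentially. real (f N) < real N powr (\<theta> + \<eta>)"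
  shows "\<exists>\<epsilon> :: nat \<Rightarrow> real. \<epsilon> \<longlonglongrightarrow> 0 \<and>
    (\<forall>\<^sub>F N in sequentially. real (f N) < real N powr (\<theta> + \<epsilon> N))"
proof -
  define \<delta> where "\<delta> N = max 0 (log (real N) (real (f N)) - \<theta>)" for N
  have "\<delta> \<longlonglongrightarrow> 0"
  proof (rule LIMSEQ_I)
    fix \<eta> :: real assume \<eta>: "\<eta> > 0"
    have "\<forall>\<^sub>F N in sequentially. norm (\<delta> N - 0) < \<eta>"
      using less[of "\<eta> / 2", OF half_gt_zero[OF \<eta>]] eventually_gt_at_top[of 1]
    proof eventually_elim
      case (elim N)
      have N: "real N > 1" using elim \<eta> by simp
      have "log (real N) (real (f N)) - \<theta> < \<eta>"
      proof (cases "f N = 0")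
        case True
        then show ?thesis using assms(1) \<eta> by (simp add: log_def)
      next
        case False
        then have "log (real N) (real (f N)) < \<theta> + \<eta> / 2"
          using elim N \<eta> by (subst log_less_iff) auto
        then show ?thesis using \<eta> by simp
      qed
      then show ?case using \<eta> by (simp add: \<delta>_def)
    qed
    then show "\<exists>no. \<forall>N\<ge>no. norm (\<delta> N - 0) < \<eta>" by (simp add: eventually_sequentially)
  qed
  then have "(\<lambda>N. \<delta> N + 1 / real N) \<longlonglongrightarrow> 0 + 0"
    by (intro tendsto_add lim_1_over_n)
  moreover have "\<forall>\<^sub>F N in sequentially. real (f N) < real N powr (\<theta> + (\<delta> N + 1 / real N))"
    using eventually_gt_at_top[of 1]
  proof eventually_elim
    case (elim N)
    then have N: "real N > 1" by simp
    show ?case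
    proof (cases "f N = 0")
      case False
      have "log (real N) (real (f N)) < \<theta> + (\<delta> N + 1 / real N)"
      proof -
        have "log (real N) (real (f N)) - \<theta> \<le> \<delta> N" by (simp add: \<delta>_def)
        moreover have "0 < 1 / real N" using N by simp
        ultimately show ?thesis by linarith
      qed
      then show ?thesis using False N by (simp add: log_less_iff)
    qed (use N in simp)
  qed
  ultimately show ?thesis by (intro exI[of _ "\<lambda>N. \<delta> N + 1 / real N"]) simp
qed

theorem theorem1p1:
  assumes "CARD('n::finite) \<ge> 3"
  shows "(odd CARD('n) \<longrightarrow>
           (\<exists>\<epsilon> :: nat \<Rightarrow> real. \<epsilon> \<longlonglongrightarrow> 0 \<and>
             (\<forall>\<^sub>F N in sequentially.
               real (alpha TYPE('n) N)
                 < real N powr (1 / 2 + 1 / (2 * real CARD('n)) + \<epsilon> N)))) \<and>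
         (even CARD('n) \<longrightarrow>
           (\<exists>\<epsilon> :: nat \<Rightarrow> real. \<epsilon> \<longlonglongrightarrow> 0 \<and>
             (\<forall>\<^sub>F N in sequentially.
               real (alpha TYPE('n) N)
                 < real N powr (1 / 2 + 1 / (real CARD('n) - 1) + \<epsilon> N))))"
proof (intro conjI impI)
  assume "odd CARD('n)"
  then obtain j where j: "CARD('n) = 2 * j + 1" by (rule oddE)
  have eq: "((real CARD('n) + 1) / 2) / (2 * real (j + 1) - 1) = 1 / 2 + 1 / (2 * real CARD('n))"
    using assms j by (simp add: field_simps)
  have r: "2 \<le> j + 1" "2 * (j + 1) \<le> CARD('n) + 1" using assms j by auto
  show "\<exists>\<epsilon> :: nat \<Rightarrow> real. \<epsilon> \<longlonglongrightarrow> 0 \<and> (\<forall>\<^sub>F N in sequentially.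
      real (alpha TYPE('n) N) < real N powr (1 / 2 + 1 / (2 * real CARD('n)) + \<epsilon> N))"
  proof (rule ex_vanishing_exponent)
    show "0 \<le> 1 / 2 + 1 / (2 * real CARD('n))" using assms by simp
    show "\<forall>\<^sub>F N in sequentially.
        real (alpha TYPE('n) N) < real N powr (1 / 2 + 1 / (2 * real CARD('n)) + \<eta>)" if "\<eta> > 0" for \<eta>
      using eventually_alpha_less[where 'n = 'n, OF assms r that] unfolding eq .
  qed
next
  assume "even CARD('n)"
  then obtain j where j: "CARD('n) = 2 * j" by (rule evenE)
  have eq: "((real CARD('n) + 1) / 2) / (2 * real (j) - 1) = 1 / 2 + 1 / (real CARD('n) - 1)"
    using assms j by (simp add: field_simps)
  have r: "2 \<le> j" "2 * (j) \<le> CARD('n) + 1" using assms j by auto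
  show "\<exists>\<epsilon> :: nat \<Rightarrow> real. \<epsilon> \<longlonglongrightarrow> 0 \<and> (\<forall>\<^sub>F N in sequentially.
      real (alpha TYPE('n) N) < real N powr (1 / 2 + 1 / (real CARD('n) - 1) + \<epsilon> N))"
  proof (rule ex_vanishing_exponent)
    show "0 \<le> 1 / 2 + 1 / (real CARD('n) - 1)" using assms by simp
    show "\<forall>\<^sub>F N in sequentially.
        real (alpha TYPE('n) N) < real N powr (1 / 2 + 1 / (real CARD('n) - 1) + \<eta>)" if "\<eta> > 0" for \<eta>
      using eventually_alpha_less[where 'n = 'n, OF assms r that] unfolding eq .
  qed
qed

end
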